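(* Let $\mathcal{G}$ be a periodic metric graph in the class $\mathbf{G}$. Then for every $p>6$ there exists $\mu_{p,\mathcal{G}}>0$, depending on $p$ and $\mathcal{G}$, such that for every $\mu\in(0,\mu_{p,\mathcal{G}}]$ problem \[ \begin{cases} u''+u^{p-1}=\lambda u & \text{on every edge of }\mathcal{G},\\ u\in H^1(\mathcal{G}),\ u>0 & \text{on }\mathcal{G},\\ \sum_{e\succ \mathrm{v}}\frac{du}{dx_e}(\mathrm{v})=0 & \text{for every vertex }\mathrm{v}, \end{cases} \] admits a solution $(u,\lambda)$ with $u\in H^1_\mu(\mathcal{G})$, $E(u,\mathcal{G})>0$ and $\lambda>0$.
   Context: A metric graph $\mathcal{G}=(\mathbb{V},\mathbb{E})$ belongs to the class $\mathbf{G}$ if it is connected, has at most countably many edges, every vertex has finite degree, and $e_0:=\inf_{e\in\mathbb{E}}|e|>0$. A periodic graph is a graph with infinitely many edges, of uniformly bounded length, arranged in a periodic pattern (in the sense of Berkolaiko–Kuchment: there is a free action of $\mathbb{Z}^d$ on $\mathcal G$ by graph isometries with compact quotient). $H^1(\mathcal{G})$ is the space of continuous functions on $\mathcal{G}$, $H^1$ on each edge, with finite $H^1$ norm; $H^1_\mu(\mathcal{G})=\{v\in H^1(\mathcal{G}):\|v\|_{L^2(\mathcal{G})}^2=\mu\}$; $E(u,\mathcal{G})=\frac12\|u'\|_{L^2}^2-\frac1p\|u\|_{L^p}^p$. In the vertex condition, $e\succ\mathrm v$ means $e$ is incident at $\mathrm v$, and $\frac{du}{dx_e}(\mathrm v)$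 is the outgoing derivative of $u$ at $\mathrm v$ along $e$. *)

theory Defs
  imports "HOL-Analysis.Analysis"
begin

text \<open>A metric graph with (all) edges of finite length is given by a vertex type 'v,
an edge type 'e, and for every edge e an origin src e, a terminus tgt e and a length len e.
The edge e is identified with the interval [0, len e], the point 0 sitting at src e
and the point len e sitting at tgt e.  A function on the graph is a family u e of
real functions on [0, len e].\<close>

definition graph_adj :: "('e \<Rightarrow> 'v) \<Rightarrow> ('e \<Rightarrow> 'v) \<Rightarrow> ('v \<times> 'v) set" where
  "graph_adj src tgt = {(v, w). \<exists>e. (src e = v \<and> tgt e = w) \<or> (src e = w \<and> tgt e = v)}"

definition graph_connected :: "('e \<Rightarrow> 'v) \<Rightarrow> ('e \<Rightarrow> 'v) \<Rightarrow> bool" where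
  "graph_connected src tgt \<longleftrightarrow> (\<forall>v w. (v, w) \<in> (graph_adj src tgt)\<^sup>*)"

text \<open>The class G: connected, at most countably many edges, finite degrees,
infimum of edge lengths positive.\<close>
definition in_class_G :: "('e \<Rightarrow> 'v) \<Rightarrow> ('e \<Rightarrow> 'v) \<Rightarrow> ('e \<Rightarrow> real) \<Rightarrow> bool" where
  "in_class_G src tgt len \<longleftrightarrow>
     graph_connected src tgt \<and>
     countable (UNIV :: 'e set) \<and>
     (\<forall>v. finite {e. src e = v \<or> tgt e = v}) \<and>
     (\<exists>c>0. \<forall>e. c \<le> len e)"

text \<open>The lattice Z^d, represented as integer sequences vanishing from index d on.\<close>
definition Zd :: "nat \<Rightarrow> (nat \<Rightarrow> int) set" where
  "Zd d = {g. \<forall>i\<ge>d. g i = 0}"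

text \<open>A free action of Z^d by graph isometries with compact quotient.
sv g, se g are the actions on vertices and edges; rv g e says whether the isometry g
maps the edge e onto se g e reversing its orientation
(i.e. the point x of e is sent to the point len e - x of se g e).\<close>
definition Zd_periodic_action ::
  "('e \<Rightarrow> 'v) \<Rightarrow> ('e \<Rightarrow> 'v) \<Rightarrow> ('e \<Rightarrow> real) \<Rightarrow> nat \<Rightarrow>
   ((nat \<Rightarrow> int) \<Rightarrow> 'v \<Rightarrow> 'v) \<Rightarrow> ((nat \<Rightarrow> int) \<Rightarrow> 'e \<Rightarrow> 'e) \<Rightarrow> ((nat \<Rightarrow> int) \<Rightarrow> 'e \<Rightarrow> bool) \<Rightarrow> bool"
  where
  "Zd_periodic_action src tgt len d sv se rv \<longleftrightarrow>
     \<comment> \<open>group action\<close>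
     sv (\<lambda>_. 0) = id \<and> se (\<lambda>_. 0) = id \<and> (\<forall>e. \<not> rv (\<lambda>_. 0) e) \<and>
     (\<forall>g\<in>Zd d. \<forall>h\<in>Zd d.
        sv (\<lambda>i. g i + h i) = sv g \<circ> sv h \<and>
        se (\<lambda>i. g i + h i) = se g \<circ> se h \<and>
        (\<forall>e. rv (\<lambda>i. g i + h i) e = (rv g (se h e) \<noteq> rv h e))) \<and>
     \<comment> \<open>by graph isometries\<close>
     (\<forall>g\<in>Zd d. \<forall>e.
        len (se g e) = len e \<and>
        (if rv g e then src (se g e) = sv g (tgt e) \<and> tgt (se g e) = sv g (src e)
         else src (se g e) = sv g (src e) \<and> tgt (se g e) = sv g (tgt e))) \<and>
     \<comment> \<open>free\<close>
     (\<forall>g\<in>Zd d. g \<noteq> (\<lambda>_. 0) \<longrightarrow> (\<forall>v. sv g v \<noteq> v) \<and> (\<forall>e. se g e \<noteq> e)) \<and>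
     \<comment> \<open>compact quotient: finitely many orbits of vertices and of edges\<close>
     (\<exists>FV FE. finite FV \<and> finite FE \<and>
        (\<forall>v. \<exists>g\<in>Zd d. \<exists>w\<in>FV. v = sv g w) \<and>
        (\<forall>e. \<exists>g\<in>Zd d. \<exists>f\<in>FE. e = se g f))"

definition periodic_graph :: "('e \<Rightarrow> 'v) \<Rightarrow> ('e \<Rightarrow> 'v) \<Rightarrow> ('e \<Rightarrow> real) \<Rightarrow> bool" where
  "periodic_graph src tgt len \<longleftrightarrow>
     infinite (UNIV :: 'e set) \<and>
     (\<exists>L. \<forall>e. len e \<le> L) \<and>
     (\<exists>d sv se rv. Zd_periodic_action src tgt len d sv se rv)"

text \<open>Squared L^2 norm, L^p norm to the p, and the energy.\<close>
definition graph_mass :: "('e \<Rightarrow> real) \<Rightarrow> ('e \<Rightarrow> real \<Rightarrow> real) \<Rightarrow> real" where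
  "graph_mass len u = (\<Sum>\<^sub>\<infinity>e. integral {0..len e} (\<lambda>x. (u e x)\<^sup>2))"

definition graph_energy ::
  "('e \<Rightarrow> real) \<Rightarrow> real \<Rightarrow> ('e \<Rightarrow> real \<Rightarrow> real) \<Rightarrow> ('e \<Rightarrow> real \<Rightarrow> real) \<Rightarrow> real" where
  "graph_energy len p u u' =
     1/2 * (\<Sum>\<^sub>\<infinity>e. integral {0..len e} (\<lambda>x. (u' e x)\<^sup>2))
     - 1/p * (\<Sum>\<^sub>\<infinity>e. integral {0..len e} (\<lambda>x. \<bar>u e x\<bar> powr p))"

text \<open>(u, lambda) solves the stationary NLS problem with Kirchhoff conditions;
u' is the derivative of u along each edge (on the closed edge) and u'' its second
derivative (in the interior of each edge).\<close>
definition NLS_Kirchhoff_solution ::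
  "('e \<Rightarrow> 'v) \<Rightarrow> ('e \<Rightarrow> 'v) \<Rightarrow> ('e \<Rightarrow> real) \<Rightarrow> real \<Rightarrow> real \<Rightarrow>
   ('e \<Rightarrow> real \<Rightarrow> real) \<Rightarrow> ('e \<Rightarrow> real \<Rightarrow> real) \<Rightarrow> ('e \<Rightarrow> real \<Rightarrow> real) \<Rightarrow> bool" where
  "NLS_Kirchhoff_solution src tgt len p lam u u' u'' \<longleftrightarrow>
     \<comment> \<open>regularity on each edge\<close>
     (\<forall>e. \<forall>x\<in>{0..len e}. (u e has_real_derivative u' e x) (at x within {0..len e})) \<and>
     (\<forall>e. \<forall>x\<in>{0<..<len e}. (u' e has_real_derivative u'' e x) (at x)) \<and>
     \<comment> \<open>continuity at the vertices\<close>
     (\<exists>\<phi>. \<forall>e. u e 0 = \<phi> (src e) \<and> u e (len e) = \<phi> (tgt e)) \<and>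
     \<comment> \<open>finite H^1 norm\<close>
     ((\<lambda>e. integral {0..len e} (\<lambda>x. (u' e x)\<^sup>2 + (u e x)\<^sup>2)) summable_on UNIV) \<and>
     \<comment> \<open>positivity\<close>
     (\<forall>e. \<forall>x\<in>{0..len e}. u e x > 0) \<and>
     \<comment> \<open>the equation on every edge\<close>
     (\<forall>e. \<forall>x\<in>{0<..<len e}. u'' e x + (u e x) powr (p - 1) = lam * u e x) \<and>
     \<comment> \<open>Kirchhoff condition: sum of outgoing derivatives vanishes\<close>
     (\<forall>v. (\<Sum>e\<in>{e. src e = v}. u' e 0) + (\<Sum>e\<in>{e. tgt e = v}. - u' e (len e)) = 0)"

end

theory Submission
  imports Defs
begin

text \<open>
With \<open>\<lambda> = k\<^sup>2\<close> and \<open>u = k powr (2 / (p - 2)) * v\<close> the equation becomes \<open>v'' = k\<^sup>2 (v - v powr (p - 1))\<close>,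
and for \<open>p > 6\<close> a single bump \<open>v\<close> with \<open>k\<close> large gives small mass and positive energy.
The bump sits on a path whose interior vertices have degree two. It is a piece of the phase-plane orbit of height \<open>h\<close>,
slightly above the homoclinic one, cut off at the small values \<open>a\<close> and \<open>b\<close>; these three numbers
determine \<open>k\<close>, as the orbit has to fit into the path. Outside the path the solution is small and is obtained by a contraction
based on the Green functions of the edges, with weights decaying geometrically in the combinatorial distance to the path;
it depends continuously on \<open>(k, a, b)\<close>, and its outgoing derivatives at the path are
close to \<open>- k a\<close>, \<open>- k b\<close>.
If the path joins two vertices of degree at least three, then the two remaining Kirchhoff conditions and the mass
constraint are three scalar equations in \<open>(h, a, b)\<close>, solved by the Poincare-Miranda theorem:
for \<open>a\<close> of the order of \<open>sqrt (2 * lev p h)\<close> the orbit has slope at least that order, while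
the outer edges ask for \<open>(deg - 1) * a\<close>; and the mass tends to \<open>0\<close> as \<open>h\<close> tends to the homoclinic height.
If all degrees are two, the homoclinic orbit itself matches exactly, because the conserved energy of the outer solution
vanishes at infinity, and the mass is adjusted by the intermediate value theorem.
\<close>

section \<open>Ordinary differential equations with Lipschitz right-hand side\<close>


text \<open>Supercriticality enters through two exponents. Adding the integrated energy law and the
  equation tested with the profile leaves the coefficient \<open>(p - 6) / (4 * p)\<close> in front
  of the power integral, and the inner mass scales like \<open>k powr (4 / (p - 2) - 1)\<close>,
  which tends to zero. The split by degrees has a simple origin. At an end of the path with
  \<open>n\<close> outer half-edges the matching compares, to leading order,
  \<open>sqrt (c^2 + amp^2)\<close> with \<open>n * c\<close>. For \<open>n >= 2\<close> the two
  cross at some \<open>c\<close> comparable to \<open>amp\<close>; for \<open>n = 1\<close> they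
  agree only if \<open>amp = 0\<close>, that is, on the homoclinic orbit. As the path has a fixed
  length, \<open>k\<close> is not free: it is only known to lie between a logarithm of the cut-off
  and a multiple of its inverse. This suffices because the outer mass is quadratic in the cut-off.
  The outer solution is shown to be continuous, not differentiable, in its parameters, so the
  matching is done by a topological theorem on zeros. Periodicity bounds the degrees and supplies,
  by translation, a second branching vertex or a second leaf.\<close>

lemma geometric_increments_limit:
  fixes f :: "nat \<Rightarrow> 'a \<Rightarrow> 'b::banach"
  assumes inc: "\<And>n x. x \<in> A \<Longrightarrow> norm (f (Suc n) x - f n x) \<le> C / 2 ^ n"
  shows "\<exists>g. uniform_limit A f g sequentially \<and>
             (\<forall>n. \<forall>x\<in>A. norm (g x - f n x) \<le> 2 * C / 2 ^ n)"
proof -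
  define d where "d n x = f (Suc n) x - f n x" for n x
  have geo: "(\<lambda>n. C * (1/2) ^ n) sums (C * 2)" 
    using sums_mult[OF geometric_sums[of "1/2::real"], of C] by simp
  have "summable (\<lambda>n. C / 2 ^ n)"
    using geo by (simp add: sums_iff power_divide)
  then have ul: "uniform_limit A (\<lambda>n x. \<Sum>i<n. d i x) (\<lambda>x. \<Sum>i. d i x) sequentially"
    using inc by (intro Weierstrass_m_test[where M="\<lambda>n. C / 2 ^ n"]) (auto simp: d_def)
  define g where "g x = f 0 x + (\<Sum>i. d i x)" for x
  have tel: "(\<Sum>i<n. d i x) = f n x - f 0 x" for n x
    unfolding d_def by (induction n) auto
  have "uniform_limit A (\<lambda>n x. f 0 x + (\<Sum>i<n. d i x)) g sequentially"
    unfolding g_def by (intro uniform_limit_intros ul)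
  then have lim: "uniform_limit A f g sequentially"
    by (simp add: tel)
  \<comment> \<open>Subtracting the remaining tail of the geometric series lets the induction on
    \<open>k\<close> close; the plain bound \<open>2 * C / 2 ^ n\<close> would not reproduce
    itself.\<close>
  have tel2: "norm (f (n + k) x - f n x) \<le> 2 * C / 2 ^ n - 2 * C / 2 ^ (n + k)" if "x \<in> A" for n k x
  proof (induction k)
    case (Suc k)
    have "norm (f (n + Suc k) x - f n x) \<le> norm (f (Suc (n + k)) x - f (n + k) x) + norm (f (n + k) x - f n x)"
      using norm_triangle_ineq[of "f (Suc (n + k)) x - f (n + k) x" "f (n + k) x - f n x"] by simp
    also have "\<dots> \<le> C / 2 ^ (n + k) + (2 * C / 2 ^ n - 2 * C / 2 ^ (n + k))"
      using inc[OF that, of "n + k"] Suc by linarith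
    finally show ?case by (simp add: field_simps)
  qed simp
  have Cnn: "C \<ge> 0" if "x \<in> A" for x
    using order_trans[OF norm_ge_zero inc[OF that, of 0]] by simp
  have "norm (g x - f n x) \<le> 2 * C / 2 ^ n" if "x \<in> A" for n x
  proof -
    have "(\<lambda>k. f (k + n) x) \<longlonglongrightarrow> g x"
      using tendsto_uniform_limitI[OF lim that] by (rule LIMSEQ_ignore_initial_segment)
    then have "(\<lambda>k. norm (f (k + n) x - f n x)) \<longlonglongrightarrow> norm (g x - f n x)"
      by (intro tendsto_intros)
    moreover have "norm (f (k + n) x - f n x) \<le> 2 * C / 2 ^ n" for k
    proof -
      have "2 * C / 2 ^ (n + k) \<ge> 0" using Cnn[OF that] by simp
      then show ?thesis using tel2[OF that, of n k] by (simp add: add.commute)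
    qed
    ultimately show ?thesis by (intro LIMSEQ_le_const2) auto
  qed
  with lim show ?thesis by blast
qed

text \<open>Successive approximation converges on the whole half-line, with no restriction on the
  interval, because increments are measured against \<open>exp (2 * L * t)\<close>: integrating
  \<open>L * exp (2 * L * t)\<close> returns at most half of that weight.\<close>

lemma picard_lindelof_global:
  fixes F :: "'a::banach \<Rightarrow> 'a"
  assumes lip: "\<And>x y. norm (F x - F y) \<le> L * norm (x - y)" and L: "L > 0"
  shows "\<exists>x. x 0 = z \<and> (\<forall>T>0. \<forall>t\<in>{0..T}. (x has_vector_derivative F (x t)) (at t within {0..T}))"
proof -
  define P :: "nat \<Rightarrow> real \<Rightarrow> 'a" where "P = rec_nat (\<lambda>t. z) (\<lambda>n x t. z + integral {0..t} (\<lambda>s. F (x s)))"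
  have P0: "P 0 = (\<lambda>t. z)" and PS: "P (Suc n) = (\<lambda>t. z + integral {0..t} (\<lambda>s. F (P n s)))" for n
    by (simp_all add: P_def)
  have contF: "continuous_on UNIV F"
  proof (rule continuous_on_iff[THEN iffD2], intro ballI allI impI)
    fix x and e :: real assume "e > 0"
    have "dist (F y) (F x) < e" if "dist y x < e / L" for y
    proof -
      have "L * norm (y - x) < e" using that L by (simp add: dist_norm pos_less_divide_eq mult.commute)
      then show ?thesis using lip[of y x] unfolding dist_norm by linarith
    qed
    then show "\<exists>d>0. \<forall>y\<in>UNIV. dist y x < d \<longrightarrow> dist (F y) (F x) < e"
      using \<open>e > 0\<close> L by (intro exI[of _ "e / L"]) auto
  qed
  note contF' = continuous_on_compose2[OF contF, OF _ subset_UNIV]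
  have contP: "continuous_on {0..T} (P n)" for n T
  proof (induction n)
    case (Suc n)
    have "continuous_on {0..T} (\<lambda>s. F (P n s))" by (intro contF' Suc)
    from indefinite_integral_continuous_1[OF integrable_continuous_real[OF this]] show ?case
      unfolding PS by (intro continuous_on_add continuous_on_const)
  qed (simp add: P0)
  have intP: "(\<lambda>s. F (P n s)) integrable_on {0..t}" for n t
    by (intro integrable_continuous_real contF' contP)
  \<comment> \<open>The first increment has norm \<open>t * norm (F z)\<close>, and
    \<open>2 * L * t\<close> is at most \<open>exp (2 * L * t)\<close>.\<close>
  define C where "C = norm (F z) / (2 * L)"
  have C: "C \<ge> 0" using L by (simp add: C_def)
  have exple: "t * (2 * L) \<le> exp (2 * L * t)" for t
    by (rule order_trans[OF _ exp_ge_add_one_self]) simp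
  have incr: "norm (P (Suc n) t - P n t) \<le> C * exp (2 * L * t) / 2 ^ n" if "t \<ge> 0" for n t
    using that
  proof (induction n arbitrary: t)
    case 0
    have "norm (P (Suc 0) t - P 0 t) = t * (2 * L) * C"
      using 0 L by (simp add: P0 PS C_def)
    also have "\<dots> \<le> exp (2 * L * t) * C"
      by (intro mult_right_mono exple C)
    finally show ?case by (simp add: mult.commute)
  next
    case (Suc n)
    have e: "P (Suc (Suc n)) t - P (Suc n) t = integral {0..t} (\<lambda>s. F (P (Suc n) s) - F (P n s))"
      unfolding integral_diff[OF intP[of "Suc n"] intP[of n]]
      using fun_cong[OF PS[of "Suc n"], of t] fun_cong[OF PS[of n], of t]
      by (metis add_diff_cancel_left)
    have I: "((\<lambda>s. L * (C * exp (2 * L * s) / 2 ^ n)) has_integral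
        C * exp (2 * L * t) / 2 ^ Suc n - C * exp (2 * L * 0) / 2 ^ Suc n) {0..t}"
      using Suc.prems L
      by (intro fundamental_theorem_of_calculus)
        (auto intro!: derivative_eq_intros simp: has_real_derivative_iff_has_vector_derivative[symmetric])
    have "norm (P (Suc (Suc n)) t - P (Suc n) t) \<le> integral {0..t} (\<lambda>s. L * (C * exp (2 * L * s) / 2 ^ n))"
      unfolding e
    proof (rule integral_norm_bound_integral)
      fix s assume s: "s \<in> {0..t}"
      have "norm (F (P (Suc n) s) - F (P n s)) \<le> L * norm (P (Suc n) s - P n s)" by (rule lip)
      also have "\<dots> \<le> L * (C * exp (2 * L * s) / 2 ^ n)"
        using Suc.IH[of s] s L by (intro mult_left_mono) auto
      finally show "norm (F (P (Suc n) s) - F (P n s)) \<le> L * (C * exp (2 * L * s) / 2 ^ n)" .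
    qed (use I intP in \<open>auto intro!: integrable_diff\<close>)
    also have "\<dots> = C * exp (2 * L * t) / 2 ^ Suc n - C * exp (2 * L * 0) / 2 ^ Suc n"
      using I by (rule integral_unique)
    also have "\<dots> \<le> C * exp (2 * L * t) / 2 ^ Suc n" using C by simp
    finally show ?case .
  qed
  have "\<exists>g. uniform_limit {0..T} P g sequentially" for T
  proof -
    have "norm (P (Suc n) t - P n t) \<le> (C * exp (2 * L * T)) / 2 ^ n" if "t \<in> {0..T}" for n t
    proof -
      have "C * exp (2 * L * t) / 2 ^ n \<le> C * exp (2 * L * T) / 2 ^ n"
        using that C L by (intro divide_right_mono mult_left_mono) auto
      then show ?thesis using incr[of t n] that by auto
    qed
    then show ?thesis using geometric_increments_limit[where f=P and A="{0..T}"] by blast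
  qed
  then obtain G where G: "\<And>T. uniform_limit {0..T} P (G T) sequentially" by metis
  \<comment> \<open>A pointwise limit that does not mention \<open>T\<close>, so that one function
    serves all intervals \<open>{0..T}\<close>.\<close>
  define x where "x t = lim (\<lambda>n. P n t)" for t
  have xG: "x t = G T t" if "t \<in> {0..T}" for t T
    unfolding x_def using tendsto_uniform_limitI[OF G that] by (rule limI)
  have ulx: "uniform_limit {0..T} P x sequentially" for T
    using G[of T] uniform_limit_cong'[of "{0..T}" P P x "G T" sequentially] xG[of _ T] by blast
  have contx: "continuous_on {0..T} x" for T
    by (rule uniform_limit_theorem[OF always_eventually ulx]) (auto simp: contP)
  have inteq: "x t = z + integral {0..t} (\<lambda>s. F (x s))" if t: "t \<ge> 0" for t
  proof -
    have "uniform_limit {0..t} (\<lambda>n s. F (P n s)) (\<lambda>s. F (x s)) sequentially"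
    proof (rule uniform_limitI)
      fix e :: real assume "e > 0"
      then have "\<forall>\<^sub>F n in sequentially. \<forall>s\<in>{0..t}. dist (P n s) (x s) < e / L"
        using L by (intro uniform_limitD[OF ulx]) auto
      then show "\<forall>\<^sub>F n in sequentially. \<forall>s\<in>{0..t}. dist (F (P n s)) (F (x s)) < e"
      proof eventually_elim
        case (elim n)
        show ?case
        proof
          fix s assume "s \<in> {0..t}"
          then have "L * norm (P n s - x s) < e" using elim L by (auto simp: dist_norm field_simps)
          then show "dist (F (P n s)) (F (x s)) < e" using lip[of "P n s" "x s"] by (simp add: dist_norm)
        qed
      qed
    qed
    from uniform_limit_integral[OF this, where thesis="\<exists>I J. (\<forall>n. ((\<lambda>s. F (P n s)) has_integral I n) {0..t}) \<and> ((\<lambda>s. F (x s)) has_integral J) {0..t} \<and> (I \<longlongrightarrow> J) sequentially"]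
    obtain I J where IJ: "\<And>n. ((\<lambda>s. F (P n s)) has_integral I n) {0..t}"
      "((\<lambda>s. F (x s)) has_integral J) {0..t}" "(I \<longlongrightarrow> J) sequentially"
      using contF'[OF contP] sequentially_bot by blast
    have "(\<lambda>n. P (Suc n) t) \<longlonglongrightarrow> z + J"
      unfolding PS integral_unique[OF IJ(1)] by (intro tendsto_intros IJ(3))
    moreover have "(\<lambda>n. P (Suc n) t) \<longlonglongrightarrow> x t"
      using t by (intro LIMSEQ_Suc tendsto_uniform_limitI[OF ulx[of t]]) auto
    ultimately show ?thesis using IJ(2) LIMSEQ_unique by (metis integral_unique)
  qed
  show ?thesis
  proof (intro exI[of _ x] conjI allI impI ballI)
    show "x 0 = z" using inteq[of 0] by simp
    fix T t :: real assume "T > 0" "t \<in> {0..T}"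
    have "((\<lambda>t. z + integral {0..t} (\<lambda>s. F (x s))) has_vector_derivative F (x t)) (at t within {0..T})"
      using \<open>t \<in> _\<close> integral_has_vector_derivative[of 0 T "\<lambda>s. F (x s)" t] contF'[OF contx]
      by (auto intro!: derivative_eq_intros)
    then show "(x has_vector_derivative F (x t)) (at t within {0..T})"
      by (rule has_vector_derivative_transform[rotated 2]) (use \<open>t \<in> _\<close> inteq in auto)
  qed
qed

text \<open>The squared distance of the two solutions times \<open>exp (- 2 * L * t)\<close> is
  nonincreasing, by Cauchy-Schwarz and the Lipschitz bound. This is where the inner product is
  used.\<close>

lemma gronwall_dependence:
  fixes F :: "'a::real_inner \<Rightarrow> 'a"
  assumes lip: "\<And>x y. norm (F x - F y) \<le> L * norm (x - y)"
    and x: "\<And>t. t \<in> {0..T} \<Longrightarrow> (x has_vector_derivative F (x t)) (at t within {0..T})"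
    and y: "\<And>t. t \<in> {0..T} \<Longrightarrow> (y has_vector_derivative F (y t)) (at t within {0..T})"
    and T: "0 \<le> T"
  shows "norm (x T - y T) \<le> exp (L * T) * norm (x 0 - y 0)"
proof -
  define w where "w t = x t - y t" for t
  define f where "f t = (w t \<bullet> w t) * exp (- 2 * L * t)" for t
  have w: "(w has_vector_derivative (F (x t) - F (y t))) (at t within {0..T})" if "t \<in> {0..T}" for t
    unfolding w_def using x[OF that] y[OF that] by (auto intro!: derivative_eq_intros)
  define f' where "f' t = (2 * (w t \<bullet> (F (x t) - F (y t))) - 2 * L * (w t \<bullet> w t)) * exp (- 2 * L * t)" for t
  have f: "(f has_real_derivative f' t) (at t within {0..T})" if "t \<in> {0..T}" for t
  proof -
    have "((\<lambda>t. w t \<bullet> w t) has_vector_derivative (w t \<bullet> (F (x t) - F (y t)) + (F (x t) - F (y t)) \<bullet> w t)) (at t within {0..T})"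
      using bounded_bilinear.has_vector_derivative[OF bounded_bilinear_inner w[OF that] w[OF that]] .
    then have "((\<lambda>t. w t \<bullet> w t) has_real_derivative (2 * (w t \<bullet> (F (x t) - F (y t))))) (at t within {0..T})"
      by (simp add: has_real_derivative_iff_has_vector_derivative inner_commute)
    then show ?thesis unfolding f_def f'_def
      by (auto intro!: derivative_eq_intros simp: algebra_simps)
  qed
  have f'neg: "f' t \<le> 0" for t
  proof -
    have "w t \<bullet> (F (x t) - F (y t)) \<le> norm (w t) * norm (F (x t) - F (y t))"
      by (rule norm_cauchy_schwarz)
    also have "\<dots> \<le> norm (w t) * (L * norm (w t))"
      by (intro mult_left_mono) (auto simp: w_def lip)
    also have "norm (w t) * (L * norm (w t)) = L * (w t \<bullet> w t)"
      by (simp add: power2_norm_eq_inner[symmetric] power2_eq_square)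
    finally show ?thesis unfolding f'_def
      by (intro mult_nonpos_nonneg) auto
  qed
  have "f T \<le> f 0"
  proof (cases "T = 0")
    case False
    then have "0 < T" using T by simp
    show ?thesis
    proof -
      have "continuous_on {0..T} f"
        by (rule DERIV_continuous_on[OF f])
      moreover have "(f has_real_derivative f' t) (at t)" if "0 < t" "t < T" for t
        using f[of t] that at_within_Icc_at[of 0 t T] by auto
      ultimately show ?thesis
        using \<open>0 < T\<close> f'neg by (intro DERIV_nonpos_imp_decreasing_open[of 0 T f]) (auto intro: less_imp_le)
    qed
  qed simp
  then have le: "w T \<bullet> w T \<le> (w 0 \<bullet> w 0) * exp (2 * L * T)"
    by (simp add: f_def exp_minus field_simps)
  have "(norm (w T))\<^sup>2 = w T \<bullet> w T"
    by (rule power2_norm_eq_inner)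
  also note le
  also have "(w 0 \<bullet> w 0) * exp (2 * L * T) = (norm (w 0) * exp (L * T))\<^sup>2"
    using exp_double[of "L * T"] by (simp add: power_mult_distrib power2_norm_eq_inner mult.assoc)
  finally have "norm (w T) \<le> norm (w 0) * exp (L * T)"
    by (rule power2_le_imp_le) simp
  then show ?thesis by (simp add: w_def mult.commute)
qed

section \<open>The phase plane\<close>


lemma powr_lipschitz:
  fixes q :: real
  assumes q: "q \<ge> 1" and xy: "0 \<le> x" "x \<le> M" "0 \<le> y" "y \<le> M"
  shows "\<bar>x powr q - y powr q\<bar> \<le> q * M powr (q - 1) * \<bar>x - y\<bar>"
proof -
  have main: "\<bar>y powr q - x powr q\<bar> \<le> q * M powr (q - 1) * \<bar>y - x\<bar>"
    if "0 \<le> x" "x < y" "y \<le> M" for x y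
  proof -
    have "continuous_on {x..y} (\<lambda>z. z powr q)"
      using that q by (intro continuous_on_powr') (auto intro: continuous_intros)
    moreover have der: "((\<lambda>z. z powr q) has_real_derivative q * z powr (q - 1)) (at z)" if "z > 0" for z
      using that by (auto intro!: derivative_eq_intros)
    ultimately have "\<exists>l z. x < z \<and> z < y \<and> ((\<lambda>z. z powr q) has_real_derivative l) (at z) \<and>
        y powr q - x powr q = (y - x) * l"
      using that(1) by (intro MVT that(2)) (auto simp: real_differentiable_def intro!: exI der)
    then obtain l z where z: "x < z" "z < y" "((\<lambda>z. z powr q) has_real_derivative l) (at z)"
        "y powr q - x powr q = (y - x) * l" by blast
    have l: "l = q * z powr (q - 1)"
      using DERIV_unique[OF z(3) der] that z by simp
    have "z powr (q - 1) \<le> M powr (q - 1)"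
      using that z q by (intro powr_mono2) auto
    then have "q * z powr (q - 1) * (y - x) \<le> q * M powr (q - 1) * (y - x)"
      using that q by (intro mult_right_mono mult_left_mono) auto
    moreover have "q * z powr (q - 1) \<ge> 0" using q by simp
    ultimately show ?thesis using z(4) l that by (simp add: abs_mult mult.commute)
  qed
  consider "x < y" | "x = y" | "y < x" by linarith
  then show ?thesis
  proof cases
    case 1
    then show ?thesis using main[of x y] xy by (simp add: abs_minus_commute)
  next
    case 3
    then show ?thesis using main[of y x] xy by simp
  qed simp
qed

definition sol_height :: "real \<Rightarrow> real" where
  "sol_height p = (p / 2) powr (1 / (p - 2))"

text \<open>The conserved quantity of \<open>v'' = v - v powr (p - 1)\<close> is \<open>v'\<^sup>2 / 2 + lev p v\<close>;
the level of the homoclinic orbit is \<open>lev p (sol_height p) = 0\<close>.\<close>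

definition lev :: "real \<Rightarrow> real \<Rightarrow> real" where
  "lev p v = v powr p / p - v\<^sup>2 / 2"

section \<open>The level function \<open>lev\<close>: sign, monotonicity and quadratic
  bounds\<close>

lemma lev_eq:
  assumes "v \<ge> 0" "p > 2"
  shows "lev p v = v\<^sup>2 * (v powr (p - 2) / p - 1/2)"
proof (cases "v = 0")
  case False
  then have "v powr p = v\<^sup>2 * v powr (p - 2)"
    using assms powr_add[of v 2 "p - 2"] by (simp add: powr_numeral)
  then show ?thesis by (simp add: lev_def algebra_simps)
qed (use assms in \<open>simp add: lev_def\<close>)

lemma sol_height_powr: "p > 2 \<Longrightarrow> sol_height p powr (p - 2) = p / 2"
  by (simp add: sol_height_def powr_powr)

lemma sol_height_gt_1: "p > 2 \<Longrightarrow> sol_height p > 1"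
  unfolding sol_height_def by (intro gr_one_powr) auto

lemma lev_sol_height: "p > 2 \<Longrightarrow> lev p (sol_height p) = 0"
  using sol_height_gt_1[of p] by (simp add: lev_eq sol_height_powr)

lemma lev_neg:
  assumes "p > 2" "0 < v" "v < sol_height p"
  shows "lev p v < 0"
proof -
  have "v powr (p - 2) < p / 2"
    using powr_less_mono2[of "p - 2" v "sol_height p"] assms sol_height_powr[of p] by simp
  then have "v powr (p - 2) / p - 1/2 < 0" using assms by (simp add: field_simps)
  then show ?thesis using assms by (simp add: lev_eq mult_pos_neg)
qed

lemma lev_has_derivative:
  assumes "v > 0" "p > 2"
  shows "(lev p has_real_derivative (v powr (p - 1) - v)) (at v)"
  unfolding lev_def[abs_def] using assms by (auto intro!: derivative_eq_intros)

lemma lev_continuous_on: "p > 2 \<Longrightarrow> continuous_on {0..} (lev p)"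
  unfolding lev_def[abs_def] by (intro continuous_intros continuous_on_powr') auto

lemma lev_strict_mono:
  assumes "p > 2" "1 \<le> v" "v < w"
  shows "lev p v < lev p w"
proof (rule DERIV_pos_imp_increasing_open[OF assms(3)])
  fix x assume x: "v < x" "x < w"
  have "x powr (p - 1) > x powr 1" using x assms by (intro powr_less_mono) auto
  then show "\<exists>y. (lev p has_real_derivative y) (at x) \<and> 0 < y"
    using lev_has_derivative[of x p] x assms by (intro exI[of _ "x powr (p - 1) - x"]) auto
next
  show "continuous_on {v..w} (lev p)"
    by (rule continuous_on_subset[OF lev_continuous_on]) (use assms in auto)
qed

lemma lev_nonneg: "p > 2 \<Longrightarrow> sol_height p \<le> h \<Longrightarrow> lev p h \<ge> 0"
  using lev_strict_mono[of p "sol_height p" h] sol_height_gt_1[of p] lev_sol_height[of p]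
  by (cases "h = sol_height p") auto

lemma lev_less:
  assumes "p > 2" "sol_height p \<le> h" "0 < v" "v < h"
  shows "lev p v < lev p h"
  using lev_neg[of p v] lev_nonneg[of p h] lev_strict_mono[of p v h] sol_height_gt_1[of p] assms
  by (cases "v < sol_height p") auto

lemma lev_upper: "p > 2 \<Longrightarrow> - 2 * lev p v \<le> v\<^sup>2"
  by (simp add: lev_def)

text \<open>For \<open>p > 6\<close> the correction \<open>v powr (p - 2) / p\<close> is below 3/8
  on \<open>[0, 1]\<close>. The constant 1/4 is the square of the decay rate 1/2 that the orbit has
  below height one.\<close>

lemma lev_lower:
  assumes "p > 6" "0 \<le> v" "v \<le> 1"
  shows "v\<^sup>2 / 4 \<le> - 2 * lev p v"
proof -
  have "v powr (p - 2) \<le> 1" using assms by (intro powr_le1) auto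
  then have "v powr (p - 2) / p \<le> 3/8" using assms by (simp add: field_simps)
  then have "v\<^sup>2 * (v powr (p - 2) / p) \<le> v\<^sup>2 * (3/8)" by (intro mult_left_mono) auto
  then show ?thesis using assms by (simp add: lev_eq algebra_simps)
qed

text \<open>\<open>ps h\<close> solves \<open>v'' = v - v powr (p - 1)\<close> from height \<open>h\<close> with slope zero; the nonlinearity is frozen
outside \<open>[0, H]\<close> to make it globally Lipschitz, which is invisible as long as \<open>ps h\<close> stays in that range.\<close>

locale profile =
  fixes p H L :: real and ps ys :: "real \<Rightarrow> real \<Rightarrow> real"
  assumes p6: "p > 6" and H_def: "H = sol_height p + 1"
    and ps0: "ps h 0 = h" and ys0: "ys h 0 = 0"
    and ps_deriv: "t \<ge> 0 \<Longrightarrow> (ps h has_real_derivative ys h t) (at t within {0..})"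
    and ys_deriv: "t \<ge> 0 \<Longrightarrow>
      (ys h has_real_derivative (max 0 (min H (ps h t)) - max 0 (min H (ps h t)) powr (p - 1))) (at t within {0..})"
    and ps_lip: "t \<ge> 0 \<Longrightarrow> \<bar>ps h t - ps h' t\<bar> \<le> exp (L * t) * \<bar>h - h'\<bar>"
    and L0: "L > 0"

text \<open>The first-order system for value and slope, with the value clamped to
  \<open>[0, H]\<close> inside the nonlinearity, is globally Lipschitz. So existence and continuous
  dependence hold for all starting heights with a single constant \<open>L\<close>.\<close>

lemma profile_exists:
  fixes p :: real
  assumes p: "p > 6"
  shows "\<exists>L ps ys. profile p (sol_height p + 1) L ps ys"
proof -
  define H where "H = sol_height p + 1"
  have H: "H > 1" using sol_height_gt_1[of p] p by (simp add: H_def)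
  define cl where "cl v = max 0 (min H v)" for v :: real
  define F where "F = (\<lambda>z::real \<times> real. (snd z, cl (fst z) - cl (fst z) powr (p - 1)))"
  define L1 where "L1 = 1 + (p - 1) * H powr (p - 2)"
  define L where "L = 1 + L1"
  have L1: "L1 > 0" using p by (simp add: L1_def add_pos_nonneg)
  have cl_lip: "\<bar>cl v - cl w\<bar> \<le> \<bar>v - w\<bar>" for v w by (simp add: cl_def)
  have cl_in: "0 \<le> cl v" "cl v \<le> H" for v using H by (auto simp: cl_def)
  have g_lip: "\<bar>(cl v - cl v powr (p - 1)) - (cl w - cl w powr (p - 1))\<bar> \<le> L1 * \<bar>v - w\<bar>" for v w
  proof -
    have "\<bar>cl v powr (p - 1) - cl w powr (p - 1)\<bar> \<le> (p - 1) * H powr (p - 1 - 1) * \<bar>cl v - cl w\<bar>"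
      using p cl_in by (intro powr_lipschitz) auto
    also have "\<dots> \<le> (p - 1) * H powr (p - 2) * \<bar>v - w\<bar>"
      using p by (intro mult_mono cl_lip) auto
    finally show ?thesis using cl_lip[of v w] by (simp add: L1_def distrib_right)
  qed
  have lip: "norm (F z - F z') \<le> L * norm (z - z')" for z z'
  proof -
    have "norm (F z - F z') \<le> norm (fst (F z - F z')) + norm (snd (F z - F z'))"
      by (metis norm_Pair_le prod.collapse)
    also have "\<dots> \<le> \<bar>snd z - snd z'\<bar> + L1 * \<bar>fst z - fst z'\<bar>"
      using g_lip[of "fst z" "fst z'"] by (simp add: F_def)
    also have "\<dots> \<le> norm (z - z') + L1 * norm (z - z')"
      using norm_snd_le[of "snd (z - z')" "fst (z - z')"] norm_fst_le[of "fst (z - z')" "snd (z - z')"] L1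
      unfolding prod.collapse by (intro add_mono mult_left_mono) auto
    finally show ?thesis by (simp add: L_def distrib_right)
  qed
  have L: "L > 0" using L1 by (simp add: L_def)
  have "\<exists>X. \<forall>h. X h 0 = (h, 0) \<and> (\<forall>T>0. \<forall>t\<in>{0..T}. (X h has_vector_derivative F (X h t)) (at t within {0..T}))"
    by (rule choice) (intro allI picard_lindelof_global[OF lip L])
  then obtain X where X0: "\<And>h. X h 0 = (h, 0)"
    and Xd: "\<And>h T t. T > 0 \<Longrightarrow> t \<in> {0..T} \<Longrightarrow> (X h has_vector_derivative F (X h t)) (at t within {0..T})"
    by blast
  have Xd': "(X h has_vector_derivative F (X h t)) (at t within {0..})" if "t \<ge> 0" for h t
  proof -
    have "at t within {0..} = at t within {0..t+1}"
      by (rule at_within_nhd[of t "{..<t+1}"]) auto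
    then show ?thesis using Xd[of "t+1" t h] that by simp
  qed
  have "profile p H L (\<lambda>h t. fst (X h t)) (\<lambda>h t. snd (X h t))"
  proof
    fix t h h' :: real assume t: "t \<ge> 0"
    from Xd'[OF t, of h]
    show "((\<lambda>t. fst (X h t)) has_real_derivative snd (X h t)) (at t within {0..})"
      using bounded_linear.has_vector_derivative[OF bounded_linear_fst]
      by (fastforce simp: F_def has_real_derivative_iff_has_vector_derivative)
    from Xd'[OF t, of h]
    show "((\<lambda>t. snd (X h t)) has_real_derivative
        (max 0 (min H (fst (X h t))) - max 0 (min H (fst (X h t))) powr (p - 1))) (at t within {0..})"
      using bounded_linear.has_vector_derivative[OF bounded_linear_snd]
      by (fastforce simp: F_def cl_def has_real_derivative_iff_has_vector_derivative)
    have "norm (X h t - X h' t) \<le> exp (L * t) * norm (X h 0 - X h' 0)"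
      by (rule gronwall_dependence[OF lip])
        (auto intro: t has_vector_derivative_within_subset[OF Xd'])
    then show "\<bar>fst (X h t) - fst (X h' t)\<bar> \<le> exp (L * t) * \<bar>h - h'\<bar>"
      using norm_fst_le[of "fst (X h t - X h' t)" "snd (X h t - X h' t)"]
      unfolding prod.collapse by (simp add: X0)
  qed (use p L X0 H_def in auto)
  then show ?thesis unfolding H_def by blast
qed


section \<open>Monotonicity of the profile and passage times\<close>

context profile
begin

text \<open>Only positivity has to be recorded: while it holds, a profile started between
  \<open>sol_height p\<close> and \<open>H\<close> decreases, so it also stays below the upper clamp
  and obeys the true equation.\<close>

definition good :: "real \<Rightarrow> real \<Rightarrow> bool" where
  "good h s \<longleftrightarrow> (\<forall>r\<in>{0..s}. 0 < ps h r)"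

lemma p2: "p > 2" using p6 by simp

lemma ps_cont: "continuous_on {0..} (ps h)" "continuous_on {0..} (ys h)"
  using ps_deriv ys_deriv by (auto intro!: DERIV_continuous_on)

lemma ps_cont': "0 \<le> r \<Longrightarrow> continuous_on {r..s} (ps h)" "0 \<le> r \<Longrightarrow> continuous_on {r..s} (ys h)"
  by (auto intro: continuous_on_subset[OF ps_cont(1)] continuous_on_subset[OF ps_cont(2)])

lemma ps_deriv_at: "t > 0 \<Longrightarrow> (ps h has_real_derivative ys h t) (at t)"
  using ps_deriv[of t h] at_within_interior[of t "{0..}"] by (simp add: interior_real_atLeast)

lemma ps_deriv_within: "0 \<le> r \<Longrightarrow> t \<in> {r..s} \<Longrightarrow> (ps h has_real_derivative ys h t) (at t within {r..s})"
  by (rule DERIV_subset[OF ps_deriv]) auto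

lemma ys_deriv':
  assumes "t \<ge> 0" "0 \<le> ps h t" "ps h t \<le> H"
  shows "(ys h has_real_derivative (ps h t - ps h t powr (p - 1))) (at t within {0..})"
  using ys_deriv[of t h] assms by simp

lemma energy_on_range:
  assumes "t \<ge> 0" and "\<And>r. r \<in> {0..t} \<Longrightarrow> 0 < ps h r \<and> ps h r \<le> H"
  shows "(ys h t)\<^sup>2 = 2 * (lev p h - lev p (ps h t))"
proof -
  define f where "f r = (ys h r)\<^sup>2 / 2 + lev p (ps h r)" for r
  have "\<exists>c. \<forall>r\<in>{0..t}. f r = c"
  proof (rule has_field_derivative_zero_constant)
    fix r assume r: "r \<in> {0..t}"
    have d1: "(ps h has_real_derivative ys h r) (at r within {0..t})"
      using r by (intro ps_deriv_within) auto
    have d2: "(ys h has_real_derivative (ps h r - ps h r powr (p - 1))) (at r within {0..t})"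
      by (rule DERIV_subset[OF ys_deriv']) (use r assms(2)[OF r] in auto)
    have "((\<lambda>r. lev p (ps h r)) has_real_derivative (ps h r powr (p - 1) - ps h r) * ys h r) (at r within {0..t})"
      by (rule DERIV_chain2[OF lev_has_derivative d1]) (use assms(2)[OF r] p2 in auto)
    with d2 show "(f has_real_derivative 0) (at r within {0..t})"
      unfolding f_def[abs_def] by (auto intro!: derivative_eq_intros simp: field_simps)
  qed simp
  then have "f t = f 0" using assms(1) by (metis atLeastAtMost_iff order_refl)
  then show ?thesis by (simp add: f_def ps0 ys0 field_simps)
qed

lemma ps_decreasing_step:
  assumes "0 \<le> r" "r < s" "\<And>q. r < q \<Longrightarrow> q < s \<Longrightarrow> ys h q < 0"
  shows "ps h s < ps h r"
  using assms by (intro DERIV_neg_imp_decreasing_open[OF assms(2)] ps_cont'(1))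
    (auto intro!: exI ps_deriv_at)

text \<open>The slope is negative right after time zero. At a first return to a nonnegative slope
  the profile lies strictly below \<open>h\<close>, so the energy identity gives a nonzero slope
  there, and the intermediate value theorem contradicts the choice of the first return.\<close>

lemma ys_neg_aux:
  assumes h: "sol_height p \<le> h" "h \<le> H" and g: "good h s" and s: "0 < s"
  shows "\<forall>r\<in>{0<..s}. ys h r < 0"
proof -
  have h1: "h > 1" using sol_height_gt_1[OF p2] h by linarith
  have "(ys h has_real_derivative (h - h powr (p - 1))) (at 0 within {0..})"
    using ys_deriv'[of 0 h] h h1 by (simp add: ps0)
  moreover have "h - h powr (p - 1) < 0"
    using powr_less_mono[of 1 "p - 1" h] h1 p2 by simp
  ultimately obtain d where d: "d > 0" "\<And>r. r > 0 \<Longrightarrow> r < d \<Longrightarrow> ys h r < 0"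
    using has_real_derivative_neg_dec_right[of "ys h" "h - h powr (p - 1)" 0 "{0..}"]
    by (auto simp: ys0 less_imp_le)
  \<comment> \<open>A time inside the initial interval of negative slope; starting the set
    \<open>A\<close> at \<open>m\<close> keeps the zero of \<open>ys h\<close> at time 0 out of
    it.\<close>
  define m where "m = min d s / 2"
  have m: "0 < m" "m < d" "m < s" using d s by (auto simp: m_def)
  define A where "A = {m..s} \<inter> ys h -` {0..}"
  have "A = {}"
  proof (rule ccontr)
    assume ne: "A \<noteq> {}"
    have cl: "closed A" unfolding A_def
      using m by (intro continuous_closed_preimage ps_cont'(2)) auto
    have bd: "bdd_below A" by (auto simp: A_def)
    define r1 where "r1 = Inf A"
    have "r1 \<in> A" unfolding r1_def by (rule closed_contains_Inf[OF ne bd cl])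
    then have r1: "m \<le> r1" "r1 \<le> s" "ys h r1 \<ge> 0" by (auto simp: A_def)
    have neg: "ys h r < 0" if "0 < r" "r < r1" for r
    proof (cases "r < d")
      case False
      then have "r \<notin> A" using cInf_lower[OF _ bd, of r] that by (auto simp: r1_def)
      then show ?thesis using False m that r1 by (auto simp: A_def)
    qed (use d that in auto)
    have lt: "ps h r1 < h"
      using ps_decreasing_step[of 0 r1 h] neg r1 m by (simp add: ps0)
    have le: "ps h r \<le> h" if "r \<in> {0..r1}" for r
    proof (cases "r = 0")
      case False
      then show ?thesis using ps_decreasing_step[of 0 r h] neg that by (simp add: ps0)
    qed (simp add: ps0)
    have pos: "0 < ps h r1" using g r1 m by (auto simp: good_def)
    have "(ys h r1)\<^sup>2 = 2 * (lev p h - lev p (ps h r1))"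
    proof (rule energy_on_range)
      show "0 < ps h r \<and> ps h r \<le> H" if "r \<in> {0..r1}" for r
        using le[OF that] h g that r1 by (auto simp: good_def)
    qed (use r1 m in auto)
    moreover have "lev p (ps h r1) < lev p h" by (rule lev_less[OF p2 h(1) pos lt])
    ultimately have "ys h r1 \<noteq> 0" by auto
    then have "ys h r1 > 0" using r1 by simp
    moreover have "ys h m < 0" using d m by auto
    ultimately obtain x where x: "m \<le> x" "x \<le> r1" "ys h x = 0"
      using IVT'[of "ys h" m 0 r1] r1 m ps_cont'(2)[of m r1 h] by auto
    with neg[of x] \<open>ys h r1 \<noteq> 0\<close> m show False by (cases "x = r1") auto
  qed
  show ?thesis
  proof
    fix r assume r: "r \<in> {0<..s}"
    have "r \<notin> A" using \<open>A = {}\<close> by simp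
    then show "ys h r < 0" using d(2)[of r] m r by (cases "r < m") (auto simp: A_def)
  qed
qed

lemma good_mono: "good h s \<Longrightarrow> r \<le> s \<Longrightarrow> good h r"
  by (auto simp: good_def)

lemma ys_neg: "sol_height p \<le> h \<Longrightarrow> h \<le> H \<Longrightarrow> good h s \<Longrightarrow> 0 < s \<Longrightarrow> ys h s < 0"
  using ys_neg_aux by auto

lemma ps_strict:
  assumes "sol_height p \<le> h" "h \<le> H" "good h s" "0 \<le> r" "r < s"
  shows "ps h s < ps h r"
proof (rule ps_decreasing_step[OF assms(4,5)])
  fix q assume "r < q" "q < s"
  then show "ys h q < 0" using assms by (intro ys_neg good_mono[OF assms(3)]) auto
qed

lemma ps_anti:
  assumes "sol_height p \<le> h" "h \<le> H" "good h s" "0 \<le> r" "r \<le> s"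
  shows "ps h s \<le> ps h r"
  using assms ps_strict[of h s r] by (cases "r = s") auto

lemma ps_le_h:
  assumes "sol_height p \<le> h" "h \<le> H" "good h s" "0 \<le> s"
  shows "ps h s \<le> h"
  using ps_anti[OF assms(1-3), of 0] assms by (simp add: ps0)

lemma energy:
  assumes "sol_height p \<le> h" "h \<le> H" "good h s" "0 \<le> s"
  shows "(ys h s)\<^sup>2 = 2 * (lev p h - lev p (ps h s))"
  using assms by (intro energy_on_range) (auto simp: good_def intro!: order_trans[OF ps_le_h] intro: good_mono)

lemma ys_eq:
  assumes "sol_height p \<le> h" "h \<le> H" "good h s" "0 \<le> s"
  shows "ys h s = - sqrt (2 * (lev p h - lev p (ps h s)))"
proof -
  have "ys h s \<le> 0" using ys_neg[OF assms(1-3)] assms(4) ys0 by (cases "s = 0") auto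
  then show ?thesis using energy[OF assms] by (metis abs_of_nonpos minus_minus real_sqrt_abs)
qed

definition theta :: "real \<Rightarrow> real \<Rightarrow> real" where
  "theta h a = Inf {s. 0 \<le> s \<and> ps h s \<le> a}"

text \<open>If the profile stayed above \<open>a\<close>, then after time one its height would lie
  in the compact interval \<open>[a, ps h 1]\<close>, on which \<open>lev p h - lev p v\<close> has
  a positive minimum. The slope would stay below a negative constant and the height would become
  nonpositive. Since \<open>a > 0\<close>, this includes the homoclinic height.\<close>

lemma reach:
  assumes h: "sol_height p \<le> h" "h \<le> H" and a: "0 < a" "a < h"
  shows "\<exists>s\<ge>0. ps h s \<le> a"
proof (rule ccontr)
  assume "\<not> ?thesis"
  then have gt: "ps h s > a" if "s \<ge> 0" for s using that by force
  then have g: "good h s" for s using a by (force simp: good_def)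
  have lt: "ps h 1 < h" using ps_strict[OF h g, of 0 1] by (simp add: ps0)
  have a1: "a < ps h 1" using gt by simp
  have "continuous_on {a..ps h 1} (\<lambda>v. lev p h - lev p v)"
    using a by (intro continuous_intros continuous_on_subset[OF lev_continuous_on[OF p2]]) auto
  then obtain v0 where v0: "v0 \<in> {a..ps h 1}" "\<And>v. v \<in> {a..ps h 1} \<Longrightarrow> lev p h - lev p v0 \<le> lev p h - lev p v"
    using continuous_attains_inf[of "{a..ps h 1}" "\<lambda>v. lev p h - lev p v"] a1 by fastforce
  define m where "m = sqrt (2 * (lev p h - lev p v0))"
  have m: "m > 0" using lev_less[OF p2 h(1), of v0] v0 a lt by (auto simp: m_def)
  have y: "ys h s \<le> - m" if "s \<ge> 1" for s
    using ys_eq[OF h g, of s] v0(2)[of "ps h s"] gt[of s] ps_anti[OF h g, of 1 s] that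
    by (simp add: m_def)
  \<comment> \<open>Starting below \<open>h\<close> at time one and falling with speed at least
    \<open>m\<close>, the profile is used up by time \<open>1 + h / m\<close>.\<close>
  define S where "S = 1 + h / m"
  have "ps h S + m * S \<le> ps h 1 + m * 1"
  proof (rule DERIV_nonpos_imp_nonincreasing[of 1 S "\<lambda>s. ps h s + m * s"])
    show "1 \<le> S" using m a by (simp add: S_def)
    fix x :: real assume "1 \<le> x"
    then show "\<exists>y. ((\<lambda>s. ps h s + m * s) has_real_derivative y) (at x) \<and> y \<le> 0"
      using y[of x] by (intro exI[of _ "ys h x + m"] conjI) (auto intro!: derivative_eq_intros ps_deriv_at)
  qed
  moreover have "m * S = m + h" using m by (simp add: S_def field_simps)
  ultimately have "ps h S \<le> 0" using lt by simp
  moreover have "S \<ge> 0" using m a by (simp add: S_def add_nonneg_nonneg)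
  ultimately show False using gt[of S] a by simp
qed

lemma theta_props:
  assumes h: "sol_height p \<le> h" "h \<le> H" and a: "0 < a" "a < h"
  shows "0 < theta h a" "ps h (theta h a) = a" "good h (theta h a)"
    "\<And>r. 0 \<le> r \<Longrightarrow> r < theta h a \<Longrightarrow> a < ps h r"
proof -
  define A where "A = {0..} \<inter> ps h -` {..a}"
  have A': "A = {s. 0 \<le> s \<and> ps h s \<le> a}" by (auto simp: A_def)
  have cl: "closed A" unfolding A_def by (intro continuous_closed_preimage ps_cont(1)) auto
  have bd: "bdd_below A" by (auto simp: A_def)
  have ne: "A \<noteq> {}" using reach[OF assms] by (auto simp: A_def)
  have th: "theta h a = Inf A" by (simp add: theta_def A')
  have "theta h a \<in> A" unfolding th by (rule closed_contains_Inf[OF ne bd cl])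
  then have t: "0 \<le> theta h a" "ps h (theta h a) \<le> a" by (auto simp: A_def)
  then show pos: "0 < theta h a" using a ps0[of h] by (cases "theta h a = 0") auto
  show lt: "a < ps h r" if "0 \<le> r" "r < theta h a" for r
    using cInf_lower[OF _ bd, of r] that unfolding th by (force simp: A_def)
  show eq: "ps h (theta h a) = a"
  proof (rule ccontr)
    assume "\<not> ?thesis"
    then have "ps h (theta h a) < a" using t by simp
    then obtain x where x: "0 \<le> x" "x \<le> theta h a" "ps h x = a"
      using IVT2'[of "ps h" "theta h a" a 0] a t ps_cont'(1)[of 0 "theta h a" h] by (auto simp: ps0)
    with lt[of x] \<open>ps h (theta h a) < a\<close> show False by (cases "x = theta h a") auto
  qed
  show "good h (theta h a)" unfolding good_def
  proof
    fix r assume "r \<in> {0..theta h a}"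
    then show "0 < ps h r" using lt[of r] eq a by (cases "r = theta h a") auto
  qed
qed

lemma theta_le: "0 \<le> s \<Longrightarrow> ps h s \<le> a \<Longrightarrow> theta h a \<le> s"
  unfolding theta_def by (rule cInf_lower) auto

text \<open>The crossing of the level \<open>a\<close> is strict: shortly before the passage time
  the profile is above \<open>a\<close> by \<open>d1\<close>, shortly after it is below
  \<open>a\<close> by \<open>d2\<close>. Both signs survive perturbations with
  \<open>K * |h' - h| + |a' - a| < min d1 d2\<close>, which traps the new passage time.\<close>

lemma theta_continuous: "continuous_on {(h, a). sol_height p \<le> h \<and> h \<le> H \<and> 0 < a \<and> a < h} (\<lambda>(h, a). theta h a)"
  (is "continuous_on ?D _")
proof (rule continuous_on_iff[THEN iffD2], intro ballI allI impI)
  fix z and e :: real assume z: "z \<in> ?D" and e: "e > 0"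
  obtain h a where ha: "z = (h, a)" by (cases z)
  have h: "sol_height p \<le> h" "h \<le> H" and a: "0 < a" "a < h" using z ha by auto
  define T where "T = theta h a"
  note T = theta_props[OF h a, folded T_def]
  define e1 where "e1 = min e T / 2"
  have e1: "0 < e1" "e1 < e" "e1 < T" using e T(1) by (auto simp: e1_def)
  define d1 where "d1 = ps h (T - e1) - a"
  have d1: "d1 > 0" using T(4)[of "T - e1"] e1 by (simp add: d1_def)
  \<comment> \<open>Positivity persists a little beyond \<open>T\<close>, so the profile is still
    strictly decreasing up to \<open>T + e2\<close>; this makes \<open>d2\<close> positive.\<close>
  have "isCont (ps h) T" using ps_deriv_at[OF T(1)] by (rule DERIV_isCont)
  then obtain r0 where r0: "r0 > 0" "\<And>x. \<bar>x - T\<bar> < r0 \<Longrightarrow> \<bar>ps h x - a\<bar> < a"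
    using T(2) a unfolding continuous_at_eps_delta dist_real_def by meson
  define e2 where "e2 = min r0 e / 2"
  have e2: "0 < e2" "e2 < r0" "e2 < e" using r0 e by (auto simp: e2_def)
  have g2: "good h (T + e2)" unfolding good_def
  proof
    fix r assume r: "r \<in> {0..T + e2}"
    show "0 < ps h r"
    proof (cases "r \<le> T")
      case True then show ?thesis using T(3) r by (auto simp: good_def)
    next
      case False
      then show ?thesis using r0(2)[of r] r e2 by (auto simp: abs_if split: if_splits)
    qed
  qed
  define d2 where "d2 = a - ps h (T + e2)"
  have d2: "d2 > 0" using ps_strict[OF h g2, of T] T(1,2) e2 by (simp add: d2_def)
  define K where "K = exp (L * (T + e2))"
  have K: "K > 0" by (simp add: K_def)
  have lipK: "\<bar>ps h' s - ps h s\<bar> \<le> K * \<bar>h' - h\<bar>" if "0 \<le> s" "s \<le> T + e2" for s h'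
  proof -
    have "exp (L * s) \<le> K" using that L0 by (simp add: K_def)
    then have "exp (L * s) * \<bar>h' - h\<bar> \<le> K * \<bar>h' - h\<bar>" by (intro mult_right_mono) auto
    then show ?thesis using ps_lip[OF that(1), of h' h] by linarith
  qed
  define d where "d = min d1 d2 / (2 * (K + 1))"
  have d: "d > 0" using d1 d2 K by (simp add: d_def)
  have bd: "K * x + y < min d1 d2" if "x < d" "y < d" "0 \<le> x" "0 \<le> y" for x y
  proof -
    have "K * x + y < K * d + d" using that K by (intro add_le_less_mono mult_left_mono) auto
    also have "\<dots> = (K + 1) * d" by (simp add: distrib_right)
    also have "\<dots> = min d1 d2 / 2"
      using nonzero_mult_divide_mult_cancel_left[of "K + 1" "min d1 d2" 2] K by (simp add: d_def mult.commute)
    finally show ?thesis using d1 d2 by simp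
  qed
  show "\<exists>d>0. \<forall>z'\<in>?D. dist z' z < d \<longrightarrow> dist ((\<lambda>(h, a). theta h a) z') ((\<lambda>(h, a). theta h a) z) < e"
  proof (intro exI[of _ d] conjI d ballI impI)
    fix z' assume z': "z' \<in> ?D" "dist z' z < d"
    obtain h' a' where ha': "z' = (h', a')" by (cases z')
    have h': "sol_height p \<le> h'" "h' \<le> H" and a': "0 < a'" "a' < h'" using z' ha' by auto
    note T' = theta_props[OF h' a']
    have dh: "\<bar>h' - h\<bar> < d" using z'(2) dist_fst_le[of z' z] by (simp add: ha ha' dist_real_def)
    have da: "\<bar>a' - a\<bar> < d" using z'(2) dist_snd_le[of z' z] by (simp add: ha ha' dist_real_def)
    have B: "K * \<bar>h' - h\<bar> + \<bar>a' - a\<bar> < min d1 d2" using bd[OF dh da] by simp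
    have up: "theta h' a' \<le> T + e2"
      using B lipK[of "T + e2" h'] T(1) e2 by (intro theta_le) (auto simp: d2_def)
    have lo: "theta h' a' > T - e1"
    proof (rule ccontr)
      assume "\<not> ?thesis"
      then have le: "theta h' a' \<le> T - e1" by simp
      have "ps h (T - e1) \<le> ps h (theta h' a')"
        using le T'(1) e1 by (intro ps_anti[OF h]) (auto intro: good_mono[OF T(3)])
      then show False using B lipK[of "theta h' a'" h'] T'(1,2) up by (auto simp: d1_def)
    qed
    show "dist ((\<lambda>(h, a). theta h a) z') ((\<lambda>(h, a). theta h a) z) < e"
      using up lo e1 e2 by (simp add: ha ha' dist_real_def T_def[symmetric])
  qed
qed

end

section \<open>Estimates along the profile\<close>


lemma real_derivative_transform:
  assumes "x \<in> S" "\<And>y. y \<in> S \<Longrightarrow> g y = f y" "(f has_real_derivative D) (at x within S)"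
  shows "(g has_real_derivative D) (at x within S)"
  using assms unfolding has_field_derivative_def by (rule has_derivative_transform)

lemma real_derivative_glue_at_0:
  assumes "(f has_real_derivative D) (at 0 within {..0})" "(f has_real_derivative D) (at 0 within {0..})"
  shows "(f has_real_derivative D) (at 0)"
proof -
  have "{..0} \<union> {0..} = (UNIV :: real set)" by auto
  then have eq: "at (0::real) = sup (at 0 within {..0}) (at 0 within {0..})"
    by (metis at_within_union)
  show ?thesis using assms unfolding has_field_derivative_iff
    by (subst eq) (rule filterlim_sup)
qed

text \<open>The bump is the profile run in both directions from its maximum; the zero slope there
  makes the reflected function differentiable.\<close>

lemma even_extension_deriv:
  fixes f g :: "real \<Rightarrow> real"
  assumes d: "\<And>t. t \<ge> 0 \<Longrightarrow> (f has_real_derivative g t) (at t within {0..})"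
    and g0: "g 0 = 0"
  shows "((\<lambda>t. f \<bar>t\<bar>) has_real_derivative sgn t * g \<bar>t\<bar>) (at t)"
proof -
  have r: "((\<lambda>t. f \<bar>t\<bar>) has_real_derivative g t) (at t within {0..})" if "t \<ge> 0" for t
    by (rule real_derivative_transform[OF _ _ d]) (use that in auto)
  have l: "((\<lambda>t. f \<bar>t\<bar>) has_real_derivative - g (- t)) (at t within {..0})" if "t \<le> 0" for t
  proof -
    have "((f \<circ> uminus) has_real_derivative g (- t) * (- 1)) (at t within {..0})"
      using that d[of "- t"] by (intro DERIV_image_chain) (auto intro!: derivative_eq_intros)
    then have "((\<lambda>t. f (- t)) has_real_derivative - g (- t)) (at t within {..0})" by (simp add: o_def)
    then show ?thesis by (rule real_derivative_transform[rotated 2]) (use that in auto)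
  qed
  consider "t > 0" | "t < 0" | "t = 0" by linarith
  then show ?thesis
  proof cases
    case 1
    then show ?thesis using r[of t] at_within_interior[of t "{0..}"] by simp
  next
    case 2
    then show ?thesis using l[of t] at_within_interior[of t "{..0}"] by simp
  next
    case 3
    then show ?thesis using real_derivative_glue_at_0[of "\<lambda>t. f \<bar>t\<bar>" 0] l[of 0] r[of 0] g0 by simp
  qed
qed

lemma odd_extension_deriv:
  fixes f :: "real \<Rightarrow> real" and g :: real
  assumes d: "(f has_real_derivative g) (at \<bar>t\<bar> within {0..})" and f0: "f 0 = 0"
  shows "((\<lambda>t. sgn t * f \<bar>t\<bar>) has_real_derivative g) (at t)"
proof -
  have r: "((\<lambda>t. sgn t * f \<bar>t\<bar>) has_real_derivative g) (at t within {0..})" if "t \<ge> 0"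
    by (rule real_derivative_transform[where f=f]) (use d that f0 in \<open>auto simp: sgn_if\<close>)
  have l: "((\<lambda>t. sgn t * f \<bar>t\<bar>) has_real_derivative g) (at t within {..0})" if "t \<le> 0"
  proof -
    have "((f \<circ> uminus) has_real_derivative g * (- 1)) (at t within {..0})"
      using that d by (intro DERIV_image_chain) (auto intro!: derivative_eq_intros)
    then have "((\<lambda>t. - f (- t)) has_real_derivative g) (at t within {..0})"
      by (auto intro!: derivative_eq_intros simp: o_def)
    then show ?thesis by (rule real_derivative_transform[rotated 2]) (use that f0 in \<open>auto simp: sgn_if\<close>)
  qed
  consider "t > 0" | "t < 0" | "t = 0" by linarith
  then show ?thesis
  proof cases
    case 1
    then show ?thesis using r at_within_interior[of t "{0..}"] by simp
  next
    case 2
    then show ?thesis using l at_within_interior[of t "{..0}"] by simp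
  next
    case 3
    then show ?thesis using real_derivative_glue_at_0[of "\<lambda>t. sgn t * f \<bar>t\<bar>" g] l r by simp
  qed
qed

section \<open>Slope, passage time, mass and energy of the truncated orbit\<close>

context profile
begin

lemma h_gt_1: "sol_height p \<le> h \<Longrightarrow> h > 1"
  using sol_height_gt_1[OF p2] by linarith

text \<open>Absolute slope of the orbit of height \<open>h\<close> where it has the value
  \<open>a\<close>, read off from the conserved energy.\<close>

definition sig :: "real \<Rightarrow> real \<Rightarrow> real" where
  "sig h a = sqrt (2 * (lev p h - lev p a))"

lemma sig_le:
  assumes "sol_height p \<le> h" "0 \<le> a"
  shows "sig h a \<le> a + sqrt (2 * lev p h)"
proof -
  have "sig h a \<le> sqrt (a\<^sup>2 + 2 * lev p h)"
    unfolding sig_def using lev_upper[OF p2, of a] by (intro real_sqrt_le_mono) simp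
  also have "\<dots> \<le> sqrt (a\<^sup>2) + sqrt (2 * lev p h)"
    using lev_nonneg[OF p2 assms(1)] by (intro sqrt_add_le_add_sqrt) auto
  finally show ?thesis using assms by simp
qed

lemma ys_theta:
  assumes h: "sol_height p \<le> h" "h \<le> H" and a: "0 < a" "a < h"
  shows "ys h (theta h a) = - sig h a"
  using ys_eq[OF h, of "theta h a"] theta_props(1-3)[OF h a] by (simp add: sig_def)

text \<open>By \<open>sig_le\<close> the profile falls no faster than \<open>ps h s + S\<close>, so
  \<open>(ps h s + S) * exp s\<close> is nondecreasing. A small cut-off near the homoclinic level
  thus takes a long time to reach, which later forces \<open>k\<close> to be large.\<close>

lemma theta_exp_lower:
  assumes h: "sol_height p \<le> h" "h \<le> H" and a: "0 < a" "a < h"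
  shows "exp (- theta h a) \<le> a + sqrt (2 * lev p h)"
proof -
  define S where "S = sqrt (2 * lev p h)"
  note T = theta_props[OF h a]
  have S: "S \<ge> 0" using lev_nonneg[OF p2 h(1)] by (simp add: S_def)
  have "(ps h 0 + S) * exp 0 \<le> (ps h (theta h a) + S) * exp (theta h a)"
  proof (rule DERIV_nonneg_imp_increasing_open[of 0 "theta h a" "\<lambda>s. (ps h s + S) * exp s"])
    fix s assume s: "0 < s" "s < theta h a"
    have g: "good h s" using T(3) s by (auto intro: good_mono)
    have "0 < ps h s" using g s by (auto simp: good_def)
    then have "ys h s + ps h s + S \<ge> 0"
      using ys_eq[OF h g] sig_le[OF h(1), of "ps h s"] s by (simp add: S_def sig_def)
    then have "(ys h s + ps h s + S) * exp s \<ge> 0" by simp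
    then show "\<exists>y. ((\<lambda>s. (ps h s + S) * exp s) has_real_derivative y) (at s) \<and> 0 \<le> y"
      using ps_deriv_at[OF s(1), of h]
      by (intro exI[of _ "(ys h s + ps h s + S) * exp s"] conjI)
        (auto intro!: derivative_eq_intros simp: algebra_simps)
  qed (use T(1) in \<open>auto intro!: continuous_intros ps_cont'\<close>)
  then have "1 \<le> (a + S) * exp (theta h a)" using T(2) h_gt_1[OF h(1)] S by (simp add: ps0)
  then show ?thesis by (simp add: S_def exp_minus field_simps)
qed

lemma ys_le_half:
  assumes h: "sol_height p \<le> h" "h \<le> H" and g: "good h s" "0 \<le> s" and le: "ps h s \<le> 1"
  shows "ys h s \<le> - ps h s / 2"
proof -
  have pos: "0 < ps h s" using g by (auto simp: good_def)
  have "(ps h s / 2)\<^sup>2 \<le> 2 * (lev p h - lev p (ps h s))"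
    using lev_lower[OF p6 _ le] pos lev_nonneg[OF p2 h(1)] by (simp add: power_divide)
  then have "ps h s / 2 \<le> sqrt (2 * (lev p h - lev p (ps h s)))"
    by (rule real_le_rsqrt)
  then show ?thesis using ys_eq[OF h g] by simp
qed

lemma theta_one_le:
  assumes h: "sol_height p \<le> h" "h \<le> H" and a: "0 < a" "a \<le> 1"
  shows "theta h 1 \<le> theta h a"
  using theta_props(1,2)[OF h, of a] a h_gt_1[OF h(1)] by (intro theta_le) auto

text \<open>Below height one the slope is at most \<open>- ps h s / 2\<close>, so
  \<open>ps h s * exp (s / 2)\<close> is nonincreasing from time \<open>theta h 1\<close>
  on.\<close>

lemma theta_upper:
  assumes h: "sol_height p \<le> h" "h \<le> H" and a: "0 < a" "a \<le> 1"
  shows "theta h a \<le> theta h 1 + 2 * ln (1 / a)"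
proof -
  define T1 where "T1 = theta h 1"
  define T where "T = theta h a"
  have a': "a < h" using a h_gt_1[OF h(1)] by simp
  note T = theta_props[OF h a(1) a', folded T_def]
  note T1 = theta_props[OF h zero_less_one h_gt_1[OF h(1)], folded T1_def]
  have le: "T1 \<le> T" using theta_one_le[OF h a] by (simp add: T_def T1_def)
  have "ps h T * exp (T / 2) \<le> ps h T1 * exp (T1 / 2)"
  proof (rule DERIV_nonpos_imp_decreasing_open[OF le, where f="\<lambda>s. ps h s * exp (s / 2)"])
    fix s assume s: "T1 < s" "s < T"
    have g: "good h s" using T(3) s by (auto intro: good_mono)
    have "ps h s \<le> 1" using ps_anti[OF h g, of T1] s T1(1,2) by simp
    then have "ys h s \<le> - ps h s / 2" using ys_le_half[OF h g] s T1(1) by simp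
    then have "(ys h s + ps h s / 2) * exp (s / 2) \<le> 0" by (intro mult_nonpos_nonneg) auto
    then show "\<exists>y. ((\<lambda>s. ps h s * exp (s / 2)) has_real_derivative y) (at s) \<and> y \<le> 0"
      using ps_deriv_at[of s h] s T1(1)
      by (intro exI[of _ "(ys h s + ps h s / 2) * exp (s / 2)"] conjI)
        (auto intro!: derivative_eq_intros simp: algebra_simps)
  qed (use T1(1) in \<open>auto intro!: continuous_intros ps_cont'\<close>)
  then have "a * exp (T / 2) \<le> exp (T1 / 2)" using T(2) T1(2) by simp
  then have "ln (a * exp (T / 2)) \<le> ln (exp (T1 / 2))" using a by (subst ln_le_cancel_iff) auto
  then have "ln a + T / 2 \<le> T1 / 2" using a by (simp add: ln_mult)
  then show ?thesis using a by (simp add: T_def T1_def ln_div)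
qed

text \<open>Height one is a reference level below all starting heights; compactness of the range of
  \<open>h\<close> makes the time to reach it uniform.\<close>

lemma theta_one_bounds:
  "\<exists>t0>0. \<exists>t1. \<forall>h. sol_height p \<le> h \<and> h \<le> H \<longrightarrow> t0 \<le> theta h 1 \<and> theta h 1 \<le> t1"
proof -
  have c: "continuous_on {sol_height p..H} (\<lambda>h. theta h 1)"
    by (rule continuous_on_compose2[OF theta_continuous, where f="\<lambda>h. (h, 1)", simplified])
      (auto intro!: continuous_intros h_gt_1)
  have ne: "{sol_height p..H} \<noteq> {}" using H_def by simp
  obtain x where x: "x \<in> {sol_height p..H}" "\<And>y. y \<in> {sol_height p..H} \<Longrightarrow> theta x 1 \<le> theta y 1"
    using continuous_attains_inf[OF _ ne c] by auto
  obtain z where z: "\<And>y. y \<in> {sol_height p..H} \<Longrightarrow> theta y 1 \<le> theta z 1"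
    using continuous_attains_sup[OF compact_Icc ne c] by blast
  have "theta x 1 > 0" using x theta_props(1)[of x 1] h_gt_1[of x] by auto
  with x z show ?thesis by (intro exI[of _ "theta x 1"] conjI exI[of _ "theta z 1"]) auto
qed

text \<open>Contribution of one side of the bump, from its maximum down to the cut-off, before the
  scaling by \<open>k\<close>; likewise for \<open>halfpow\<close> and
  \<open>halfkin\<close>.\<close>

definition halfmass :: "real \<Rightarrow> real \<Rightarrow> real" where
  "halfmass h a = integral {0..theta h a} (\<lambda>s. (ps h s)\<^sup>2)"

definition halfpow :: "real \<Rightarrow> real \<Rightarrow> real" where
  "halfpow h a = integral {0..theta h a} (\<lambda>s. ps h s powr p)"

definition halfkin :: "real \<Rightarrow> real \<Rightarrow> real" where
  "halfkin h a = integral {0..theta h a} (\<lambda>s. (ys h s)\<^sup>2)"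

lemma ps_powr_cont:
  "good h T \<Longrightarrow> continuous_on {0..T} (\<lambda>s. ps h s powr q)"
  by (intro continuous_on_powr ps_cont' continuous_on_const) (auto simp: good_def)

text \<open>Up to time \<open>theta h 1\<close> the profile lies between 1 and \<open>H\<close>.
  Afterwards its square is at most \<open>- 2 * ps h s * ys h s\<close>, the derivative of minus the
  square, so the tail contributes at most 1 whatever the cut-off.\<close>

lemma halfmass_bounds:
  assumes h: "sol_height p \<le> h" "h \<le> H" and a: "0 < a" "a \<le> 1"
  shows "theta h 1 \<le> halfmass h a" "halfmass h a \<le> H\<^sup>2 * theta h 1 + 1" "theta h 1 \<le> halfpow h a"
proof -
  define T1 where "T1 = theta h 1"
  define T where "T = theta h a"
  have a': "a < h" using a h_gt_1[OF h(1)] by simp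
  note T = theta_props[OF h a(1) a', folded T_def]
  note T1 = theta_props[OF h zero_less_one h_gt_1[OF h(1)], folded T1_def]
  have le: "T1 \<le> T" using theta_one_le[OF h a] by (simp add: T_def T1_def)
  have g: "good h s" if "s \<le> T" for s using T(3) that by (rule good_mono)
  have ge1: "1 \<le> ps h s" if "s \<in> {0..T1}" for s
    using T1(4)[of s] T1(2) that by (cases "s = T1") auto
  have c2: "continuous_on {r..T} (\<lambda>s. (ps h s)\<^sup>2)" if "r \<ge> 0" for r
    using that by (intro continuous_intros ps_cont')
  have cp: "continuous_on {0..T} (\<lambda>s. ps h s powr p)"
    by (rule ps_powr_cont[OF T(3)])
  have split: "integral {0..T} f = integral {0..T1} f + integral {T1..T} f"
    "f integrable_on {0..T1}" "f integrable_on {T1..T}"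
    if "continuous_on {0..T} f" for f :: "real \<Rightarrow> real"
    using that T1(1) le
    by (auto intro!: Henstock_Kurzweil_Integration.integral_combine[symmetric] integrable_continuous_real
        intro: continuous_on_subset)
  have low: "T1 \<le> integral {0..T} f" if "continuous_on {0..T} f"
    "\<And>s. s \<in> {0..T1} \<Longrightarrow> 1 \<le> f s" "\<And>s. s \<in> {T1..T} \<Longrightarrow> 0 \<le> f s" for f :: "real \<Rightarrow> real"
  proof -
    have "integral {0..T1} (\<lambda>_. 1::real) \<le> integral {0..T1} f"
      using that split by (intro integral_le) auto
    moreover have "0 \<le> integral {T1..T} f" using that split by (intro Henstock_Kurzweil_Integration.integral_nonneg) auto
    ultimately show ?thesis using split(1)[OF that(1)] T1(1) by simp
  qed
  show "theta h 1 \<le> halfmass h a"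
    unfolding halfmass_def T_def[symmetric] T1_def[symmetric]
    using ge1 by (intro low c2) (auto intro: one_le_power)
  show "theta h 1 \<le> halfpow h a"
    unfolding halfpow_def T_def[symmetric] T1_def[symmetric]
    using ge1 p6 by (intro low cp) (auto intro: ge_one_powr_ge_zero)
  have "integral {0..T1} (\<lambda>s. (ps h s)\<^sup>2) \<le> integral {0..T1} (\<lambda>s. H\<^sup>2)"
  proof (rule integral_le)
    fix s assume s: "s \<in> {0..T1}"
    have "ps h s \<le> H" using ps_le_h[OF h g, of s] s le h by simp
    then show "(ps h s)\<^sup>2 \<le> H\<^sup>2" using ge1[OF s] by (intro power_mono) auto
  qed (use split c2 in auto)
  then have i1: "integral {0..T1} (\<lambda>s. (ps h s)\<^sup>2) \<le> H\<^sup>2 * T1" using T1(1) by (simp add: mult.commute)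
  have I: "((\<lambda>s. - 2 * ps h s * ys h s) has_integral (- (ps h T)\<^sup>2 - - (ps h T1)\<^sup>2)) {T1..T}"
  proof (rule fundamental_theorem_of_calculus[OF le])
    fix s assume "s \<in> {T1..T}"
    then have "(ps h has_real_derivative ys h s) (at s within {T1..T})"
      using T1(1) by (intro ps_deriv_within) auto
    then have "((\<lambda>s. - (ps h s)\<^sup>2) has_real_derivative - 2 * ps h s * ys h s) (at s within {T1..T})"
      by (auto intro!: derivative_eq_intros)
    then show "((\<lambda>s. - (ps h s)\<^sup>2) has_vector_derivative - 2 * ps h s * ys h s) (at s within {T1..T})"
      by (simp add: has_real_derivative_iff_has_vector_derivative)
  qed
  have "integral {T1..T} (\<lambda>s. (ps h s)\<^sup>2) \<le> integral {T1..T} (\<lambda>s. - 2 * ps h s * ys h s)"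
  proof (rule integral_le)
    fix s assume s: "s \<in> {T1..T}"
    have "ps h s \<le> 1" using ps_anti[OF h g, of s T1] s T1(1,2) by simp
    then have "ys h s \<le> - ps h s / 2" using ys_le_half[OF h g] s T1(1) by simp
    moreover have "0 < ps h s" using T(3) s T1(1) by (auto simp: good_def)
    ultimately have "ps h s * ys h s \<le> ps h s * (- ps h s / 2)" by (intro mult_left_mono) auto
    then show "(ps h s)\<^sup>2 \<le> - 2 * ps h s * ys h s" by (simp add: power2_eq_square)
  next
    show "(\<lambda>s. (ps h s)\<^sup>2) integrable_on {T1..T}" using T1(1) by (intro integrable_continuous_real c2) simp
    show "(\<lambda>s. - 2 * ps h s * ys h s) integrable_on {T1..T}" using I by (rule has_integral_integrable)
  qed
  also have "\<dots> \<le> 1" using integral_unique[OF I] T1(2) by simp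
  finally show "halfmass h a \<le> H\<^sup>2 * theta h 1 + 1"
    unfolding halfmass_def T_def[symmetric] T1_def[symmetric]
    using split(1)[OF c2[of 0]] i1 by simp
qed

text \<open>Two identities are added: the energy law integrated in time (\<open>e1\<close>), and the
  equation multiplied by the profile and integrated by parts (\<open>e2\<close>). The mass cancels
  and \<open>2 * halfkin h a\<close> is expressed by \<open>halfpow h a\<close>, a boundary term and
  \<open>2 * lev p h * T\<close>, which is nonnegative and dropped. The coefficient is
  \<open>(1 - 2 / p) / 4 - 1 / p = (p - 6) / (4 * p)\<close>.\<close>

lemma half_energy:
  assumes h: "sol_height p \<le> h" "h \<le> H" and a: "0 < a" "a < h"
  shows "halfkin h a / 2 - halfpow h a / p \<ge> (p - 6) / (4 * p) * halfpow h a - a * sig h a / 4"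
proof -
  define T where "T = theta h a"
  note T = theta_props[OF h a, folded T_def]
  have g: "good h s" if "s \<le> T" for s using T(3) that by (rule good_mono)
  have pos: "0 < ps h s" if "s \<in> {0..T}" for s using T(3) that by (auto simp: good_def)
  have i2: "(\<lambda>s. (ps h s)\<^sup>2) integrable_on {0..T}"
    by (intro integrable_continuous_real continuous_intros ps_cont') auto
  have ip: "(\<lambda>s. ps h s powr p) integrable_on {0..T}"
    by (intro integrable_continuous_real ps_powr_cont[OF T(3)])
  have "integral {0..T} (\<lambda>s. (ys h s)\<^sup>2) = integral {0..T} (\<lambda>s. 2 * lev p h + ((ps h s)\<^sup>2 - 2 / p * ps h s powr p))"
  proof (rule integral_cong)
    fix s assume s: "s \<in> {0..T}"
    show "(ys h s)\<^sup>2 = 2 * lev p h + ((ps h s)\<^sup>2 - 2 / p * ps h s powr p)"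
      using energy[OF h g, of s] s p6 by (simp add: lev_def[of p "ps h s"] algebra_simps)
  qed
  also have "\<dots> = 2 * lev p h * T + (halfmass h a - 2 / p * halfpow h a)"
  proof -
    have c: "((\<lambda>s. 2 * lev p h) has_integral (2 * lev p h * T)) {0..T}"
      using has_integral_const_real[of "2 * lev p h" 0 T] T(1) by (simp add: mult.commute)
    show ?thesis
      unfolding halfmass_def halfpow_def T_def[symmetric]
      by (intro integral_unique has_integral_add has_integral_diff c has_integral_mult_right integrable_integral i2 ip)
  qed
  finally have e1: "halfkin h a = 2 * lev p h * T + (halfmass h a - 2 / p * halfpow h a)"
    by (simp add: halfkin_def T_def)
  have "((\<lambda>s. (ys h s)\<^sup>2 + ((ps h s)\<^sup>2 - ps h s powr p)) has_integral (ps h T * ys h T - ps h 0 * ys h 0)) {0..T}"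
  proof (rule fundamental_theorem_of_calculus)
    show "0 \<le> T" using T(1) by simp
    fix s assume s: "s \<in> {0..T}"
    have d1: "(ps h has_real_derivative ys h s) (at s within {0..T})"
      using s by (intro ps_deriv_within) auto
    have "ps h s \<le> H" using ps_le_h[OF h g, of s] s h by simp
    then have d2: "(ys h has_real_derivative (ps h s - ps h s powr (p - 1))) (at s within {0..T})"
      by (intro DERIV_subset[OF ys_deriv']) (use s pos[OF s] in auto)
    have "ps h s * ps h s powr (p - 1) = ps h s powr p"
      using powr_add[of "ps h s" 1 "p - 1"] pos[OF s] by simp
    then have "((\<lambda>s. ps h s * ys h s) has_real_derivative (ys h s)\<^sup>2 + ((ps h s)\<^sup>2 - ps h s powr p)) (at s within {0..T})"
      by (intro DERIV_cong[OF DERIV_mult[OF d1 d2]]) (simp add: power2_eq_square algebra_simps)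
    then show "((\<lambda>s. ps h s * ys h s) has_vector_derivative (ys h s)\<^sup>2 + ((ps h s)\<^sup>2 - ps h s powr p)) (at s within {0..T})"
      by (simp add: has_real_derivative_iff_has_vector_derivative)
  qed
  from integral_unique[OF this]
  have e2: "halfkin h a + (halfmass h a - halfpow h a) = - a * sig h a"
    using i2 ip T(2) ys_theta[OF h a] ys0
      integrable_continuous_real[OF continuous_on_power[OF ps_cont'(2)[of 0 T h]], of 2]
    by (simp add: integral_add integral_diff integrable_diff halfkin_def halfmass_def halfpow_def T_def[symmetric])
  have "2 * halfkin h a = (1 - 2 / p) * halfpow h a - a * sig h a + 2 * lev p h * T"
    using e1 e2 by (simp add: algebra_simps)
  moreover have "lev p h * T \<ge> 0" using lev_nonneg[OF p2 h(1)] T(1) by simp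
  ultimately have "2 * halfkin h a \<ge> (1 - 2 / p) * halfpow h a - a * sig h a" by linarith
  then have "halfkin h a / 2 - halfpow h a / p \<ge> ((1 - 2 / p) * halfpow h a - a * sig h a) / 4 - halfpow h a / p"
    by simp
  also have "((1 - 2 / p) * halfpow h a - a * sig h a) / 4 - halfpow h a / p = (p - 6) / (4 * p) * halfpow h a - a * sig h a / 4"
    using p6 by (simp add: field_simps)
  finally show ?thesis .
qed

text \<open>Rescaling time by \<open>theta h a\<close> turns the moving interval into
  \<open>[0, 1]\<close>, where parameter integrals of jointly continuous functions are
  continuous.\<close>

lemma halfmass_continuous:
  "continuous_on {(h, a). sol_height p \<le> h \<and> h \<le> H \<and> 0 < a \<and> a < h} (\<lambda>(h, a). halfmass h a)"
  (is "continuous_on ?D _")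
proof -
  have ps_joint: "continuous_on (UNIV \<times> {0..}) (\<lambda>(h, t). ps h t)"
  proof (rule continuous_on_iff[THEN iffD2], intro ballI allI impI)
    fix z :: "real \<times> real" and e :: real assume z: "z \<in> UNIV \<times> {0..}" and e: "e > 0"
    obtain h t where ht: "z = (h, t)" by (cases z)
    have t: "t \<ge> 0" using z ht by simp
    obtain d1 where d1: "d1 > 0" "\<And>s. s \<ge> 0 \<Longrightarrow> \<bar>s - t\<bar> < d1 \<Longrightarrow> \<bar>ps h s - ps h t\<bar> < e / 2"
      using ps_cont(1)[of h] t e unfolding continuous_on_iff dist_real_def
      by (metis atLeast_iff half_gt_zero)
    define K where "K = exp (L * (t + 1))"
    have K: "K > 0" by (simp add: K_def)
    define d where "d = min (min d1 1) (e / (2 * K))"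
    have d: "d > 0" using d1 e K by (simp add: d_def)
    show "\<exists>d>0. \<forall>z'\<in>UNIV \<times> {0..}. dist z' z < d \<longrightarrow> dist ((\<lambda>(h, t). ps h t) z') ((\<lambda>(h, t). ps h t) z) < e"
    proof (intro exI[of _ d] conjI d ballI impI)
      fix z' assume z': "z' \<in> UNIV \<times> {0..}" "dist z' z < d"
      obtain h' t' where ht': "z' = (h', t')" by (cases z')
      have t': "t' \<ge> 0" using z' ht' by simp
      have dh: "\<bar>h' - h\<bar> < d" using z'(2) dist_fst_le[of z' z] by (simp add: ht ht' dist_real_def)
      have dt: "\<bar>t' - t\<bar> < d" using z'(2) dist_snd_le[of z' z] by (simp add: ht ht' dist_real_def)
      have "\<bar>ps h' t' - ps h t'\<bar> \<le> exp (L * t') * \<bar>h' - h\<bar>" using t' by (rule ps_lip)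
      also have "\<dots> \<le> K * \<bar>h' - h\<bar>"
        using dt L0 by (intro mult_right_mono) (auto simp: K_def d_def abs_if split: if_splits)
      also have "\<dots> < K * (e / (2 * K))" using dh K by (intro mult_strict_left_mono) (auto simp: d_def)
      finally have "\<bar>ps h' t' - ps h t'\<bar> < e / 2" using K by simp
      moreover have "\<bar>ps h t' - ps h t\<bar> < e / 2" using d1(2)[OF t'] dt by (simp add: d_def)
      ultimately have "\<bar>ps h' t' - ps h t\<bar> < e" by linarith
      then show "dist ((\<lambda>(h, t). ps h t) z') ((\<lambda>(h, t). ps h t) z) < e"
        by (simp add: ht ht' dist_real_def)
    qed
  qed
  have th: "continuous_on ?D (\<lambda>z. theta (fst z) (snd z))"
    using theta_continuous by (simp add: case_prod_unfold)
  have thp: "0 \<le> theta (fst z) (snd z)" if "z \<in> ?D" for z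
    using theta_props(1)[of "fst z" "snd z"] that by (auto simp: case_prod_unfold)
  have "continuous_on (?D \<times> cbox 0 1) (\<lambda>(z, r). (ps (fst z) (theta (fst z) (snd z) * r))\<^sup>2)"
    unfolding case_prod_unfold
    by (intro continuous_on_power continuous_on_compose2[OF ps_joint, where f="\<lambda>x. (fst (fst x), theta (fst (fst x)) (snd (fst x)) * snd x)", simplified case_prod_unfold fst_conv snd_conv]
        continuous_intros continuous_on_compose2[OF th, where f=fst])
      (auto simp: case_prod_unfold intro!: mult_nonneg_nonneg thp[simplified case_prod_unfold])
  then have "continuous_on ?D (\<lambda>z. integral (cbox 0 1) (\<lambda>r. (ps (fst z) (theta (fst z) (snd z) * r))\<^sup>2))"
    by (rule integral_continuous_on_param)
  then have c: "continuous_on ?D (\<lambda>z. theta (fst z) (snd z) * integral {0..1} (\<lambda>r. (ps (fst z) (theta (fst z) (snd z) * r))\<^sup>2))"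
    by (intro continuous_on_mult th) simp
  have eq: "halfmass (fst z) (snd z) = theta (fst z) (snd z) * integral {0..1} (\<lambda>r. (ps (fst z) (theta (fst z) (snd z) * r))\<^sup>2)"
    if z: "z \<in> ?D" for z
  proof -
    define T where "T = theta (fst z) (snd z)"
    have T: "T > 0" using theta_props(1)[of "fst z" "snd z"] z by (auto simp: T_def case_prod_unfold)
    have "((\<lambda>s. (ps (fst z) s)\<^sup>2) has_integral integral {0..T} (\<lambda>s. (ps (fst z) s)\<^sup>2)) {0..T}"
      by (intro integrable_integral integrable_continuous_real continuous_intros ps_cont') auto
    from has_integral_stretch_real[OF this, of T]
    have "((\<lambda>r. (ps (fst z) (T * r))\<^sup>2) has_integral integral {0..T} (\<lambda>s. (ps (fst z) s)\<^sup>2) / T) {0..1}"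
      using T by (simp add: image_divide_atLeastAtMost)
    then show ?thesis using T by (simp add: halfmass_def T_def[symmetric] integral_unique)
  qed
  have "continuous_on ?D (\<lambda>z. halfmass (fst z) (snd z))"
    by (rule continuous_on_eq[OF c]) (rule eq[symmetric])
  then show ?thesis by (simp add: case_prod_unfold)
qed

end

section \<open>The linear equation on an edge\<close>


text \<open>The moving endpoint is put into the integrand by a substitution to
  \<open>[0, 1]\<close>; at \<open>x = 0\<close>, where the substitution degenerates, both sides
  vanish.\<close>

lemma continuous_on_running_integral:
  fixes f :: "'z::topological_space \<Rightarrow> real \<Rightarrow> real"
  assumes f: "continuous_on (Z \<times> {0..l}) (\<lambda>(z, r). f z r)"
  shows "continuous_on (Z \<times> {0..l}) (\<lambda>(z, x). integral {0..x} (f z))"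
proof -
  have "continuous_on ((Z \<times> {0..l}) \<times> cbox 0 1) (\<lambda>(y, r). f (fst y) (snd y * r))"
    unfolding case_prod_unfold
    by (rule continuous_on_compose2[OF f, where f="\<lambda>y. (fst (fst y), snd (fst y) * snd y)", simplified case_prod_unfold fst_conv snd_conv])
      (auto intro!: continuous_intros mult_nonneg_nonneg intro: order_trans[OF mult_left_le])
  then have "continuous_on (Z \<times> {0..l}) (\<lambda>y. integral (cbox 0 1) (\<lambda>r. f (fst y) (snd y * r)))"
    by (rule integral_continuous_on_param)
  then have c: "continuous_on (Z \<times> {0..l}) (\<lambda>y. snd y * integral {0..1} (\<lambda>r. f (fst y) (snd y * r)))"
    by (intro continuous_on_mult continuous_intros) simp
  have eq: "snd y * integral {0..1} (\<lambda>r. f (fst y) (snd y * r)) = integral {0..snd y} (f (fst y))"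
    if y: "y \<in> Z \<times> {0..l}" for y
  proof (cases "snd y = 0")
    case False
    then have T: "snd y > 0" using y by auto
    have "continuous_on {0..snd y} (f (fst y))"
      by (rule continuous_on_compose2[OF f, where f="\<lambda>r. (fst y, r)", simplified])
        (use y in \<open>auto intro!: continuous_intros\<close>)
    then have "(f (fst y) has_integral integral {0..snd y} (f (fst y))) {0..snd y}"
      by (intro integrable_integral integrable_continuous_real)
    from has_integral_stretch_real[OF this, of "snd y"]
    have "((\<lambda>r. f (fst y) (snd y * r)) has_integral integral {0..snd y} (f (fst y)) / snd y) {0..1}"
      using T by (simp add: image_divide_atLeastAtMost)
    then show ?thesis using T by (simp add: integral_unique)
  qed simp
  have "continuous_on (Z \<times> {0..l}) (\<lambda>y. integral {0..snd y} (f (fst y)))"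
    by (rule continuous_on_eq[OF c]) (rule eq)
  then show ?thesis by (simp add: case_prod_unfold)
qed

text \<open>The solution of \<open>w'' = k\<^sup>2 (w - g)\<close> on \<open>[0, l]\<close> with boundary values \<open>x0\<close>, \<open>x1\<close>,
written with the Green function of the interval.\<close>

definition edge_sol :: "real \<Rightarrow> real \<Rightarrow> real \<Rightarrow> real \<Rightarrow> (real \<Rightarrow> real) \<Rightarrow> real \<Rightarrow> real" where
  "edge_sol k l x0 x1 g x =
     (x0 * sinh (k * (l - x)) + x1 * sinh (k * x) +
      k * (sinh (k * (l - x)) * integral {0..x} (\<lambda>r. sinh (k * r) * g r) +
           sinh (k * x) * (integral {0..l} (\<lambda>r. sinh (k * (l - r)) * g r) - integral {0..x} (\<lambda>r. sinh (k * (l - r)) * g r))))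
     / sinh (k * l)"

definition edge_sol' :: "real \<Rightarrow> real \<Rightarrow> real \<Rightarrow> real \<Rightarrow> (real \<Rightarrow> real) \<Rightarrow> real \<Rightarrow> real" where
  "edge_sol' k l x0 x1 g x =
     k * (- x0 * cosh (k * (l - x)) + x1 * cosh (k * x) +
      k * (- cosh (k * (l - x)) * integral {0..x} (\<lambda>r. sinh (k * r) * g r) +
           cosh (k * x) * (integral {0..l} (\<lambda>r. sinh (k * (l - r)) * g r) - integral {0..x} (\<lambda>r. sinh (k * (l - r)) * g r))))
     / sinh (k * l)"

text \<open>The part of the outgoing derivative at one end that is due to \<open>g\<close>, up to
  the factor \<open>k / sinh (k * l)\<close>; \<open>b\<close> selects the terminus. The kernel is
  largest at the chosen end and vanishes at the other one.\<close>

definition edge_flux :: "real \<Rightarrow> real \<Rightarrow> bool \<Rightarrow> (real \<Rightarrow> real) \<Rightarrow> real" where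
  "edge_flux k l b g = k * integral {0..l} (\<lambda>r. sinh (k * (if b then r else l - r)) * g r)"

context
  fixes k l :: real
  assumes k: "k > 0" and l: "l > 0"
begin

lemma sinh_kl: "sinh (k * l) > 0" using k l by simp

lemma edge_sol_0: "edge_sol k l x0 x1 g 0 = x0"
  and edge_sol_l: "edge_sol k l x0 x1 g l = x1"
  using k l by (simp_all add: edge_sol_def)

lemma edge_sol'_0: "edge_sol' k l x0 x1 g 0 = k * ((- x0 * cosh (k * l) + x1 + edge_flux k l False g) / sinh (k * l))"
  and edge_sol'_l: "- edge_sol' k l x0 x1 g l = k * ((- x1 * cosh (k * l) + x0 + edge_flux k l True g) / sinh (k * l))"
  using k l by (simp_all add: edge_sol'_def edge_flux_def field_simps)

lemma edge_sol_derivs: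
  assumes g: "continuous_on {0..l} g" and x: "x \<in> {0..l}"
  shows "(edge_sol k l x0 x1 g has_real_derivative edge_sol' k l x0 x1 g x) (at x within {0..l})"
    and "(edge_sol' k l x0 x1 g has_real_derivative k\<^sup>2 * (edge_sol k l x0 x1 g x - g x)) (at x within {0..l})"
proof -
  define A where "A x = integral {0..x} (\<lambda>r. sinh (k * r) * g r)" for x
  define B where "B x = integral {0..x} (\<lambda>r. sinh (k * (l - r)) * g r)" for x
  define S where "S = sinh (k * l)"
  have S: "S \<noteq> 0" using k l by (simp add: S_def)
  have A: "(A has_real_derivative sinh (k * x) * g x) (at x within {0..l})"
    unfolding A_def[abs_def] using x by (intro integral_has_real_derivative continuous_intros g)
  have B: "(B has_real_derivative sinh (k * (l - x)) * g x) (at x within {0..l})"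
    unfolding B_def[abs_def] using x by (intro integral_has_real_derivative continuous_intros g)
  have e: "edge_sol k l x0 x1 g = (\<lambda>x. (x0 * sinh (k * (l - x)) + x1 * sinh (k * x) +
      k * (sinh (k * (l - x)) * A x + sinh (k * x) * (B l - B x))) / S)"
    by (simp add: edge_sol_def fun_eq_iff A_def B_def S_def)
  have e': "edge_sol' k l x0 x1 g = (\<lambda>x. k * (- x0 * cosh (k * (l - x)) + x1 * cosh (k * x) +
      k * (- cosh (k * (l - x)) * A x + cosh (k * x) * (B l - B x))) / S)"
    by (simp add: edge_sol'_def fun_eq_iff A_def B_def S_def)
  show "(edge_sol k l x0 x1 g has_real_derivative edge_sol' k l x0 x1 g x) (at x within {0..l})"
    unfolding e e' by (intro DERIV_cdivide) (auto intro!: derivative_eq_intros A B simp: algebra_simps)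
  \<comment> \<open>Up to the factor \<open>k\<close> this is the Wronskian of the two homogeneous
    solutions; it produces exactly the source term \<open>- g x\<close>.\<close>
  have s: "S = sinh (k * (l - x)) * cosh (k * x) + cosh (k * (l - x)) * sinh (k * x)"
    unfolding S_def by (simp only: sinh_add[symmetric] distrib_left[symmetric] diff_add_cancel)
  have "(edge_sol' k l x0 x1 g has_real_derivative
      k * (x0 * (k * sinh (k * (l - x))) + x1 * (k * sinh (k * x)) +
       k * ((k * sinh (k * (l - x))) * A x - cosh (k * (l - x)) * (sinh (k * x) * g x) +
        (k * sinh (k * x)) * (B l - B x) - cosh (k * x) * (sinh (k * (l - x)) * g x))) / S) (at x within {0..l})"
    unfolding e' by (intro DERIV_cdivide) (auto intro!: derivative_eq_intros A B simp: algebra_simps)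
  also have "k * (x0 * (k * sinh (k * (l - x))) + x1 * (k * sinh (k * x)) +
       k * ((k * sinh (k * (l - x))) * A x - cosh (k * (l - x)) * (sinh (k * x) * g x) +
        (k * sinh (k * x)) * (B l - B x) - cosh (k * x) * (sinh (k * (l - x)) * g x))) =
       k\<^sup>2 * ((x0 * sinh (k * (l - x)) + x1 * sinh (k * x) +
      k * (sinh (k * (l - x)) * A x + sinh (k * x) * (B l - B x))) - g x * S)"
    unfolding s by (simp add: power2_eq_square algebra_simps)
  also have "\<dots> / S = k\<^sup>2 * (edge_sol k l x0 x1 g x - g x)"
    using S unfolding e by (simp add: field_simps)
  finally show "(edge_sol' k l x0 x1 g has_real_derivative k\<^sup>2 * (edge_sol k l x0 x1 g x - g x)) (at x within {0..l})" .
qed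

lemma integral_sinh: "0 \<le> x \<Longrightarrow> ((\<lambda>r. sinh (k * r)) has_integral (cosh (k * x) - 1) / k) {0..x}"
  and integral_sinh_rev: "x \<le> l \<Longrightarrow> ((\<lambda>r. sinh (k * (l - r))) has_integral (cosh (k * (l - x)) - 1) / k) {x..l}"
proof -
  have "((\<lambda>r. sinh (k * r)) has_integral (cosh (k * x) / k - cosh (k * 0) / k)) {0..x}" if "0 \<le> x"
    using that k by (intro fundamental_theorem_of_calculus)
      (auto intro!: derivative_eq_intros simp: has_real_derivative_iff_has_vector_derivative[symmetric])
  then show "0 \<le> x \<Longrightarrow> ((\<lambda>r. sinh (k * r)) has_integral (cosh (k * x) - 1) / k) {0..x}"
    by (simp add: diff_divide_distrib)
  have "((\<lambda>r. sinh (k * (l - r))) has_integral (- cosh (k * (l - l)) / k - - cosh (k * (l - x)) / k)) {x..l}" if "x \<le> l"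
    using that k by (intro fundamental_theorem_of_calculus)
      (auto intro!: derivative_eq_intros simp: has_real_derivative_iff_has_vector_derivative[symmetric])
  then show "x \<le> l \<Longrightarrow> ((\<lambda>r. sinh (k * (l - r))) has_integral (cosh (k * (l - x)) - 1) / k) {x..l}"
    by (simp add: diff_divide_distrib)
qed

lemma kernel_integrals:
  assumes g: "continuous_on {0..l} g" and G: "\<And>r. r \<in> {0..l} \<Longrightarrow> \<bar>g r\<bar> \<le> G" and x: "x \<in> {0..l}"
  shows "k * \<bar>integral {0..x} (\<lambda>r. sinh (k * r) * g r)\<bar> \<le> G * (cosh (k * x) - 1)"
    and "k * \<bar>integral {0..l} (\<lambda>r. sinh (k * (l - r)) * g r) - integral {0..x} (\<lambda>r. sinh (k * (l - r)) * g r)\<bar>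
          \<le> G * (cosh (k * (l - x)) - 1)"
    and "(\<And>r. r \<in> {0..l} \<Longrightarrow> 0 \<le> g r) \<Longrightarrow> 0 \<le> integral {0..x} (\<lambda>r. sinh (k * r) * g r)"
    and "(\<And>r. r \<in> {0..l} \<Longrightarrow> 0 \<le> g r) \<Longrightarrow>
         0 \<le> integral {0..l} (\<lambda>r. sinh (k * (l - r)) * g r) - integral {0..x} (\<lambda>r. sinh (k * (l - r)) * g r)"
proof -
  have split: "integral {0..l} (\<lambda>r. sinh (k * (l - r)) * g r) - integral {0..x} (\<lambda>r. sinh (k * (l - r)) * g r) =
      integral {x..l} (\<lambda>r. sinh (k * (l - r)) * g r)"
  proof -
    have "(\<lambda>r. sinh (k * (l - r)) * g r) integrable_on {0..l}"
      by (intro integrable_continuous_real continuous_intros g)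
    from Henstock_Kurzweil_Integration.integral_combine[OF _ _ this, of x] show ?thesis using x by auto
  qed
  have i1: "(\<lambda>r. sinh (k * r) * g r) integrable_on {0..x}"
    using x by (intro integrable_continuous_real continuous_intros continuous_on_subset[OF g]) auto
  have i2: "(\<lambda>r. sinh (k * (l - r)) * g r) integrable_on {x..l}"
    using x by (intro integrable_continuous_real continuous_intros continuous_on_subset[OF g]) auto
  have "\<bar>integral {0..x} (\<lambda>r. sinh (k * r) * g r)\<bar> \<le> integral {0..x} (\<lambda>r. sinh (k * r) * G)"
  proof (rule integral_norm_bound_integral[OF i1, unfolded real_norm_def])
    show "(\<lambda>r. sinh (k * r) * G) integrable_on {0..x}" by (intro integrable_continuous_real continuous_intros)
    show "\<bar>sinh (k * r) * g r\<bar> \<le> sinh (k * r) * G" if "r \<in> {0..x}" for r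
      using that x G[of r] k by (auto simp: abs_mult intro!: mult_left_mono)
  qed
  also have "\<dots> = (cosh (k * x) - 1) / k * G"
    using x by (intro integral_unique has_integral_mult_left integral_sinh) simp
  finally show "k * \<bar>integral {0..x} (\<lambda>r. sinh (k * r) * g r)\<bar> \<le> G * (cosh (k * x) - 1)"
    using k by (simp add: field_simps)
  have "\<bar>integral {x..l} (\<lambda>r. sinh (k * (l - r)) * g r)\<bar> \<le> integral {x..l} (\<lambda>r. sinh (k * (l - r)) * G)"
  proof (rule integral_norm_bound_integral[OF i2, unfolded real_norm_def])
    show "(\<lambda>r. sinh (k * (l - r)) * G) integrable_on {x..l}" by (intro integrable_continuous_real continuous_intros)
    show "\<bar>sinh (k * (l - r)) * g r\<bar> \<le> sinh (k * (l - r)) * G" if "r \<in> {x..l}" for r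
      using that x G[of r] k by (auto simp: abs_mult intro!: mult_left_mono)
  qed
  also have "\<dots> = (cosh (k * (l - x)) - 1) / k * G"
    using x by (intro integral_unique has_integral_mult_left integral_sinh_rev) simp
  finally show "k * \<bar>integral {0..l} (\<lambda>r. sinh (k * (l - r)) * g r) - integral {0..x} (\<lambda>r. sinh (k * (l - r)) * g r)\<bar>
          \<le> G * (cosh (k * (l - x)) - 1)"
    using k unfolding split by (simp add: field_simps)
  assume pos: "\<And>r. r \<in> {0..l} \<Longrightarrow> 0 \<le> g r"
  show "0 \<le> integral {0..x} (\<lambda>r. sinh (k * r) * g r)"
    using x k pos by (intro Henstock_Kurzweil_Integration.integral_nonneg i1) auto
  show "0 \<le> integral {0..l} (\<lambda>r. sinh (k * (l - r)) * g r) - integral {0..x} (\<lambda>r. sinh (k * (l - r)) * g r)"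
    unfolding split using x k pos by (intro Henstock_Kurzweil_Integration.integral_nonneg i2) auto
qed

text \<open>A maximum principle without constants: integrating the kernels gives
  \<open>cosh - 1\<close>, and the addition theorem recombines the \<open>cosh\<close> terms into
  \<open>sinh (k * l)\<close>. So the coefficient of \<open>G\<close> is 1, uniformly in
  \<open>k\<close> and \<open>l\<close>.\<close>

lemma edge_sol_bound:
  assumes g: "continuous_on {0..l} g" and G: "\<And>r. r \<in> {0..l} \<Longrightarrow> \<bar>g r\<bar> \<le> G" and x: "x \<in> {0..l}"
  shows "\<bar>edge_sol k l x0 x1 g x\<bar> \<le> \<bar>x0\<bar> + \<bar>x1\<bar> + G"
proof -
  define A where "A = integral {0..x} (\<lambda>r. sinh (k * r) * g r)"
  define B where "B = integral {0..l} (\<lambda>r. sinh (k * (l - r)) * g r) - integral {0..x} (\<lambda>r. sinh (k * (l - r)) * g r)"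
  define S where "S = sinh (k * l)"
  define s where "s = sinh (k * x)"
  define t where "t = sinh (k * (l - x))"
  note AB = kernel_integrals(1,2)[OF g G x, folded A_def B_def]
  have st: "0 \<le> s" "0 \<le> t" "s \<le> S" "t \<le> S" using x k by (auto simp: s_def t_def S_def)
  have G0: "G \<ge> 0" using G[of 0] l by force
  have Ssum: "S = t * cosh (k * x) + cosh (k * (l - x)) * s"
    unfolding S_def s_def t_def by (simp only: sinh_add[symmetric] distrib_left[symmetric] diff_add_cancel)
  have "\<bar>x0 * t + x1 * s + k * (t * A + s * B)\<bar> \<le> \<bar>x0\<bar> * t + \<bar>x1\<bar> * s + (t * (k * \<bar>A\<bar>) + s * (k * \<bar>B\<bar>))"
  proof -
    have "\<bar>x0 * t + x1 * s + k * (t * A + s * B)\<bar> \<le> \<bar>x0 * t\<bar> + \<bar>x1 * s\<bar> + (\<bar>k * (t * A)\<bar> + \<bar>k * (s * B)\<bar>)"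
      by (simp add: distrib_left)
    also have "\<dots> = \<bar>x0\<bar> * t + \<bar>x1\<bar> * s + (t * (k * \<bar>A\<bar>) + s * (k * \<bar>B\<bar>))"
      using st k by (simp add: abs_mult)
    finally show ?thesis .
  qed
  also have "\<dots> \<le> \<bar>x0\<bar> * S + \<bar>x1\<bar> * S + (t * (G * (cosh (k * x) - 1)) + s * (G * (cosh (k * (l - x)) - 1)))"
    using st AB by (intro add_mono mult_left_mono) auto
  also have "\<dots> = (\<bar>x0\<bar> + \<bar>x1\<bar> + G) * S - G * (t + s)"
    unfolding Ssum by (simp add: algebra_simps)
  also have "\<dots> \<le> (\<bar>x0\<bar> + \<bar>x1\<bar> + G) * S" using G0 st by simp
  finally show ?thesis
    using sinh_kl unfolding edge_sol_def
    by (simp add: A_def[symmetric] B_def[symmetric] S_def[symmetric] s_def[symmetric] t_def[symmetric] abs_divide pos_divide_le_eq)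
qed

lemma edge_sol_nonneg:
  assumes g: "continuous_on {0..l} g" and pos: "\<And>r. r \<in> {0..l} \<Longrightarrow> 0 \<le> g r" and x: "x \<in> {0..l}"
    and "0 \<le> x0" "0 \<le> x1"
  shows "0 \<le> edge_sol k l x0 x1 g x"
    and "0 < x0 \<or> 0 < x1 \<Longrightarrow> 0 < x \<Longrightarrow> x < l \<Longrightarrow> 0 < edge_sol k l x0 x1 g x"
proof -
  obtain G where "\<forall>y\<in>g ` {0..l}. norm y \<le> G"
    using compact_imp_bounded[OF compact_continuous_image[OF g compact_Icc]] unfolding bounded_iff by blast
  then have G: "\<And>r. r \<in> {0..l} \<Longrightarrow> \<bar>g r\<bar> \<le> G" by auto
  note n = kernel_integrals(3,4)[OF g G x pos]
  have s: "0 \<le> sinh (k * (l - x))" "0 \<le> sinh (k * x)" using x k by auto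
  show "0 \<le> edge_sol k l x0 x1 g x"
    unfolding edge_sol_def using n s assms k sinh_kl
    by (intro divide_nonneg_pos add_nonneg_nonneg mult_nonneg_nonneg) auto
  assume a: "0 < x0 \<or> 0 < x1" "0 < x" "x < l"
  have s': "0 < sinh (k * (l - x))" "0 < sinh (k * x)" using a k by auto
  have "0 < x0 * sinh (k * (l - x)) + x1 * sinh (k * x)"
    using a(1)
  proof
    assume "0 < x0"
    then show ?thesis using s' \<open>0 \<le> x1\<close> by (intro add_pos_nonneg mult_pos_pos mult_nonneg_nonneg) auto
  next
    assume "0 < x1"
    then show ?thesis using s' \<open>0 \<le> x0\<close> by (intro add_nonneg_pos mult_pos_pos mult_nonneg_nonneg) auto
  qed
  moreover have "0 \<le> k * (sinh (k * (l - x)) * integral {0..x} (\<lambda>r. sinh (k * r) * g r) +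
           sinh (k * x) * (integral {0..l} (\<lambda>r. sinh (k * (l - r)) * g r) - integral {0..x} (\<lambda>r. sinh (k * (l - r)) * g r)))"
    using n s k by (intro add_nonneg_nonneg mult_nonneg_nonneg) auto
  ultimately show "0 < edge_sol k l x0 x1 g x"
    unfolding edge_sol_def using sinh_kl by (intro divide_pos_pos) auto
qed

text \<open>Far from sharp in \<open>k\<close>; it is applied with \<open>k\<close> fixed, to see
  that derivatives decay over the graph as fast as the values.\<close>

lemma edge_sol'_bound:
  assumes g: "continuous_on {0..l} g" and G: "\<And>r. r \<in> {0..l} \<Longrightarrow> \<bar>g r\<bar> \<le> G" and x: "x \<in> {0..l}"
  shows "\<bar>edge_sol' k l x0 x1 g x\<bar> \<le> k * (\<bar>x0\<bar> + \<bar>x1\<bar> + 2 * G) * (cosh (k * l))\<^sup>2 / sinh (k * l)"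
proof -
  define A where "A = integral {0..x} (\<lambda>r. sinh (k * r) * g r)"
  define B where "B = integral {0..l} (\<lambda>r. sinh (k * (l - r)) * g r) - integral {0..x} (\<lambda>r. sinh (k * (l - r)) * g r)"
  define C where "C = cosh (k * l)"
  define s where "s = cosh (k * x)"
  define t where "t = cosh (k * (l - x))"
  note AB = kernel_integrals(1,2)[OF g G x, folded A_def B_def]
  have st: "1 \<le> s" "1 \<le> t" "s \<le> C" "t \<le> C" "1 \<le> C"
    using x k by (auto simp: s_def t_def C_def cosh_real_ge_1 cosh_real_nonneg_le_iff)
  have CC: "C \<le> C\<^sup>2" using st by (simp add: power2_eq_square)
  have G0: "G \<ge> 0" using G[of 0] l by force
  have "\<bar>- x0 * t + x1 * s + k * (- t * A + s * B)\<bar> \<le> \<bar>x0\<bar> * t + \<bar>x1\<bar> * s + (t * (k * \<bar>A\<bar>) + s * (k * \<bar>B\<bar>))"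
  proof -
    have "- x0 * t + x1 * s + k * (- t * A + s * B) = - (x0 * t) + x1 * s + (- (k * (t * A)) + k * (s * B))"
      by (simp add: algebra_simps)
    then have "\<bar>- x0 * t + x1 * s + k * (- t * A + s * B)\<bar> \<le> \<bar>x0 * t\<bar> + \<bar>x1 * s\<bar> + (\<bar>k * (t * A)\<bar> + \<bar>k * (s * B)\<bar>)"
      by linarith
    also have "\<dots> = \<bar>x0\<bar> * t + \<bar>x1\<bar> * s + (t * (k * \<bar>A\<bar>) + s * (k * \<bar>B\<bar>))"
      using st k by (simp add: abs_mult)
    finally show ?thesis .
  qed
  also have "\<dots> \<le> \<bar>x0\<bar> * C\<^sup>2 + \<bar>x1\<bar> * C\<^sup>2 + (t * (G * (s - 1)) + s * (G * (t - 1)))"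
    using st AB CC unfolding s_def[symmetric] t_def[symmetric] by (intro add_mono mult_left_mono) auto
  also have "\<dots> \<le> \<bar>x0\<bar> * C\<^sup>2 + \<bar>x1\<bar> * C\<^sup>2 + (C * (G * C) + C * (G * C))"
    using st G0 by (intro add_mono mult_mono mult_nonneg_nonneg order_refl) auto
  also have "\<dots> = (\<bar>x0\<bar> + \<bar>x1\<bar> + 2 * G) * C\<^sup>2"
    by (simp add: algebra_simps power2_eq_square)
  finally have "k * \<bar>- x0 * t + x1 * s + k * (- t * A + s * B)\<bar> \<le> k * ((\<bar>x0\<bar> + \<bar>x1\<bar> + 2 * G) * C\<^sup>2)"
    using k by (intro mult_left_mono) auto
  then show ?thesis
    using sinh_kl k unfolding edge_sol'_def
    by (simp add: A_def[symmetric] B_def[symmetric] C_def[symmetric] s_def[symmetric] t_def[symmetric]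
        abs_divide abs_mult divide_right_mono mult.assoc)
qed

lemma edge_flux_bound:
  assumes g: "continuous_on {0..l} g" and G: "\<And>r. r \<in> {0..l} \<Longrightarrow> \<bar>g r\<bar> \<le> G"
  shows "\<bar>edge_flux k l b g\<bar> \<le> G * (cosh (k * l) - 1)"
    and "(\<And>r. r \<in> {0..l} \<Longrightarrow> 0 \<le> g r) \<Longrightarrow> 0 \<le> edge_flux k l b g"
  using kernel_integrals(1,3)[OF g G, of l] kernel_integrals(2,4)[OF g G, of 0] k l
  by (cases b; auto simp: edge_flux_def abs_mult)+

lemma edge_sol_diff:
  assumes g: "continuous_on {0..l} g" "continuous_on {0..l} g'" and x: "x \<in> {0..l}"
  shows "edge_sol k l x0 x1 g x - edge_sol k l x0' x1' g' x =
         edge_sol k l (x0 - x0') (x1 - x1') (\<lambda>r. g r - g' r) x"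
proof -
  have d: "integral {0..y} (\<lambda>r. f r * (g r - g' r)) = integral {0..y} (\<lambda>r. f r * g r) - integral {0..y} (\<lambda>r. f r * g' r)"
    if "continuous_on {0..l} f" "y \<le> l" for f y
    using that unfolding right_diff_distrib
    by (intro integral_diff integrable_continuous_real continuous_intros)
      (auto intro: continuous_on_subset[OF that(1)] continuous_on_subset[OF g(1)] continuous_on_subset[OF g(2)])
  have c: "continuous_on {0..l} (\<lambda>r. sinh (k * r))" "continuous_on {0..l} (\<lambda>r. sinh (k * (l - r)))"
    by (intro continuous_intros)+
  have xl: "x \<le> l" using x by simp
  show ?thesis unfolding edge_sol_def d[OF c(1) xl] d[OF c(2) xl] d[OF c(2) order_refl] diff_divide_distrib[symmetric]
    by (rule arg_cong[where f="\<lambda>y. y / _"]) (simp add: algebra_simps)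
qed

lemma edge_flux_diff:
  assumes g: "continuous_on {0..l} g" "continuous_on {0..l} g'"
  shows "edge_flux k l b g - edge_flux k l b g' = edge_flux k l b (\<lambda>r. g r - g' r)"
proof -
  have "integral {0..l} (\<lambda>r. f r * (g r - g' r)) = integral {0..l} (\<lambda>r. f r * g r) - integral {0..l} (\<lambda>r. f r * g' r)"
    if "continuous_on {0..l} f" for f
    using that g unfolding right_diff_distrib
    by (intro integral_diff integrable_continuous_real continuous_intros)
  then show ?thesis unfolding edge_flux_def
    by (cases b) (simp_all add: continuous_intros right_diff_distrib)
qed

end

lemma edge_sol_continuous_param:
  fixes K :: "'z::topological_space \<Rightarrow> real"
  assumes K: "continuous_on Z K" "\<And>z. z \<in> Z \<Longrightarrow> K z > 0" and l: "l > 0"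
    and x: "continuous_on Z x0" "continuous_on Z x1"
    and g: "continuous_on (Z \<times> {0..l}) (\<lambda>(z, r). g z r)"
  shows "continuous_on (Z \<times> {0..l}) (\<lambda>(z, x). edge_sol (K z) l (x0 z) (x1 z) (g z) x)"
    and "continuous_on Z (\<lambda>z. edge_flux (K z) l b (g z))"
proof -
  have K': "continuous_on (Z \<times> {0..l}) (\<lambda>y. K (fst y))" and x': "continuous_on (Z \<times> {0..l}) (\<lambda>y. x0 (fst y))"
    "continuous_on (Z \<times> {0..l}) (\<lambda>y. x1 (fst y))"
    by (auto intro!: continuous_on_compose2[OF K(1)] continuous_on_compose2[OF x(1)] continuous_on_compose2[OF x(2)] continuous_intros)
  have g': "continuous_on (Z \<times> {0..l}) (\<lambda>y. g (fst y) (snd y))"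
    using g by (simp add: case_prod_unfold)
  have "continuous_on (Z \<times> {0..l}) (\<lambda>(z, r). sinh (K z * r) * g z r)"
    unfolding case_prod_unfold by (intro continuous_intros K' g')
  from continuous_on_running_integral[OF this]
  have A: "continuous_on (Z \<times> {0..l}) (\<lambda>y. integral {0..snd y} (\<lambda>r. sinh (K (fst y) * r) * g (fst y) r))"
    by (simp add: case_prod_unfold)
  have "continuous_on (Z \<times> {0..l}) (\<lambda>(z, r). sinh (K z * (l - r)) * g z r)"
    unfolding case_prod_unfold by (intro continuous_intros K' g')
  from continuous_on_running_integral[OF this]
  have B: "continuous_on (Z \<times> {0..l}) (\<lambda>y. integral {0..snd y} (\<lambda>r. sinh (K (fst y) * (l - r)) * g (fst y) r))"
    by (simp add: case_prod_unfold)
  have Al: "continuous_on Z (\<lambda>z. integral {0..l} (\<lambda>r. sinh (K z * r) * g z r))"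
    by (rule continuous_on_compose2[OF A, where f="\<lambda>z. (z, l)", simplified]) (use l in \<open>auto intro!: continuous_intros\<close>)
  have Bl: "continuous_on Z (\<lambda>z. integral {0..l} (\<lambda>r. sinh (K z * (l - r)) * g z r))"
    by (rule continuous_on_compose2[OF B, where f="\<lambda>z. (z, l)", simplified]) (use l in \<open>auto intro!: continuous_intros\<close>)
  have Bl': "continuous_on (Z \<times> {0..l}) (\<lambda>y. integral {0..l} (\<lambda>r. sinh (K (fst y) * (l - r)) * g (fst y) r))"
    by (rule continuous_on_compose2[OF Bl]) (auto intro!: continuous_intros)
  have nz: "sinh (K z * l) \<noteq> 0" if "z \<in> Z" for z using K(2)[OF that] l by auto
  show "continuous_on (Z \<times> {0..l}) (\<lambda>(z, x). edge_sol (K z) l (x0 z) (x1 z) (g z) x)"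
    unfolding edge_sol_def case_prod_unfold
    using nz by (intro continuous_intros K' x' A B Bl') auto
  show "continuous_on Z (\<lambda>z. edge_flux (K z) l b (g z))"
    unfolding edge_flux_def by (cases b) (auto intro!: continuous_intros K(1) Al Bl)
qed

section \<open>Small solutions with prescribed values on a finite vertex set\<close>


lemma geometric_increments_lim:
  fixes f :: "nat \<Rightarrow> 'a \<Rightarrow> 'b::banach"
  assumes inc: "\<And>n x. x \<in> A \<Longrightarrow> norm (f (Suc n) x - f n x) \<le> C / 2 ^ n"
  shows "uniform_limit A f (\<lambda>x. lim (\<lambda>n. f n x)) sequentially"
    and "x \<in> A \<Longrightarrow> norm (lim (\<lambda>n. f n x) - f n x) \<le> 2 * C / 2 ^ n"
proof -
  obtain g where g: "uniform_limit A f g sequentially"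
      "\<And>n x. x \<in> A \<Longrightarrow> norm (g x - f n x) \<le> 2 * C / 2 ^ n"
    using geometric_increments_limit[of A f C, OF inc] by blast
  have lim: "lim (\<lambda>n. f n x) = g x" if "x \<in> A" for x
    using tendsto_uniform_limitI[OF g(1) that] by (rule limI)
  show "uniform_limit A f (\<lambda>x. lim (\<lambda>n. f n x)) sequentially"
    using g(1) uniform_limit_cong'[of A f f "\<lambda>x. lim (\<lambda>n. f n x)" g sequentially] lim by blast
  show "x \<in> A \<Longrightarrow> norm (lim (\<lambda>n. f n x) - f n x) \<le> 2 * C / 2 ^ n"
    using g(2) lim by simp
qed

text \<open>A half-edge \<open>(e, b)\<close> is the edge \<open>e\<close> seen from its origin (\<open>b = False\<close>) or its terminus
(\<open>b = True\<close>).\<close>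

definition halfedges :: "('e \<Rightarrow> 'v) \<Rightarrow> ('e \<Rightarrow> 'v) \<Rightarrow> 'v \<Rightarrow> ('e \<times> bool) set" where
  "halfedges src tgt v = {h. (if snd h then tgt (fst h) else src (fst h)) = v}"

definition far_end :: "('e \<Rightarrow> 'v) \<Rightarrow> ('e \<Rightarrow> 'v) \<Rightarrow> 'e \<times> bool \<Rightarrow> 'v" where
  "far_end src tgt h = (if snd h then src (fst h) else tgt (fst h))"

locale metric_graph =
  fixes src tgt :: "'e \<Rightarrow> 'v" and len :: "'e \<Rightarrow> real" and p e0 Lm :: real and D :: nat
  assumes p6: "p > 6" and e0: "0 < e0" "\<And>e. e0 \<le> len e" and Lm: "\<And>e. len e \<le> Lm"
    and finH: "\<And>v. finite (halfedges src tgt v)" and cardH: "\<And>v. card (halfedges src tgt v) \<le> D"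
    and neH: "\<And>v. halfedges src tgt v \<noteq> {}"
    and conn: "\<And>v w. (v, w) \<in> (graph_adj src tgt)\<^sup>*"
begin

abbreviation "H \<equiv> halfedges src tgt"
abbreviation "far \<equiv> far_end src tgt"

lemma len_pos: "len e > 0" using e0 by (rule less_le_trans)

lemma adj_far: "(v, w) \<in> graph_adj src tgt \<longleftrightarrow> (\<exists>h\<in>H v. far h = w)"
  by (fastforce simp: graph_adj_def halfedges_def far_end_def)

lemma far_H: "h \<in> H v \<Longrightarrow> (fst h, \<not> snd h) \<in> H (far h)" "h \<in> H v \<Longrightarrow> far (fst h, \<not> snd h) = v"
  by (auto simp: halfedges_def far_end_def)

lemma H_src: "(e, False) \<in> H (src e)" and H_tgt: "(e, True) \<in> H (tgt e)"
  by (auto simp: halfedges_def)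

end

text \<open>One threshold for both sources of smallness: the Lipschitz constant of the nonlinearity
  and \<open>1 / sinh (k * len e)\<close>. The factor \<open>D + 1\<close> compensates the growth of
  the weights from a vertex to its neighbours, and 100 leaves room for all later margins.\<close>

definition outer_eps :: "nat \<Rightarrow> real" where
  "outer_eps D = 1 / (100 * (real D + 1))"

text \<open>\<open>X\<close> carries the prescribed values, with a separate value at
  \<open>vb\<close>. In the application \<open>X\<close> is the vertex set of the path and
  \<open>vb\<close> its last vertex.\<close>

locale outer = metric_graph src tgt len p e0 Lm D
  for src tgt :: "'e \<Rightarrow> 'v" and len p e0 Lm D +
  fixes X :: "'v set" and vb :: 'v and K0 m0 :: real
  assumes X: "finite X" "X \<noteq> {}" and K0: "K0 > 0" and m0: "m0 > 0"
    and small_m0: "(p - 1) * (4 * m0) powr (p - 2) \<le> outer_eps D"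
    and large_K0: "1 / sinh (K0 * e0) \<le> outer_eps D"
begin

abbreviation "eps \<equiv> outer_eps D"

lemma eps: "0 < eps" "eps \<le> 1/100" "2 * eps * (2 * real D + 3) \<le> 1/4" "eps * real D \<le> 1/100"
  by (auto simp: outer_eps_def field_simps)

section \<open>Weights decaying with the distance to the prescribed vertices\<close>

primrec layer :: "nat \<Rightarrow> 'v set" where
  "layer 0 = X"
| "layer (Suc n) = layer n \<union> (\<Union>v\<in>layer n. far ` H v)"

definition lev_dist :: "'v \<Rightarrow> nat" where "lev_dist v = (LEAST n. v \<in> layer n)"

text \<open>The layers grow at most by the factor \<open>D + 1\<close>, so that this choice makes the weights summable.\<close>

definition q :: real where "q = 1 / (2 * (real D + 1))"

definition w :: "'v \<Rightarrow> real" where "w v = q ^ lev_dist v"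

definition W :: "'e \<Rightarrow> real" where "W e = w (src e) + w (tgt e)"

lemma ex_layer: "\<exists>n. v \<in> layer n"
proof -
  obtain x where x: "x \<in> X" using X by auto
  from conn[of x v] show ?thesis
  proof (induction rule: rtrancl_induct)
    case base
    show ?case using x by (intro exI[of _ 0]) simp
  next
    case (step y z)
    then obtain n where "y \<in> layer n" by blast
    moreover obtain h where "h \<in> H y" "far h = z" using step by (auto simp: adj_far)
    ultimately have "z \<in> layer (Suc n)" by auto
    then show ?case by blast
  qed
qed

lemma lev_dist_in: "v \<in> layer (lev_dist v)"
  unfolding lev_dist_def using ex_layer by (rule LeastI_ex)

lemma lev_dist_far: "h \<in> H v \<Longrightarrow> lev_dist (far h) \<le> Suc (lev_dist v)"
  unfolding lev_dist_def[of "far h"] by (rule Least_le) (use lev_dist_in[of v] in auto)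

lemma q: "0 < q" "q < 1" by (auto simp: q_def)

lemma w_pos: "0 < w v" and w_le_1: "w v \<le> 1" and w_X: "v \<in> X \<Longrightarrow> w v = 1"
proof -
  show "0 < w v" "w v \<le> 1" using q by (auto simp: w_def power_le_one)
  assume "v \<in> X"
  then have "lev_dist v \<le> 0" unfolding lev_dist_def by (intro Least_le) simp
  then show "w v = 1" by (simp add: w_def)
qed

text \<open>Distances of neighbours differ by at most one, and
  \<open>1 / q = 2 * D + 2\<close>.\<close>

lemma w_far: 
  assumes "h \<in> H v"
  shows "w (far h) \<le> (2 * real D + 2) * w v"
proof -
  have "lev_dist v \<le> Suc (lev_dist (far h))"
    using lev_dist_far[OF far_H(1)[OF assms]] far_H(2)[OF assms] by simp
  then have "q ^ Suc (lev_dist (far h)) \<le> q ^ lev_dist v"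
    using q by (intro power_decreasing) auto
  then have "q * w (far h) \<le> w v" by (simp add: w_def)
  then show ?thesis by (simp add: q_def field_simps)
qed

lemma W_H:
  assumes "h \<in> H v"
  shows "W (fst h) = w v + w (far h)"
  using assms by (auto simp: W_def halfedges_def far_end_def split: if_splits)

lemma W_le: "h \<in> H v \<Longrightarrow> W (fst h) \<le> (2 * real D + 3) * w v"
  using W_H[of h v] w_far[of h v] by (simp add: algebra_simps)

lemma W_pos: "0 < W e" and W_le_2: "W e \<le> 2"
  using w_pos[of "src e"] w_pos[of "tgt e"] w_le_1[of "src e"] w_le_1[of "tgt e"] by (auto simp: W_def)

lemma W_sq: "(W e)\<^sup>2 \<le> 2 * W e"
  using mult_right_mono[OF W_le_2[of e], of "W e"] W_pos[of e] by (simp add: power2_eq_square)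

lemma layer_finite: "finite (layer n)" 
  by (induction n) (auto simp: X finH)

lemma card_layer: "card (layer n) \<le> card X * (D + 1) ^ n"
proof (induction n)
  case (Suc n)
  have "card (\<Union>v\<in>layer n. far ` H v) \<le> (\<Sum>v\<in>layer n. card (far ` H v))"
    by (rule card_UN_le[OF layer_finite])
  also have "\<dots> \<le> (\<Sum>v\<in>layer n. D)"
    by (intro sum_mono order_trans[OF card_image_le[OF finH] cardH])
  finally have "card (layer (Suc n)) \<le> card (layer n) * (D + 1)"
    using card_Un_le[of "layer n" "\<Union>v\<in>layer n. far ` H v"] by simp
  also have "\<dots> \<le> card X * (D + 1) ^ n * (D + 1)" using Suc by (rule mult_right_mono) simp
  finally show ?case by (simp add: algebra_simps)
qed simp

text \<open>At distance \<open>n\<close> there are at most \<open>card X * (D + 1) ^ n\<close>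
  vertices, each of weight \<open>q ^ n\<close>, and \<open>(D + 1) * q = 1/2\<close>: a geometric
  series.\<close>

lemma sum_w_le:
  assumes "finite F"
  shows "sum w F \<le> 2 * real (card X)"
proof -
  define N where "N = Max (insert 0 (lev_dist ` F))"
  have N: "lev_dist ` F \<subseteq> {..N}" using assms by (auto simp: N_def)
  have "sum w F = (\<Sum>n\<in>{..N}. \<Sum>v\<in>{v\<in>F. lev_dist v = n}. w v)"
    using sum.group[OF assms finite_atMost N, of w] by simp
  also have "\<dots> \<le> (\<Sum>n\<in>{..N}. real (card X) * (1/2) ^ n)"
  proof (rule sum_mono)
    fix n
    have "(\<Sum>v\<in>{v\<in>F. lev_dist v = n}. w v) = real (card {v\<in>F. lev_dist v = n}) * q ^ n"
      by (simp add: w_def)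
    also have "card {v\<in>F. lev_dist v = n} \<le> card (layer n)"
      by (intro card_mono layer_finite) (use lev_dist_in in auto)
    then have "card {v\<in>F. lev_dist v = n} \<le> card X * (D + 1) ^ n"
      using card_layer[of n] by (rule order_trans)
    then have "real (card {v\<in>F. lev_dist v = n}) * q ^ n \<le> real (card X * (D + 1) ^ n) * q ^ n"
      using q by (intro mult_right_mono of_nat_mono) auto
    also have "\<dots> = real (card X) * ((real D + 1) * q) ^ n"
      by (simp add: power_mult_distrib add.commute)
    also have "(real D + 1) * q = 1/2" by (simp add: q_def field_simps)
    finally show "(\<Sum>v\<in>{v\<in>F. lev_dist v = n}. w v) \<le> real (card X) * (1/2) ^ n" .
  qed
  also have "\<dots> = real (card X) * (\<Sum>n\<in>{..N}. (1/2) ^ n)" by (simp add: sum_distrib_left)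
  also have "(\<Sum>n\<in>{..N}. (1/2::real) ^ n) \<le> 2"
    by (simp add: sum_gp0)
  finally show ?thesis by (simp add: mult_left_mono)
qed

lemma sum_W_le:
  assumes "finite F"
  shows "sum W F \<le> 4 * real D * real (card X)"
proof -
  have aux: "(\<Sum>e\<in>F. w (f e)) \<le> real D * (2 * real (card X))"
    if f: "f = src \<or> f = tgt" for f :: "'e \<Rightarrow> 'v"
  proof -
    have "(\<Sum>e\<in>F. w (f e)) = (\<Sum>v\<in>f ` F. \<Sum>e\<in>{e\<in>F. f e = v}. w (f e))"
      using sum.group[OF assms finite_imageI[OF assms], of f f "\<lambda>e. w (f e)"] by simp
    also have "\<dots> \<le> (\<Sum>v\<in>f ` F. real D * w v)"
    proof (rule sum_mono)
      fix v
      have "card {e\<in>F. f e = v} \<le> card (H v)"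
        using f
      proof
        assume "f = src"
        then show ?thesis
          by (intro card_inj_on_le[where f="\<lambda>e. (e, False)"] finH) (auto simp: inj_on_def halfedges_def)
      next
        assume "f = tgt"
        then show ?thesis
          by (intro card_inj_on_le[where f="\<lambda>e. (e, True)"] finH) (auto simp: inj_on_def halfedges_def)
      qed
      then have "real (card {e\<in>F. f e = v}) * w v \<le> real D * w v"
        using cardH[of v] w_pos[of v] by (intro mult_right_mono) auto
      then show "(\<Sum>e\<in>{e\<in>F. f e = v}. w (f e)) \<le> real D * w v" by simp
    qed
    also have "\<dots> = real D * sum w (f ` F)" by (simp add: sum_distrib_left)
    also have "\<dots> \<le> real D * (2 * real (card X))"
      using assms by (intro mult_left_mono sum_w_le) auto
    finally show ?thesis .
  qed
  show ?thesis using aux[of src] aux[of tgt] by (simp add: W_def sum.distrib)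
qed

lemma W_summable: "W summable_on S"
  by (intro nonneg_bdd_above_summable_on bdd_aboveI[of _ "4 * real D * real (card X)"])
    (use W_pos sum_W_le in \<open>auto intro: less_imp_le\<close>)

lemma W2_summable: "(\<lambda>e. C * (W e)\<^sup>2) summable_on S"
proof -
  have "(\<lambda>e. 2 * W e) summable_on S" by (intro summable_on_cmult_right W_summable)
  then have "(\<lambda>e. (W e)\<^sup>2) summable_on S"
    by (rule summable_on_comparison_test) (auto simp: W_sq)
  then show ?thesis by (rule summable_on_cmult_right)
qed

lemma sum_W2_le: "infsum (\<lambda>e. (W e)\<^sup>2) S \<le> 8 * real D * real (card X)"
proof (rule infsum_le_finite_sums)
  show "(\<lambda>e. (W e)\<^sup>2) summable_on S" using W2_summable[of 1] by simp
  fix F assume F: "finite F" "F \<subseteq> S"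
  have "(\<Sum>e\<in>F. (W e)\<^sup>2) \<le> (\<Sum>e\<in>F. 2 * W e)"
    by (intro sum_mono W_sq)
  also have "\<dots> = 2 * sum W F" by (simp add: sum_distrib_left)
  finally show "(\<Sum>e\<in>F. (W e)\<^sup>2) \<le> 8 * real D * real (card X)" using sum_W_le[OF F(1)] by simp
qed

section \<open>The fixed-point map and its contraction estimate\<close>

definition Zs :: "(real \<times> real \<times> real) set" where
  "Zs = {(k, a, b). K0 \<le> k \<and> 0 < a \<and> a \<le> m0 \<and> 0 < b \<and> b \<le> m0}"

definition mx :: "real \<times> real \<times> real \<Rightarrow> real" where "mx z = max (fst (snd z)) (snd (snd z))"

text \<open>In the application the interior vertices of the path also receive the first value; they
  meet only edges of the path, and the glued function uses the outer solution only off the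
  path.\<close>

definition data :: "real \<times> real \<times> real \<Rightarrow> 'v \<Rightarrow> real" where
  "data z v = (if v = vb then snd (snd z) else fst (snd z))"

definition pw :: "(real \<Rightarrow> real) \<Rightarrow> real \<Rightarrow> real" where "pw u r = u r powr (p - 1)"

text \<open>The vertex value that solves the Kirchhoff condition: with \<open>c\<close> collecting
  far values and fluxes, the outgoing derivatives \<open>k * (c h - y * cosh) / sinh\<close> sum to
  zero exactly for this \<open>y\<close>.\<close>

definition vsum :: "real \<Rightarrow> ('e \<times> bool \<Rightarrow> real) \<Rightarrow> 'v \<Rightarrow> real" where
  "vsum k c v = (\<Sum>h\<in>H v. c h / sinh (k * len (fst h))) / (\<Sum>h\<in>H v. cosh (k * len (fst h)) / sinh (k * len (fst h)))"

text \<open>A Jacobi-type step: neighbour values and nonlinearity are taken from the old pair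
  \<open>s\<close>, while the value at \<open>v\<close> itself is solved for. \<open>newu\<close>
  then uses the new vertex values, so each iterate is continuous at the vertices.\<close>

definition newY :: "real \<times> real \<times> real \<Rightarrow> ('v \<Rightarrow> real) \<times> ('e \<Rightarrow> real \<Rightarrow> real) \<Rightarrow> 'v \<Rightarrow> real" where
  "newY z s v = (if v \<in> X then data z v else
     vsum (fst z) (\<lambda>h. fst s (far h) + edge_flux (fst z) (len (fst h)) (snd h) (pw (snd s (fst h)))) v)"

definition newu :: "real \<times> real \<times> real \<Rightarrow> ('v \<Rightarrow> real) \<times> ('e \<Rightarrow> real \<Rightarrow> real) \<Rightarrow> 'e \<Rightarrow> real \<Rightarrow> real" where
  "newu z s e = edge_sol (fst z) (len e) (newY z s (src e)) (newY z s (tgt e)) (pw (snd s e))"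

text \<open>A set that the step maps into itself. The bounds carry the weights, so decay at infinity
  passes to the limit; the factor 2 on edges leaves room for the source term.\<close>

definition adm :: "real \<times> real \<times> real \<Rightarrow> ('v \<Rightarrow> real) \<times> ('e \<Rightarrow> real \<Rightarrow> real) \<Rightarrow> bool" where
  "adm z s \<longleftrightarrow> (\<forall>v. 0 \<le> fst s v \<and> fst s v \<le> mx z * w v) \<and>
     (\<forall>e. \<forall>x\<in>{0..len e}. 0 \<le> snd s e x \<and> snd s e x \<le> 2 * mx z * W e) \<and>
     (\<forall>e. continuous_on {0..len e} (snd s e))"

lemma ZsD:
  assumes "z \<in> Zs"
  shows "K0 \<le> fst z" "0 < fst z" "0 < fst (snd z)" "0 < snd (snd z)" "0 < mx z" "mx z \<le> m0"
    "0 < data z v" "data z v \<le> mx z"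
  using assms K0 by (auto simp: Zs_def mx_def data_def)

lemma hyp_bounds:
  assumes "K0 \<le> k" "e0 \<le> l"
  shows "0 < sinh (k * l)" "1 \<le> eps * sinh (k * l)" "1 \<le> eps * cosh (k * l)"
    "sinh (k * l) \<le> cosh (k * l)" "cosh (k * l) \<le> (1 + eps) * sinh (k * l)"
proof -
  have le: "0 < K0 * e0" "K0 * e0 \<le> k * l" using assms K0 e0 by (auto intro: mult_mono)
  show s: "0 < sinh (k * l)" using le by simp
  have "1 \<le> eps * sinh (K0 * e0)" using large_K0 le by (simp add: pos_divide_le_eq)
  also have "\<dots> \<le> eps * sinh (k * l)" using le eps by simp
  finally show 1: "1 \<le> eps * sinh (k * l)" .
  show sc: "sinh (k * l) \<le> cosh (k * l)" by (simp add: sinh_le_cosh_real)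
  with 1 eps show "1 \<le> eps * cosh (k * l)" by (meson mult_left_mono order_trans less_imp_le)
  have "cosh (k * l) - sinh (k * l) \<le> 1" using le by (simp add: cosh_minus_sinh)
  with 1 show "cosh (k * l) \<le> (1 + eps) * sinh (k * l)" by (simp add: distrib_right)
qed

text \<open>The quotient is estimated term by term: \<open>1 <= eps * cosh\<close> absorbs the far
  value, \<open>W_le\<close> trades the edge weight for \<open>w v\<close> at the price
  \<open>2 * D + 3\<close>, and \<open>2 * eps * (2 * D + 3) <= 1/4\<close>. With different
  \<open>C\<close> this yields both the invariance of \<open>adm\<close> and the
  contraction.\<close>

lemma vsum_bound:
  assumes k: "K0 \<le> k" and C: "C \<ge> 0"
    and c: "\<And>h. h \<in> H v \<Longrightarrow> \<bar>c h\<bar> \<le> C * w (far h) + eps * C * W (fst h) * (cosh (k * len (fst h)) - 1)"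
  shows "\<bar>vsum k c v\<bar> \<le> C / 4 * w v"
proof -
  define S where "S = (\<Sum>h\<in>H v. cosh (k * len (fst h)) / sinh (k * len (fst h)))"
  have hb: "0 < sinh (k * len (fst h))" "1 \<le> eps * cosh (k * len (fst h))" for h :: "'e \<times> bool"
    using hyp_bounds[OF k e0(2)] by auto
  have S: "S > 0" unfolding S_def using neH finH hb
    by (intro sum_pos) auto
  have "\<bar>\<Sum>h\<in>H v. c h / sinh (k * len (fst h))\<bar> \<le> (\<Sum>h\<in>H v. \<bar>c h / sinh (k * len (fst h))\<bar>)"
    by (rule sum_abs)
  also have "\<dots> \<le> (\<Sum>h\<in>H v. C / 4 * w v * (cosh (k * len (fst h)) / sinh (k * len (fst h))))"
  proof (rule sum_mono)
    fix h assume h: "h \<in> H v"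
    define ch where "ch = cosh (k * len (fst h))"
    have ch: "1 \<le> ch" "1 \<le> eps * ch" using hb[of h] by (auto simp: ch_def cosh_real_ge_1)
    have wW: "w (far h) \<le> W (fst h)" using W_H[OF h] w_pos[of v] by simp
    have "w (far h) * 1 \<le> W (fst h) * (eps * ch)"
      using wW ch w_pos[of "far h"] W_pos[of "fst h"] by (intro mult_mono) auto
    then have "C * w (far h) \<le> C * (W (fst h) * (eps * ch))"
      using C by (intro mult_left_mono) auto
    moreover have "eps * C * W (fst h) * (ch - 1) \<le> eps * C * W (fst h) * ch"
      using eps C W_pos[of "fst h"] by (intro mult_left_mono) auto
    ultimately have "\<bar>c h\<bar> \<le> 2 * (eps * C * W (fst h) * ch)"
      using c[OF h] by (simp add: ch_def[symmetric] algebra_simps)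
    also have "\<dots> = (2 * eps * C * ch) * W (fst h)" by simp
    also have "\<dots> \<le> (2 * eps * C * ch) * ((2 * real D + 3) * w v)"
      using W_le[OF h] eps C ch by (intro mult_left_mono) auto
    also have "\<dots> = (2 * eps * (2 * real D + 3)) * (C * ch * w v)" by simp
    also have "\<dots> \<le> 1/4 * (C * ch * w v)"
      using eps(3) C ch w_pos[of v] by (intro mult_right_mono) auto
    finally have "\<bar>c h\<bar> \<le> C / 4 * w v * ch" by (simp add: algebra_simps)
    then have "\<bar>c h\<bar> / sinh (k * len (fst h)) \<le> C / 4 * w v * ch / sinh (k * len (fst h))"
      using hb(1)[of h] by (intro divide_right_mono) auto
    then show "\<bar>c h / sinh (k * len (fst h))\<bar> \<le> C / 4 * w v * (cosh (k * len (fst h)) / sinh (k * len (fst h)))"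
      by (simp only: abs_divide abs_of_pos[OF hb(1)] times_divide_eq_right ch_def)
  qed
  also have "\<dots> = C / 4 * w v * S" by (simp add: S_def sum_distrib_left)
  finally show ?thesis using S unfolding vsum_def S_def[symmetric] by (simp add: abs_divide pos_divide_le_eq)
qed

text \<open>Admissible values stay below \<open>4 * m0\<close>, where the derivative of the power is
  at most \<open>eps\<close> by the choice of \<open>m0\<close>.\<close>

lemma pw_lip:
  assumes z: "z \<in> Zs" and s: "adm z s" "adm z s'" and x: "x \<in> {0..len e}"
  shows "\<bar>pw (snd s e) x - pw (snd s' e) x\<bar> \<le> eps * \<bar>snd s e x - snd s' e x\<bar>"
proof -
  have b: "0 \<le> snd t e x \<and> snd t e x \<le> 4 * m0" if "adm z t" for t
  proof -
    have "snd t e x \<le> 2 * mx z * W e" using that x by (auto simp: adm_def)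
    also have "\<dots> \<le> 2 * m0 * 2" using ZsD(5,6)[OF z] W_le_2[of e] W_pos[of e] by (intro mult_mono) auto
    finally show ?thesis using that x by (auto simp: adm_def)
  qed
  have "\<bar>pw (snd s e) x - pw (snd s' e) x\<bar> \<le> (p - 1) * (4 * m0) powr (p - 1 - 1) * \<bar>snd s e x - snd s' e x\<bar>"
    unfolding pw_def using b[OF s(1)] b[OF s(2)] p6 by (intro powr_lipschitz) auto
  also have "\<dots> \<le> eps * \<bar>snd s e x - snd s' e x\<bar>"
    using small_m0 by (intro mult_right_mono) (auto simp: diff_diff_eq)
  finally show ?thesis .
qed

lemma adm_zero: "z \<in> Zs \<Longrightarrow> adm z (\<lambda>_. 0, \<lambda>_ _. 0)"
  using ZsD(5)[of z] w_pos W_pos by (auto simp: adm_def intro: less_imp_le)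

lemma pw_bound:
  assumes z: "z \<in> Zs" and s: "adm z s" and x: "x \<in> {0..len e}"
  shows "0 \<le> pw (snd s e) x" "pw (snd s e) x \<le> eps * snd s e x" "pw (snd s e) x \<le> eps * (2 * mx z * W e)"
proof -
  show 0: "0 \<le> pw (snd s e) x" by (simp add: pw_def)
  show 1: "pw (snd s e) x \<le> eps * snd s e x"
    using pw_lip[OF z s adm_zero[OF z] x] s x p6 by (auto simp: pw_def adm_def)
  have "snd s e x \<le> 2 * mx z * W e" using s x by (auto simp: adm_def)
  with 1 show "pw (snd s e) x \<le> eps * (2 * mx z * W e)"
    using eps by (meson mult_left_mono order_trans less_imp_le)
qed

lemma pw_cont: "adm z s \<Longrightarrow> continuous_on {0..len e} (pw (snd s e))"
  unfolding pw_def[abs_def] using p6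
  by (intro continuous_on_powr' continuous_on_const) (auto simp: adm_def)

lemma vsum_nonneg:
  assumes k: "K0 \<le> k" and c: "\<And>h. h \<in> H v \<Longrightarrow> 0 \<le> c h"
  shows "0 \<le> vsum k c v" "h \<in> H v \<Longrightarrow> 0 < c h \<Longrightarrow> 0 < vsum k c v"
proof -
  have hb: "0 < sinh (k * len (fst h))" for h :: "'e \<times> bool" using hyp_bounds[OF k e0(2)] by auto
  have S: "0 < (\<Sum>h\<in>H v. cosh (k * len (fst h)) / sinh (k * len (fst h)))"
    using neH finH hb by (intro sum_pos) auto
  show "0 \<le> vsum k c v" unfolding vsum_def
    using S c hb by (intro divide_nonneg_pos sum_nonneg) (auto intro: less_imp_le divide_nonneg_pos)
  assume "h \<in> H v" "0 < c h"
  then have "0 < (\<Sum>h\<in>H v. c h / sinh (k * len (fst h)))"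
    using c hb by (intro sum_pos2[OF finH, of h]) (auto intro: divide_nonneg_pos)
  then show "0 < vsum k c v" unfolding vsum_def using S by simp
qed

lemma newY_bounds:
  assumes z: "z \<in> Zs" and s: "adm z s"
  shows "0 \<le> newY z s v" "newY z s v \<le> mx z * w v"
proof -
  define c where "c h = fst s (far h) + edge_flux (fst z) (len (fst h)) (snd h) (pw (snd s (fst h)))" for h
  note zz = ZsD[OF z]
  have J: "0 \<le> edge_flux (fst z) (len e) b (pw (snd s e))"
     "edge_flux (fst z) (len e) b (pw (snd s e)) \<le> eps * (2 * mx z * W e) * (cosh (fst z * len e) - 1)" for e b
    using edge_flux_bound[OF zz(2) len_pos[of e] pw_cont[OF s, of e], of "eps * (2 * mx z * W e)" b] pw_bound[OF z s] by auto
  have c0: "0 \<le> c h" for h using s J by (auto simp: c_def adm_def)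
  \<comment> \<open>The doubled constant accommodates the edge bound \<open>2 * mx z * W e\<close>;
    \<open>vsum_bound\<close> still returns only half of what is admissible.\<close>
  have "\<bar>c h\<bar> \<le> (2 * mx z) * w (far h) + eps * (2 * mx z) * W (fst h) * (cosh (fst z * len (fst h)) - 1)" for h
  proof -
    have "fst s (far h) \<le> mx z * w (far h)" using s by (auto simp: adm_def)
    moreover have "0 \<le> mx z * w (far h)" using zz(5) w_pos[of "far h"] by simp
    ultimately show ?thesis using c0[of h] J(2)[of "fst h" "snd h"] by (simp add: c_def algebra_simps)
  qed
  then have "\<bar>vsum (fst z) c v\<bar> \<le> (2 * mx z) / 4 * w v"
    using zz by (intro vsum_bound) auto
  moreover have "0 \<le> mx z * w v" using zz(5) w_pos[of v] by simp
  ultimately have "vsum (fst z) c v \<le> mx z * w v" by simp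
  moreover have "0 \<le> vsum (fst z) c v" using vsum_nonneg(1)[OF zz(1)] c0 by blast
  ultimately show "0 \<le> newY z s v" "newY z s v \<le> mx z * w v"
    using zz(7,8)[of v] w_X[of v] unfolding newY_def c_def[abs_def] by auto
qed

lemma adm_new:
  assumes z: "z \<in> Zs" and s: "adm z s"
  shows "adm z (newY z s, newu z s)"
proof -
  note zz = ZsD[OF z]
  have u: "0 \<le> newu z s e x" "newu z s e x \<le> 2 * mx z * W e" if x: "x \<in> {0..len e}" for e x
  proof -
    have Y: "0 \<le> newY z s v" "newY z s v \<le> mx z * w v" for v using newY_bounds[OF z s] by auto
    show "0 \<le> newu z s e x" unfolding newu_def
      using pw_bound(1)[OF z s] Y x by (intro edge_sol_nonneg(1)[OF zz(2) len_pos pw_cont[OF s]]) auto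
    have "\<bar>newu z s e x\<bar> \<le> \<bar>newY z s (src e)\<bar> + \<bar>newY z s (tgt e)\<bar> + eps * (2 * mx z * W e)"
      unfolding newu_def using pw_bound[OF z s] x
      by (intro edge_sol_bound[OF zz(2) len_pos pw_cont[OF s]]) auto
    also have "\<dots> \<le> mx z * w (src e) + mx z * w (tgt e) + 1/2 * (2 * mx z * W e)"
      using Y[of "src e"] Y[of "tgt e"] eps zz(5) W_pos[of e] by (intro add_mono mult_right_mono) auto
    also have "\<dots> = 2 * mx z * W e" by (simp add: W_def algebra_simps)
    finally show "newu z s e x \<le> 2 * mx z * W e" by simp
  qed
  have "continuous_on {0..len e} (newu z s e)" for e
    unfolding newu_def using edge_sol_derivs(1)[OF zz(2) len_pos pw_cont[OF s]]
    by (intro DERIV_continuous_on) auto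
  then show ?thesis using u newY_bounds[OF z s] by (auto simp: adm_def)
qed

text \<open>Vertex values contract by 1/4. With the source term, which costs at most another 1/4,
  edge values contract by 1/2, the rate required by \<open>geometric_increments_lim\<close>.\<close>

lemma new_diff:
  assumes z: "z \<in> Zs" and s: "adm z s" "adm z s'" and B: "B \<ge> 0"
    and dY: "\<And>v. \<bar>fst s v - fst s' v\<bar> \<le> B * w v"
    and du: "\<And>e x. x \<in> {0..len e} \<Longrightarrow> \<bar>snd s e x - snd s' e x\<bar> \<le> B * W e"
  shows "\<bar>newY z s v - newY z s' v\<bar> \<le> B / 2 * w v"
    and "x \<in> {0..len e} \<Longrightarrow> \<bar>newu z s e x - newu z s' e x\<bar> \<le> B / 2 * W e"
proof -
  note zz = ZsD[OF z]
  have dp: "\<bar>pw (snd s e) x - pw (snd s' e) x\<bar> \<le> eps * (B * W e)" if "x \<in> {0..len e}" for e x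
    using pw_lip[OF z s that] du[OF that] eps by (meson mult_left_mono order_trans less_imp_le)
  have cd: "continuous_on {0..len e} (\<lambda>r. pw (snd s e) r - pw (snd s' e) r)" for e
    by (intro continuous_intros pw_cont[OF s(1)] pw_cont[OF s(2)])
  have Y4: "\<bar>newY z s v - newY z s' v\<bar> \<le> B / 4 * w v" for v
  proof (cases "v \<in> X")
    case True
    then show ?thesis using B w_pos[of v] by (simp add: newY_def)
  next
    case False
    have "newY z s v - newY z s' v = vsum (fst z) (\<lambda>h. (fst s (far h) - fst s' (far h)) +
        edge_flux (fst z) (len (fst h)) (snd h) (\<lambda>r. pw (snd s (fst h)) r - pw (snd s' (fst h)) r)) v"
      using False
      by (simp add: newY_def vsum_def diff_divide_distrib[symmetric] sum_subtractf[symmetric]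
          edge_flux_diff[OF zz(2) len_pos pw_cont[OF s(1)] pw_cont[OF s(2)], symmetric] algebra_simps)
    also have "\<bar>\<dots>\<bar> \<le> B / 4 * w v"
    proof (rule vsum_bound[OF zz(1) B])
      fix h
      have "\<bar>edge_flux (fst z) (len (fst h)) (snd h) (\<lambda>r. pw (snd s (fst h)) r - pw (snd s' (fst h)) r)\<bar>
           \<le> eps * (B * W (fst h)) * (cosh (fst z * len (fst h)) - 1)"
        using dp by (intro edge_flux_bound(1)[OF zz(2) len_pos cd]) auto
      then show "\<bar>(fst s (far h) - fst s' (far h)) +
        edge_flux (fst z) (len (fst h)) (snd h) (\<lambda>r. pw (snd s (fst h)) r - pw (snd s' (fst h)) r)\<bar>
        \<le> B * w (far h) + eps * B * W (fst h) * (cosh (fst z * len (fst h)) - 1)"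
        using dY[of "far h"] by (simp add: mult.assoc)
    qed
    finally show ?thesis .
  qed
  have "0 \<le> B * w v" using B w_pos[of v] by simp
  then show "\<bar>newY z s v - newY z s' v\<bar> \<le> B / 2 * w v" using Y4[of v] by simp
  assume x: "x \<in> {0..len e}"
  have "\<bar>newu z s e x - newu z s' e x\<bar> \<le> \<bar>newY z s (src e) - newY z s' (src e)\<bar> +
      \<bar>newY z s (tgt e) - newY z s' (tgt e)\<bar> + eps * (B * W e)"
    unfolding newu_def edge_sol_diff[OF zz(2) len_pos pw_cont[OF s(1)] pw_cont[OF s(2)] x]
    using dp x by (intro edge_sol_bound[OF zz(2) len_pos cd]) auto
  also have "\<dots> \<le> B / 4 * w (src e) + B / 4 * w (tgt e) + 1/4 * (B * W e)"
    using eps B W_pos[of e] Y4 by (intro add_mono mult_right_mono) auto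
  also have "\<dots> = B / 2 * W e" by (simp add: W_def algebra_simps)
  finally show "\<bar>newu z s e x - newu z s' e x\<bar> \<le> B / 2 * W e" .
qed

primrec it :: "nat \<Rightarrow> real \<times> real \<times> real \<Rightarrow> ('v \<Rightarrow> real) \<times> ('e \<Rightarrow> real \<Rightarrow> real)" where
  "it 0 z = (\<lambda>_. 0, \<lambda>_ _. 0)"
| "it (Suc n) z = (newY z (it n z), newu z (it n z))"

lemma adm_it: "z \<in> Zs \<Longrightarrow> adm z (it n z)"
  by (induction n) (auto simp: adm_zero adm_new)

lemma it_diff:
  assumes z: "z \<in> Zs"
  shows "(\<forall>v. \<bar>fst (it (Suc n) z) v - fst (it n z) v\<bar> \<le> 2 * mx z * w v / 2 ^ n) \<and>
    (\<forall>e. \<forall>x\<in>{0..len e}. \<bar>snd (it (Suc n) z) e x - snd (it n z) e x\<bar> \<le> 2 * mx z * W e / 2 ^ n)"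
proof (induction n)
  case 0
  have "adm z (it 1 z)" by (rule adm_it[OF z])
  then have a: "0 \<le> fst (it 1 z) v" "fst (it 1 z) v \<le> mx z * w v"
    "x \<in> {0..len e} \<Longrightarrow> 0 \<le> snd (it 1 z) e x \<and> snd (it 1 z) e x \<le> 2 * mx z * W e" for v e x
    by (auto simp: adm_def)
  have mw: "0 \<le> mx z * w v" for v using ZsD(5)[OF z] w_pos[of v] by simp
  have it0: "fst (it 0 z) v = 0" "snd (it 0 z) e x = 0" for v e x by simp_all
  have "\<bar>fst (it 1 z) v - fst (it 0 z) v\<bar> \<le> 2 * mx z * w v / 2 ^ 0" for v
    unfolding it0 using a(1,2)[of v] mw[of v] by simp
  moreover have "\<bar>snd (it 1 z) e x - snd (it 0 z) e x\<bar> \<le> 2 * mx z * W e / 2 ^ 0" if "x \<in> {0..len e}" for e x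
    unfolding it0 using a(3)[OF that] by simp
  ultimately show ?case unfolding One_nat_def by blast
next
  case (Suc n)
  have B: "2 * mx z / 2 ^ n \<ge> 0" using ZsD(5)[OF z] by simp
  have e: "newY z (it n z) = fst (it (Suc n) z)" "newu z (it n z) = snd (it (Suc n) z)" for n by simp_all
  have IH: "\<bar>fst (it (Suc n) z) v - fst (it n z) v\<bar> \<le> 2 * mx z / 2 ^ n * w v"
    "x \<in> {0..len e} \<Longrightarrow> \<bar>snd (it (Suc n) z) e x - snd (it n z) e x\<bar> \<le> 2 * mx z / 2 ^ n * W e" for v e x
    using Suc by (auto simp del: it.simps)
  note nd = new_diff[OF z adm_it[OF z, of "Suc n"] adm_it[OF z, of n] B IH, unfolded e]
  have "\<bar>fst (it (Suc (Suc n)) z) v - fst (it (Suc n) z) v\<bar> \<le> 2 * mx z * w v / 2 ^ Suc n" for v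
    using nd(1)[of v] by (simp del: it.simps)
  moreover have "\<bar>snd (it (Suc (Suc n)) z) e x - snd (it (Suc n) z) e x\<bar> \<le> 2 * mx z * W e / 2 ^ Suc n"
    if "x \<in> {0..len e}" for e x
  proof -
    have "\<bar>snd (it (Suc (Suc n)) z) e x - snd (it (Suc n) z) e x\<bar> \<le> 2 * mx z / 2 ^ n / 2 * W e"
      by (rule nd(2)) (use that in auto)
    then show ?thesis by (simp del: it.simps)
  qed
  ultimately show ?case by blast
qed

definition Yl :: "real \<times> real \<times> real \<Rightarrow> 'v \<Rightarrow> real" where
  "Yl z v = lim (\<lambda>n. fst (it n z) v)"

definition ul :: "real \<times> real \<times> real \<Rightarrow> 'e \<Rightarrow> real \<Rightarrow> real" where
  "ul z e x = lim (\<lambda>n. snd (it n z) e x)"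

end


section \<open>The limit: equation, vertex conditions, positivity and outgoing derivatives\<close>

context outer
begin

lemma Yl_bound:
  assumes z: "z \<in> Zs"
  shows "\<bar>Yl z v - fst (it n z) v\<bar> \<le> 4 * mx z / 2 ^ n * w v"
    and "(\<lambda>n. fst (it n z) v) \<longlonglongrightarrow> Yl z v"
proof -
  have inc: "norm (fst (it (Suc n) z) v - fst (it n z) v) \<le> (2 * mx z * w v) / 2 ^ n" if "v \<in> {v}" for n v
    using it_diff[OF z, of n] by (simp del: it.simps)
  show "\<bar>Yl z v - fst (it n z) v\<bar> \<le> 4 * mx z / 2 ^ n * w v"
    using geometric_increments_lim(2)[of "{v}" "\<lambda>n. fst (it n z)" "2 * mx z * w v" v n] inc[of v]
    by (simp add: Yl_def del: it.simps)
  show "(\<lambda>n. fst (it n z) v) \<longlonglongrightarrow> Yl z v"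
    unfolding Yl_def
    by (rule tendsto_uniform_limitI[OF geometric_increments_lim(1)[of "{v}" "\<lambda>n. fst (it n z)" "2 * mx z * w v"]])
      (use inc[of v] in \<open>auto simp del: it.simps\<close>)
qed

lemma ul_bound:
  assumes z: "z \<in> Zs" and x: "x \<in> {0..len e}"
  shows "\<bar>ul z e x - snd (it n z) e x\<bar> \<le> 4 * mx z / 2 ^ n * W e"
    and "(\<lambda>n. snd (it n z) e x) \<longlonglongrightarrow> ul z e x"
proof -
  have inc: "norm (snd (it (Suc n) z) e x - snd (it n z) e x) \<le> (2 * mx z * W e) / 2 ^ n" for n
    using it_diff[OF z, of n] x by (simp del: it.simps)
  show "\<bar>ul z e x - snd (it n z) e x\<bar> \<le> 4 * mx z / 2 ^ n * W e"
    using geometric_increments_lim(2)[of "{x}" "\<lambda>n. snd (it n z) e" "2 * mx z * W e" x n] inc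
    by (simp add: ul_def del: it.simps)
  show "(\<lambda>n. snd (it n z) e x) \<longlonglongrightarrow> ul z e x"
    unfolding ul_def
    by (rule tendsto_uniform_limitI[OF geometric_increments_lim(1)[of "{x}" "\<lambda>n. snd (it n z) e" "2 * mx z * W e"]])
      (use inc in \<open>auto simp del: it.simps\<close>)
qed

lemma it_continuous:
  shows "(\<forall>v. continuous_on Zs (\<lambda>z. fst (it n z) v)) \<and>
    (\<forall>e. continuous_on (Zs \<times> {0..len e}) (\<lambda>(z, x). snd (it n z) e x))"
proof (induction n)
  case 0
  then show ?case by (simp add: case_prod_unfold)
next
  case (Suc n)
  have kc: "continuous_on Zs fst" by (intro continuous_intros)
  have kp: "\<And>z. z \<in> Zs \<Longrightarrow> fst z > 0" by (rule ZsD)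
  have pc: "continuous_on (Zs \<times> {0..len e}) (\<lambda>(z, x). pw (snd (it n z) e) x)" for e
    unfolding pw_def case_prod_unfold
    using Suc p6 adm_it by (intro continuous_on_powr' continuous_on_const) (auto simp: case_prod_unfold adm_def)
  have Yc: "continuous_on Zs (\<lambda>z. newY z (it n z) v)" for v
  proof (cases "v \<in> X")
    case True
    then show ?thesis by (cases "v = vb") (auto simp: newY_def data_def intro!: continuous_intros)
  next
    case False
    have hb: "0 < sinh (fst z * len e)" if "z \<in> Zs" for z e
      using hyp_bounds(1)[OF ZsD(1)[OF that] e0(2)] .
    have hn: "sinh (fst z * len e) \<noteq> 0" if "z \<in> Zs" for z e
      using hb[OF that, of e] by linarith
    have fc: "continuous_on Zs (\<lambda>z. fst (it n z) v)" for v using Suc by blast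
    have nz: "(\<Sum>h\<in>H v. cosh (fst z * len (fst h)) / sinh (fst z * len (fst h))) \<noteq> 0" if "z \<in> Zs" for z
      using finH neH hb[OF that] by (intro less_imp_neq[symmetric] sum_pos) auto
    have "continuous_on Zs (\<lambda>z. vsum (fst z) (\<lambda>h. fst (it n z) (far h) +
        edge_flux (fst z) (len (fst h)) (snd h) (pw (snd (it n z) (fst h)))) v)"
      unfolding vsum_def
      by (intro continuous_intros fc edge_sol_continuous_param(2)[OF kc kp len_pos kc kc pc] ballI nz hn)
    then show ?thesis using False by (simp add: newY_def)
  qed
  have "continuous_on (Zs \<times> {0..len e}) (\<lambda>(z, x). newu z (it n z) e x)" for e
    unfolding newu_def by (rule edge_sol_continuous_param(1)[OF kc kp len_pos Yc Yc pc])
  with Yc show ?case by simp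
qed

text \<open>On \<open>Zs\<close> the increments have a geometric bound independent of
  \<open>z\<close>, since \<open>mx z <= m0\<close> and weights are at most 1; so the limit is
  uniform and inherits continuity.\<close>

lemma Yl_continuous: "continuous_on Zs (\<lambda>z. Yl z v)"
proof -
  have "uniform_limit Zs (\<lambda>n z. fst (it n z) v) (\<lambda>z. Yl z v) sequentially"
    unfolding Yl_def
  proof (rule geometric_increments_lim(1)[where C="2 * m0"])
    fix n z assume z: "z \<in> Zs"
    have "\<bar>fst (it (Suc n) z) v - fst (it n z) v\<bar> \<le> 2 * mx z * w v / 2 ^ n" using it_diff[OF z, of n] by blast
    also have "\<dots> \<le> 2 * m0 * 1 / 2 ^ n"
      using ZsD(5,6)[OF z] w_pos[of v] w_le_1[of v] by (intro divide_right_mono mult_mono) auto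
    finally show "norm (fst (it (Suc n) z) v - fst (it n z) v) \<le> 2 * m0 / 2 ^ n" by (simp del: it.simps)
  qed
  then show ?thesis
    using it_continuous by (intro uniform_limit_theorem[OF always_eventually]) (auto simp del: it.simps)
qed

lemma ul_continuous: "continuous_on (Zs \<times> {0..len e}) (\<lambda>(z, x). ul z e x)"
proof -
  have "uniform_limit (Zs \<times> {0..len e}) (\<lambda>n y. snd (it n (fst y)) e (snd y)) (\<lambda>y. ul (fst y) e (snd y)) sequentially"
    unfolding ul_def
  proof (rule geometric_increments_lim(1)[where C="4 * m0"])
    fix n y assume y: "y \<in> Zs \<times> {0..len e}"
    then have z: "fst y \<in> Zs" by auto
    have "\<bar>snd (it (Suc n) (fst y)) e (snd y) - snd (it n (fst y)) e (snd y)\<bar> \<le> 2 * mx (fst y) * W e / 2 ^ n"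
      using it_diff[OF z, of n] y by (auto simp del: it.simps)
    also have "\<dots> \<le> 2 * m0 * 2 / 2 ^ n"
      using ZsD(5,6)[OF z] W_pos[of e] W_le_2[of e] by (intro divide_right_mono mult_mono) auto
    finally show "norm (snd (it (Suc n) (fst y)) e (snd y) - snd (it n (fst y)) e (snd y)) \<le> 4 * m0 / 2 ^ n"
      by (simp del: it.simps)
  qed
  then have "continuous_on (Zs \<times> {0..len e}) (\<lambda>y. ul (fst y) e (snd y))"
    using it_continuous
    by (intro uniform_limit_theorem[OF always_eventually]) (auto simp: case_prod_unfold simp del: it.simps)
  then show ?thesis by (simp add: case_prod_unfold)
qed

lemma ul_cont: "z \<in> Zs \<Longrightarrow> continuous_on {0..len e} (ul z e)"
  by (rule continuous_on_compose2[OF ul_continuous, where f="\<lambda>x. (z, x)", simplified])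
    (auto intro!: continuous_intros)

lemma adm_lim:
  assumes z: "z \<in> Zs"
  shows "adm z (Yl z, ul z)"
proof -
  have "0 \<le> Yl z v" "Yl z v \<le> mx z * w v" for v
    using adm_it[OF z] LIMSEQ_le_const[OF Yl_bound(2)[OF z, of v]] LIMSEQ_le_const2[OF Yl_bound(2)[OF z, of v]]
    by (auto simp: adm_def simp del: it.simps)
  moreover have "0 \<le> ul z e x" "ul z e x \<le> 2 * mx z * W e" if "x \<in> {0..len e}" for e x
    using adm_it[OF z] that LIMSEQ_le_const[OF ul_bound(2)[OF z that]] LIMSEQ_le_const2[OF ul_bound(2)[OF z that]]
    by (auto simp: adm_def simp del: it.simps)
  ultimately show ?thesis using ul_cont[OF z] by (auto simp: adm_def)
qed

text \<open>The step halves distances, so its value at the limit is approximated by the iterates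
  \<open>it (Suc n) z\<close>, which also tend to the limit.\<close>

lemma fixed_point:
  assumes z: "z \<in> Zs"
  shows "Yl z v = newY z (Yl z, ul z) v"
    and "x \<in> {0..len e} \<Longrightarrow> ul z e x = newu z (Yl z, ul z) e x"
proof -
  have e: "newY z (it n z) = fst (it (Suc n) z)" "newu z (it n z) = snd (it (Suc n) z)" for n by simp_all
  have B: "4 * mx z / 2 ^ n \<ge> 0" for n using ZsD(5)[OF z] by simp
  note nd = new_diff[OF z adm_lim[OF z] adm_it[OF z] B, unfolded fst_conv snd_conv, OF Yl_bound(1)[OF z] ul_bound(1)[OF z], unfolded e]
  have t0: "(\<lambda>n. C / 2 ^ n / 2 * c) \<longlonglongrightarrow> 0" for C c :: real
    using tendsto_mult[OF tendsto_const[of "C / 2 * c"] LIMSEQ_realpow_zero[of "1/2"]]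
    by (simp add: power_divide mult.commute)
  have "(\<lambda>n. newY z (Yl z, ul z) v - fst (it (Suc n) z) v) \<longlonglongrightarrow> 0"
    by (rule Lim_null_comparison[OF always_eventually t0[of "4 * mx z" "w v"]])
      (use nd(1) in \<open>auto simp del: it.simps\<close>)
  moreover have "(\<lambda>n. newY z (Yl z, ul z) v - fst (it (Suc n) z) v) \<longlonglongrightarrow> newY z (Yl z, ul z) v - Yl z v"
    by (intro tendsto_intros LIMSEQ_Suc[OF Yl_bound(2)[OF z]])
  ultimately show "Yl z v = newY z (Yl z, ul z) v" using LIMSEQ_unique by fastforce
  assume x: "x \<in> {0..len e}"
  have "\<bar>newu z (Yl z, ul z) e x - snd (it (Suc n) z) e x\<bar> \<le> 4 * mx z / 2 ^ n / 2 * W e" for n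
    by (rule nd(2)) (use x in auto)
  then have "(\<lambda>n. newu z (Yl z, ul z) e x - snd (it (Suc n) z) e x) \<longlonglongrightarrow> 0"
    by (intro Lim_null_comparison[OF always_eventually t0[of "4 * mx z" "W e"]]) (auto simp del: it.simps)
  moreover have "(\<lambda>n. newu z (Yl z, ul z) e x - snd (it (Suc n) z) e x) \<longlonglongrightarrow> newu z (Yl z, ul z) e x - ul z e x"
    by (intro tendsto_intros LIMSEQ_Suc[OF ul_bound(2)[OF z x]])
  ultimately show "ul z e x = newu z (Yl z, ul z) e x" using LIMSEQ_unique by fastforce
qed

definition ul' :: "real \<times> real \<times> real \<Rightarrow> 'e \<Rightarrow> real \<Rightarrow> real" where
  "ul' z e = edge_sol' (fst z) (len e) (Yl z (src e)) (Yl z (tgt e)) (pw (ul z e))"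

text \<open>Outgoing derivative along a half-edge, divided by \<open>k\<close>.\<close>

definition oder :: "real \<times> real \<times> real \<Rightarrow> 'e \<times> bool \<Rightarrow> real" where
  "oder z h = (- Yl z (far (fst h, \<not> snd h)) * cosh (fst z * len (fst h)) + Yl z (far h) +
     edge_flux (fst z) (len (fst h)) (snd h) (pw (ul z (fst h)))) / sinh (fst z * len (fst h))"

context
  fixes z assumes z: "z \<in> Zs"
begin

lemma Yl_bounds: "0 \<le> Yl z v" "Yl z v \<le> mx z * w v" 
  using adm_lim[OF z] by (auto simp: adm_def)

lemma ul_bounds: "x \<in> {0..len e} \<Longrightarrow> 0 \<le> ul z e x" "x \<in> {0..len e} \<Longrightarrow> ul z e x \<le> 2 * mx z * W e"
  using adm_lim[OF z] by (auto simp: adm_def)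

lemma Yl_X: "v \<in> X \<Longrightarrow> Yl z v = data z v"
  using fixed_point(1)[OF z, of v] by (simp add: newY_def)

lemma pwl: "x \<in> {0..len e} \<Longrightarrow> 0 \<le> pw (ul z e) x" "x \<in> {0..len e} \<Longrightarrow> pw (ul z e) x \<le> eps * (2 * mx z * W e)"
  "continuous_on {0..len e} (pw (ul z e))"
  using pw_bound(1,3)[OF z adm_lim[OF z], of x e] pw_cont[OF adm_lim[OF z], of e] by auto

lemma ul_eq: "x \<in> {0..len e} \<Longrightarrow> ul z e x = edge_sol (fst z) (len e) (Yl z (src e)) (Yl z (tgt e)) (pw (ul z e)) x"
  using fixed_point(2)[OF z, of x e] fixed_point(1)[OF z] by (simp add: newu_def)

lemma ul_ends: "ul z e 0 = Yl z (src e)" "ul z e (len e) = Yl z (tgt e)"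
  using ul_eq[of 0 e] ul_eq[of "len e" e] len_pos[of e] ZsD(2)[OF z]
  by (auto simp: edge_sol_0 edge_sol_l)

lemma ul_derivs:
  assumes x: "x \<in> {0..len e}"
  shows "(ul z e has_real_derivative ul' z e x) (at x within {0..len e})"
    and "(ul' z e has_real_derivative (fst z)\<^sup>2 * (ul z e x - ul z e x powr (p - 1))) (at x within {0..len e})"
proof -
  note d = edge_sol_derivs[OF ZsD(2)[OF z] len_pos pwl(3) x]
  show "(ul z e has_real_derivative ul' z e x) (at x within {0..len e})"
    unfolding ul'_def by (rule real_derivative_transform[OF x ul_eq d(1)])
  show "(ul' z e has_real_derivative (fst z)\<^sup>2 * (ul z e x - ul z e x powr (p - 1))) (at x within {0..len e})"
    using d(2)[of "Yl z (src e)" "Yl z (tgt e)"] unfolding ul'_def ul_eq[OF x, symmetric] by (simp add: pw_def)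
qed

lemma ul'_oder: "ul' z e 0 = fst z * oder z (e, False)" "- ul' z e (len e) = fst z * oder z (e, True)"
  unfolding ul'_def oder_def using ZsD(2)[OF z] len_pos[of e]
  by (auto simp: edge_sol'_0 edge_sol'_l far_end_def)

text \<open>At a fixed point old and new vertex values coincide, so the equation solved for the new
  value in \<open>newY\<close> becomes the Kirchhoff condition itself.\<close>

lemma kirchhoff_outer:
  assumes v: "v \<notin> X"
  shows "(\<Sum>h\<in>H v. oder z h) = 0"
proof -
  define c where "c h = Yl z (far h) + edge_flux (fst z) (len (fst h)) (snd h) (pw (ul z (fst h)))" for h
  define S where "S = (\<Sum>h\<in>H v. cosh (fst z * len (fst h)) / sinh (fst z * len (fst h)))"
  have hb: "0 < sinh (fst z * len e)" for e
    using hyp_bounds(1)[OF ZsD(1)[OF z] e0(2)] .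
  have S: "S > 0" unfolding S_def using finH neH hb by (intro sum_pos) auto
  have "Yl z v = (\<Sum>h\<in>H v. c h / sinh (fst z * len (fst h))) / S"
    using fixed_point(1)[OF z, of v] v by (simp add: newY_def vsum_def c_def S_def)
  then have "Yl z v * S = (\<Sum>h\<in>H v. c h / sinh (fst z * len (fst h)))" using S by simp
  moreover have "(\<Sum>h\<in>H v. oder z h) = (\<Sum>h\<in>H v. c h / sinh (fst z * len (fst h)) -
      Yl z v * (cosh (fst z * len (fst h)) / sinh (fst z * len (fst h))))"
  proof (rule sum.cong[OF refl])
    fix h assume h: "h \<in> H v"
    show "oder z h = c h / sinh (fst z * len (fst h)) - Yl z v * (cosh (fst z * len (fst h)) / sinh (fst z * len (fst h)))"
      using hb[of "fst h"] by (simp add: oder_def c_def far_H(2)[OF h] diff_divide_distrib[symmetric] add.assoc)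
  qed
  ultimately show ?thesis unfolding sum_subtractf sum_distrib_left[symmetric] S_def[symmetric] by simp
qed

text \<open>Up to errors of size \<open>eps\<close>, an outer edge looks like a half-line, where the
  decaying solution has slope minus its value after division by \<open>k\<close>. The 9 is 1 for the
  value at the far end plus 8 for the flux of the nonlinearity.\<close>

lemma oder_bounds:
  assumes h: "h \<in> H v" and v: "v \<in> X"
  shows "- data z v * (1 + eps) \<le> oder z h" "oder z h \<le> - data z v + 9 * eps * mx z"
proof -
  define s where "s = sinh (fst z * len (fst h))"
  define c where "c = cosh (fst z * len (fst h))"
  define J where "J = edge_flux (fst z) (len (fst h)) (snd h) (pw (ul z (fst h)))"
  note hb = hyp_bounds[OF ZsD(1)[OF z] e0(2)[of "fst h"], folded s_def c_def]
  have m: "0 < mx z" by (rule ZsD(5)[OF z])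
  have J: "0 \<le> J" "J \<le> eps * (2 * mx z * W (fst h)) * (c - 1)"
    using edge_flux_bound[OF ZsD(2)[OF z] len_pos[of "fst h"] pwl(3)[of "fst h"], of "eps * (2 * mx z * W (fst h))" "snd h"]
      pwl(1,2)[of _ "fst h"] by (auto simp: J_def c_def)
  have o: "oder z h = (- data z v * c + Yl z (far h) + J) / s"
    by (simp add: oder_def far_H(2)[OF h] Yl_X[OF v] s_def c_def J_def)
  have "- data z v * (1 + eps) * s \<le> - data z v * c"
    using mult_left_mono[OF hb(5), of "data z v"] ZsD(7)[OF z, of v] by (simp add: mult.assoc)
  also have "\<dots> \<le> - data z v * c + Yl z (far h) + J" using J(1) Yl_bounds(1) by simp
  finally show "- data z v * (1 + eps) \<le> oder z h" unfolding o using hb(1) by (simp add: pos_le_divide_eq)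
  have "Yl z (far h) \<le> mx z * 1"
    by (rule order_trans[OF Yl_bounds(2)]) (use m w_le_1 in \<open>intro mult_left_mono; auto\<close>)
  also have "\<dots> \<le> mx z * (eps * s)" using hb(2) m by (intro mult_left_mono) auto
  finally have 1: "Yl z (far h) \<le> eps * mx z * s" by (simp add: algebra_simps)
  have "J \<le> eps * (2 * mx z * W (fst h)) * (c - 1)" by (rule J(2))
  also have "\<dots> \<le> eps * (2 * mx z * 2) * (2 * s)"
  proof (intro mult_mono)
    have "c \<le> (1 + eps) * s" by (rule hb(5))
    also have "\<dots> \<le> 2 * s" using eps hb(1) by (intro mult_right_mono) auto
    finally show "c - 1 \<le> 2 * s" by simp
    show "0 \<le> c - 1" by (simp add: c_def cosh_real_ge_1)
  qed (use eps m W_le_2[of "fst h"] W_pos[of "fst h"] in auto)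
  finally have 2: "J \<le> 8 * eps * mx z * s" by simp
  have "- data z v * c \<le> - data z v * s" using hb(4) ZsD(7)[OF z, of v] by simp
  with 1 2 have "- data z v * c + Yl z (far h) + J \<le> (- data z v + 9 * eps * mx z) * s"
    by (simp add: algebra_simps)
  then show "oder z h \<le> - data z v + 9 * eps * mx z" unfolding o using hb(1) by (simp add: pos_divide_le_eq)
qed

text \<open>Positivity spreads from \<open>X\<close> along edges: one positive neighbour makes the
  vertex value positive, as all other terms are nonnegative. Connectedness does the rest.\<close>

lemma Yl_pos: "0 < Yl z v"
proof -
  obtain x where x: "x \<in> X" using X by auto
  from conn[of x v] show ?thesis
  proof (induction rule: rtrancl_induct)
    case base
    show ?case using Yl_X[OF x] ZsD(7)[OF z, of x] by simp
  next
    case (step y v)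
    show ?case
    proof (cases "v \<in> X")
      case True
      then show ?thesis using Yl_X[OF True] ZsD(7)[OF z, of v] by simp
    next
      case False
      obtain h where h: "h \<in> H y" "far h = v" using step by (auto simp: adj_far)
      define h' where "h' = (fst h, \<not> snd h)"
      have h': "h' \<in> H v" "far h' = y" using far_H[OF h(1)] h(2) by (auto simp: h'_def)
      have J: "0 \<le> edge_flux (fst z) (len e) b (pw (ul z e))" for e b
        using edge_flux_bound(2)[OF ZsD(2)[OF z] len_pos[of e] pwl(3)[of e], of "eps * (2 * mx z * W e)" b] pwl(1,2)[of _ e]
        by auto
      have "0 < vsum (fst z) (\<lambda>h. Yl z (far h) + edge_flux (fst z) (len (fst h)) (snd h) (pw (ul z (fst h)))) v"
        using J Yl_bounds(1) step.IH h'
        by (intro vsum_nonneg(2)[OF ZsD(1)[OF z] _ h'(1)]) (auto intro: add_pos_nonneg add_nonneg_nonneg)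
      then show ?thesis using fixed_point(1)[OF z, of v] False by (simp add: newY_def)
    qed
  qed
qed

lemma ul_pos:
  assumes x: "x \<in> {0..len e}"
  shows "0 < ul z e x"
proof -
  consider "x = 0" | "x = len e" | "0 < x" "x < len e" using x by fastforce
  then show ?thesis
  proof cases
    case 3
    then show ?thesis unfolding ul_eq[OF x] using x Yl_pos pwl
      by (intro edge_sol_nonneg(2)[OF ZsD(2)[OF z] len_pos]) (auto intro: less_imp_le)
  qed (use ul_ends Yl_pos in auto)
qed

text \<open>Edge lengths lie in \<open>[e0, Lm]\<close>, so for fixed \<open>z\<close> the factor
  \<open>cosh^2 / sinh\<close> is bounded over all edges.\<close>

lemma ul'_bound:
  "\<exists>C\<ge>0. \<forall>e. \<forall>x\<in>{0..len e}. \<bar>ul' z e x\<bar> \<le> C * W e"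
proof -
  define C where "C = fst z * (3 * mx z) * (cosh (fst z * Lm))\<^sup>2 / sinh (K0 * e0)"
  note zz = ZsD[OF z]
  have s0: "0 < sinh (K0 * e0)" using K0 e0 by simp
  have C0: "C \<ge> 0" using zz s0 by (simp add: C_def)
  have "\<bar>ul' z e x\<bar> \<le> C * W e" if x: "x \<in> {0..len e}" for e x
  proof -
    define G where "G = eps * (2 * mx z * W e)"
    have "\<bar>ul' z e x\<bar> \<le> fst z * (\<bar>Yl z (src e)\<bar> + \<bar>Yl z (tgt e)\<bar> + 2 * G) * (cosh (fst z * len e))\<^sup>2 / sinh (fst z * len e)"
      unfolding ul'_def using pwl(1,2)[of _ e]
      by (intro edge_sol'_bound[OF zz(2) len_pos pwl(3) _ x]) (auto simp: G_def)
    also have "\<dots> \<le> fst z * (3 * mx z * W e) * (cosh (fst z * Lm))\<^sup>2 / sinh (K0 * e0)"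
    proof (intro frac_le mult_mono power_mono)
      have "\<bar>Yl z (src e)\<bar> + \<bar>Yl z (tgt e)\<bar> \<le> mx z * W e"
        using Yl_bounds[of "src e"] Yl_bounds[of "tgt e"] by (simp add: W_def distrib_left)
      moreover have "2 * G \<le> 2 * (mx z * W e)"
        using eps zz(5) W_pos[of e] mult_right_mono[of eps "1/2" "2 * mx z * W e"] by (simp add: G_def)
      ultimately show "\<bar>Yl z (src e)\<bar> + \<bar>Yl z (tgt e)\<bar> + 2 * G \<le> 3 * mx z * W e" by simp
      show "cosh (fst z * len e) \<le> cosh (fst z * Lm)"
        using Lm[of e] len_pos[of e] zz(2) by (intro cosh_real_nonneg_le_iff[THEN iffD2] mult_left_mono mult_nonneg_nonneg) auto
      show "sinh (K0 * e0) \<le> sinh (fst z * len e)"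
        using zz(1,2) K0 e0 e0(2)[of e] by (simp, intro mult_mono) auto
      show "0 \<le> \<bar>Yl z (src e)\<bar> + \<bar>Yl z (tgt e)\<bar> + 2 * G"
        using eps zz(5) W_pos[of e] by (simp add: G_def)
    qed (use zz s0 W_pos[of e] in auto)
    also have "\<dots> = C * W e" by (simp add: C_def)
    finally show ?thesis .
  qed
  with C0 show ?thesis by blast
qed

end

lemma oder_continuous: "continuous_on Zs (\<lambda>z. oder z h)"
proof -
  have kc: "continuous_on Zs fst" by (intro continuous_intros)
  have kp: "\<And>z. z \<in> Zs \<Longrightarrow> fst z > 0" by (rule ZsD)
  have pc: "continuous_on (Zs \<times> {0..len e}) (\<lambda>(z, x). pw (ul z e) x)" for e
    unfolding pw_def case_prod_unfold
    using ul_continuous[of e] p6 ul_bounds(1)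
    by (intro continuous_on_powr' continuous_on_const) (auto simp: case_prod_unfold)
  have nz: "sinh (fst z * len e) \<noteq> 0" if "z \<in> Zs" for z e
    using hyp_bounds(1)[OF ZsD(1)[OF that] e0(2), of e] by linarith
  show ?thesis unfolding oder_def
    using nz by (intro continuous_intros Yl_continuous edge_sol_continuous_param(2)[OF kc kp len_pos kc kc pc]) auto
qed

section \<open>Mass of the outer solution\<close>

definition omass :: "'e set \<Rightarrow> real \<times> real \<times> real \<Rightarrow> real" where
  "omass S z = (\<Sum>\<^sub>\<infinity>e\<in>S. integral {0..len e} (\<lambda>x. (ul z e x)\<^sup>2))"

lemma mass_edge_bound:
  assumes z: "z \<in> Zs"
  shows "0 \<le> integral {0..len e} (\<lambda>x. (ul z e x)\<^sup>2)"
    "integral {0..len e} (\<lambda>x. (ul z e x)\<^sup>2) \<le> 4 * (mx z)\<^sup>2 * Lm * (W e)\<^sup>2"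
proof -
  have i: "(\<lambda>x. (ul z e x)\<^sup>2) integrable_on {0..len e}"
    by (intro integrable_continuous_real continuous_intros ul_cont z)
  show "0 \<le> integral {0..len e} (\<lambda>x. (ul z e x)\<^sup>2)" by (rule Henstock_Kurzweil_Integration.integral_nonneg[OF i]) simp
  have "integral {0..len e} (\<lambda>x. (ul z e x)\<^sup>2) \<le> integral {0..len e} (\<lambda>x. (2 * mx z * W e)\<^sup>2)"
    using ul_bounds[OF z, of _ e] by (intro integral_le i power_mono) auto
  also have "\<dots> = len e * (2 * mx z * W e)\<^sup>2" using len_pos[of e] by simp
  also have "\<dots> \<le> Lm * (2 * mx z * W e)\<^sup>2" using Lm[of e] by (intro mult_right_mono) auto
  finally show "integral {0..len e} (\<lambda>x. (ul z e x)\<^sup>2) \<le> 4 * (mx z)\<^sup>2 * Lm * (W e)\<^sup>2"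
    by (simp add: power_mult_distrib algebra_simps)
qed

lemma mass_summable: "z \<in> Zs \<Longrightarrow> (\<lambda>e. integral {0..len e} (\<lambda>x. (ul z e x)\<^sup>2)) summable_on S"
  by (rule summable_on_comparison_test[OF W2_summable[of "4 * (mx z)\<^sup>2 * Lm"]])
    (use mass_edge_bound in auto)

lemma omass_bounds:
  assumes z: "z \<in> Zs"
  shows "0 \<le> omass S z" "omass S z \<le> 32 * Lm * real D * real (card X) * (mx z)\<^sup>2"
proof -
  show "0 \<le> omass S z" unfolding omass_def using mass_edge_bound[OF z] by (intro infsum_nonneg) auto
  have "omass S z \<le> infsum (\<lambda>e. 4 * (mx z)\<^sup>2 * Lm * (W e)\<^sup>2) S"
    unfolding omass_def by (intro infsum_mono mass_summable z W2_summable mass_edge_bound)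
  also have "\<dots> = 4 * (mx z)\<^sup>2 * Lm * infsum (\<lambda>e. (W e)\<^sup>2) S"
    using W2_summable[of 1 S] by (simp add: infsum_cmult_right)
  also have "\<dots> \<le> 4 * (mx z)\<^sup>2 * Lm * (8 * real D * real (card X))"
    using Lm len_pos order_trans[OF less_imp_le[OF len_pos] Lm] by (intro mult_left_mono sum_W2_le) auto
  finally show "omass S z \<le> 32 * Lm * real D * real (card X) * (mx z)\<^sup>2" by (simp add: algebra_simps)
qed

text \<open>Weierstrass test along the net of finite edge sets, with multiples of the squared
  weights as majorants uniform in \<open>z\<close>.\<close>

lemma omass_continuous: "continuous_on Zs (omass S)"
proof -
  have c: "continuous_on Zs (\<lambda>z. integral {0..len e} (\<lambda>x. (ul z e x)\<^sup>2))" for e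
  proof -
    have "continuous_on (Zs \<times> cbox 0 (len e)) (\<lambda>(z, x). (ul z e x)\<^sup>2)"
      using ul_continuous[of e] unfolding case_prod_unfold by (intro continuous_intros) simp
    from integral_continuous_on_param[OF this] show ?thesis by simp
  qed
  have "uniform_limit Zs (\<lambda>F z. \<Sum>e\<in>F. integral {0..len e} (\<lambda>x. (ul z e x)\<^sup>2))
      (\<lambda>z. \<Sum>\<^sub>\<infinity>e\<in>S. integral {0..len e} (\<lambda>x. (ul z e x)\<^sup>2)) (finite_subsets_at_top S)"
  proof (rule Weierstrass_m_test_general)
    show "(\<lambda>e. 4 * m0\<^sup>2 * Lm * (W e)\<^sup>2) summable_on S" by (rule W2_summable)
    fix e z assume z: "z \<in> Zs"
    have "4 * (mx z)\<^sup>2 * Lm * (W e)\<^sup>2 \<le> 4 * m0\<^sup>2 * Lm * (W e)\<^sup>2"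
      using ZsD(5,6)[OF z] order_trans[OF less_imp_le[OF len_pos] Lm]
      by (intro mult_right_mono mult_left_mono power_mono) auto
    then show "norm (integral {0..len e} (\<lambda>x. (ul z e x)\<^sup>2)) \<le> 4 * m0\<^sup>2 * Lm * (W e)\<^sup>2"
      using mass_edge_bound[OF z, of e] by simp
  qed
  then show ?thesis unfolding omass_def[abs_def]
    using c by (intro uniform_limit_theorem[OF always_eventually]) (auto intro!: continuous_on_sum)
qed

end

section \<open>Gluing a profile on a path to the outer solution\<close>


text \<open>Integrals along the path reduce to those over the two halves of the profile, unfolded at
  the maximum \<open>x = s / k\<close>.\<close>

lemma integral_abs_affine:
  fixes g :: "real \<Rightarrow> real"
  assumes g: "continuous_on {0..max s t} g" and s: "0 \<le> s" and t: "0 \<le> t" and k: "k > 0"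
  shows "((\<lambda>x. g \<bar>k * x - s\<bar>) has_integral (integral {0..s} g + integral {0..t} g) / k) {0..(s + t) / k}"
proof -
  have i: "(g has_integral integral {0..r} g) (cbox 0 r)" if "0 \<le> r" "r \<le> max s t" for r
    using that by (auto intro!: integrable_integral integrable_continuous_real intro: continuous_on_subset[OF g])
  have im: "(\<lambda>x. (1 / c) * x + - ((1 / c) * d)) ` {0..r} = {- d / c..(r - d) / c}" if "c > 0" "0 \<le> r" for c d r :: real
  proof -
    have "(\<lambda>x. (1 / c) * x + - ((1 / c) * d)) ` {0..r} = (\<lambda>x. (1 / c) *\<^sub>R x + (- d / c)) ` {0..r}"
      by (rule image_cong) (auto simp: field_simps)
    also have "\<dots> = {- d / c..(r - d) / c}"
      using that image_affinity_atLeastAtMost[of "1 / c" "- d / c" 0 r] by (simp add: diff_divide_distrib)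
    finally show ?thesis .
  qed
  have 1: "((\<lambda>x. g (k * x + - s)) has_integral integral {0..t} g / k) {s / k..(s + t) / k}"
    using has_integral_affinity[OF i[OF t], of k "- s"] im[OF k t, of "- s"] k by (simp add: add.commute)
  have "((\<lambda>x. g (k * x + 0)) has_integral integral {0..s} g / k) {0..s / k}"
    using has_integral_affinity[OF i[OF s], of k 0] im[OF k s, of 0] k by simp
  then have "((\<lambda>x. g (k * x)) has_integral integral {0..s} g / k) {0..s / k}" by simp
  from has_integral_reflect_real[THEN iffD2, OF this]
  have "((\<lambda>x. g (- (k * x))) has_integral integral {0..s} g / k) {- (s / k)..0}" by simp
  then have "((\<lambda>x. g (- (k * x))) has_integral integral {0..s} g / k) (cbox (- (s / k)) 0)" by simp
  from has_integral_affinity[OF this, of 1 "- (s / k)"]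
  have 2: "((\<lambda>x. g (s - k * x)) has_integral integral {0..s} g / k) {0..s / k}"
    using k by (simp add: algebra_simps)
  have "((\<lambda>x. g \<bar>k * x - s\<bar>) has_integral integral {0..s} g / k) {0..s / k}"
    by (rule has_integral_eq[OF _ 2]) (use k in \<open>auto simp: abs_if field_simps\<close>)
  moreover have "((\<lambda>x. g \<bar>k * x - s\<bar>) has_integral integral {0..t} g / k) {s / k..(s + t) / k}"
    by (rule has_integral_eq[OF _ 1]) (use k in \<open>auto simp: abs_if field_simps\<close>)
  ultimately show ?thesis
    using has_integral_combine[of 0 "s / k" "(s + t) / k"] s t k
    by (auto simp: add_divide_distrib divide_right_mono)
qed

text \<open>\<open>(es i, bs i)\<close> is the half-edge that leaves \<open>vs i\<close> towards
  \<open>vs (Suc i)\<close>. As interior vertices carry no further half-edge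
  (\<open>path_interior\<close>), the path can be treated as a single interval.\<close>

locale bump = outer src tgt len p e0 Lm D "vs ` {0..m}" "vs m" K0 m0 + profile p Hh L ps ys
  for src tgt :: "'e \<Rightarrow> 'v" and len p e0 Lm D and vs :: "nat \<Rightarrow> 'v" and m :: nat and K0 m0 Hh L ps ys +
  fixes es :: "nat \<Rightarrow> 'e" and bs :: "nat \<Rightarrow> bool"
  assumes m_pos: "0 < m" and vs_inj: "inj_on vs {0..m}"
    and path_H: "i < m \<Longrightarrow> (es i, bs i) \<in> H (vs i)" and path_far: "i < m \<Longrightarrow> far (es i, bs i) = vs (Suc i)"
    and path_interior: "0 < i \<Longrightarrow> i < m \<Longrightarrow> H (vs i) \<subseteq> {(es i, bs i), (es (i - 1), \<not> bs (i - 1))}"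
begin

section \<open>Combinatorics and arc length of the path\<close>

abbreviation "Vx \<equiv> vs ` {0..m}"

definition P :: "'e set" where "P = es ` {..<m}"

definition off :: "nat \<Rightarrow> real" where "off i = (\<Sum>j<i. len (es j))"

definition Lt :: real where "Lt = off m"

text \<open>Arc length measured from \<open>vs 0\<close>; an edge traversed against its orientation
  is parametrised backwards.\<close>

definition pos :: "nat \<Rightarrow> real \<Rightarrow> real" where
  "pos i x = (if bs i then off i + len (es i) - x else off i + x)"

lemma vs_eq: "i \<le> m \<Longrightarrow> j \<le> m \<Longrightarrow> vs i = vs j \<longleftrightarrow> i = j"
  using vs_inj by (auto simp: inj_on_def)

lemma off_Suc: "off (Suc i) = off i + len (es i)" by (simp add: off_def)

lemma off_mono: "i \<le> j \<Longrightarrow> off i \<le> off j"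
  unfolding off_def by (intro sum_mono2) (use len_pos in \<open>auto intro: less_imp_le\<close>)

lemma off_0: "off 0 = 0" and Lt_pos: "Lt > 0"
  using m_pos len_pos by (auto simp: off_def Lt_def intro!: sum_pos)

lemma off_range: "i \<le> m \<Longrightarrow> off i \<in> {0..Lt}"
  using off_mono[of 0 i] off_mono[of i m] by (auto simp: off_0 Lt_def)

lemma pos_range: "i < m \<Longrightarrow> x \<in> {0..len (es i)} \<Longrightarrow> pos i x \<in> {0..Lt}"
  using off_range[of i] off_range[of "Suc i"] by (auto simp: pos_def off_Suc)

lemma path_ends:
  assumes "i < m"
  shows "bs i \<Longrightarrow> tgt (es i) = vs i" "bs i \<Longrightarrow> src (es i) = vs (Suc i)"
    "\<not> bs i \<Longrightarrow> src (es i) = vs i" "\<not> bs i \<Longrightarrow> tgt (es i) = vs (Suc i)"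
  using path_H[OF assms] path_far[OF assms] by (auto simp: halfedges_def far_end_def split: if_splits)

text \<open>An edge determines the pair of its ends, and distinct indices give distinct pairs of
  consecutive path vertices.\<close>

lemma es_inj: "inj_on es {..<m}"
proof (rule inj_onI)
  fix i j assume ij: "i \<in> {..<m}" "j \<in> {..<m}" "es i = es j"
  have "{src (es i), tgt (es i)} = {vs i, vs (Suc i)}" "{src (es j), tgt (es j)} = {vs j, vs (Suc j)}"
    using path_ends[of i] path_ends[of j] ij by (cases "bs i"; cases "bs j"; auto)+
  then have "{vs i, vs (Suc i)} = {vs j, vs (Suc j)}" using ij by simp
  then have "(vs i = vs j \<and> vs (Suc i) = vs (Suc j)) \<or> (vs i = vs (Suc j) \<and> vs (Suc i) = vs j)"
    by (auto simp: doubleton_eq_iff)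
  then show "i = j" using ij vs_eq[of i j] vs_eq[of i "Suc j"] vs_eq[of "Suc i" j] by auto
qed

lemma path_halfedge:
  assumes "i < m" "(es i, b) \<in> H v"
  shows "b = bs i \<and> v = vs i \<or> b = (\<not> bs i) \<and> v = vs (Suc i)"
  using assms path_ends[OF assms(1)] by (cases b; cases "bs i") (auto simp: halfedges_def)

lemma path_H': "i < m \<Longrightarrow> (es i, \<not> bs i) \<in> H (vs (Suc i))"
  using far_H(1)[OF path_H] path_far by simp

definition Hout :: "'v \<Rightarrow> ('e \<times> bool) set" where "Hout v = {h \<in> H v. fst h \<notin> P}"

lemma Hout_insert:
  assumes "g \<in> H v" "fst g \<in> P" "\<And>h. h \<in> H v \<Longrightarrow> fst h \<in> P \<Longrightarrow> h = g"
  shows "H v = insert g (Hout v)" "g \<notin> Hout v"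
  unfolding Hout_def using assms by blast+

lemma Hout_first: "H (vs 0) = insert (es 0, bs 0) (Hout (vs 0))" "(es 0, bs 0) \<notin> Hout (vs 0)"
proof -
  have "h = (es 0, bs 0)" if hP: "h \<in> H (vs 0)" "fst h \<in> P" for h
  proof -
    obtain i where i: "i < m" "fst h = es i" using hP by (auto simp: P_def)
    then have "(es i, snd h) \<in> H (vs 0)" using hP by (metis prod.collapse)
    from path_halfedge[OF i(1) this] have "snd h = bs i" "i = 0" using vs_eq[of 0 i] vs_eq[of 0 "Suc i"] i by auto
    then show ?thesis using i by (cases h) simp
  qed
  moreover have "fst (es 0, bs 0) \<in> P" using m_pos by (simp add: P_def)
  ultimately show "H (vs 0) = insert (es 0, bs 0) (Hout (vs 0))" "(es 0, bs 0) \<notin> Hout (vs 0)"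
    using Hout_insert[OF path_H[OF m_pos]] by blast+
qed

lemma Hout_last: "H (vs m) = insert (es (m - 1), \<not> bs (m - 1)) (Hout (vs m))" "(es (m - 1), \<not> bs (m - 1)) \<notin> Hout (vs m)"
proof -
  have "h = (es (m - 1), \<not> bs (m - 1))" if hP: "h \<in> H (vs m)" "fst h \<in> P" for h
  proof -
    obtain i where i: "i < m" "fst h = es i" using hP by (auto simp: P_def)
    then have "(es i, snd h) \<in> H (vs m)" using hP by (metis prod.collapse)
    from path_halfedge[OF i(1) this] have "snd h = (\<not> bs i)" "m = Suc i" using vs_eq[of m i] vs_eq[of m "Suc i"] i by auto
    then show ?thesis using i by (cases h) simp
  qed
  moreover have "(es (m - 1), \<not> bs (m - 1)) \<in> H (vs m)" using path_H'[of "m - 1"] m_pos by simp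
  moreover have "fst (es (m - 1), \<not> bs (m - 1)) \<in> P" using m_pos by (simp add: P_def)
  ultimately show "H (vs m) = insert (es (m - 1), \<not> bs (m - 1)) (Hout (vs m))" "(es (m - 1), \<not> bs (m - 1)) \<notin> Hout (vs m)"
    using Hout_insert[of "(es (m - 1), \<not> bs (m - 1))" "vs m"] by blast+
qed

lemma H_off_path: "v \<notin> Vx \<Longrightarrow> h \<in> H v \<Longrightarrow> fst h \<notin> P"
proof
  assume v: "v \<notin> Vx" and hv: "h \<in> H v" and "fst h \<in> P"
  then obtain i where i: "i < m" "fst h = es i" by (auto simp: P_def)
  then have "(es i, snd h) \<in> H v" using hv by (metis prod.collapse)
  from path_halfedge[OF i(1) this] have "v = vs i \<or> v = vs (Suc i)" by blast
  with v i(1) show False by auto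
qed

lemma H_interior:
  assumes "0 < i" "i < m"
  shows "H (vs i) = {(es i, bs i), (es (i - 1), \<not> bs (i - 1))}" "(es i, bs i) \<noteq> (es (i - 1), \<not> bs (i - 1))"
proof -
  have "(es (i - 1), \<not> bs (i - 1)) \<in> H (vs i)" using path_H'[of "i - 1"] assms by simp
  then show "H (vs i) = {(es i, bs i), (es (i - 1), \<not> bs (i - 1))}"
    by (intro equalityI path_interior assms) (simp add: path_H[OF assms(2)])
  have "es i \<noteq> es (i - 1)" using inj_onD[OF es_inj, of i "i - 1"] assms by fastforce
  then show "(es i, bs i) \<noteq> (es (i - 1), \<not> bs (i - 1))" by simp
qed

lemma sum_path_integral:
  fixes f :: "real \<Rightarrow> real"
  assumes f: "continuous_on {0..Lt} f"
  shows "(\<Sum>i<m. integral {0..len (es i)} (\<lambda>x. f (pos i x))) = integral {0..Lt} f"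
proof -
  have "(\<Sum>i<n. integral {0..len (es i)} (\<lambda>x. f (pos i x))) = integral {0..off n} f" if "n \<le> m" for n
    using that
  proof (induction n)
    case 0
    then show ?case by (simp add: off_0)
  next
    case (Suc n)
    define l where "l = len (es n)"
    have l: "l > 0" "off (Suc n) = off n + l" using len_pos off_Suc by (auto simp: l_def)
    have r: "0 \<le> off n" "off n + l \<le> Lt" using off_range[of n] off_range[of "Suc n"] Suc l by auto
    have int: "f integrable_on {off n..off n + l}"
      using r l by (intro integrable_continuous_real continuous_on_subset[OF f]) auto
    have fwd: "((\<lambda>x. f (off n + x)) has_integral integral {off n..off n + l} f) {0..l}"
      using has_integral_affinity[of f "integral {off n..off n + l} f" "off n" "off n + l" 1 "off n"]
        integrable_integral[OF int] by (simp add: add.commute)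
    have "((\<lambda>x. f (off n - x)) has_integral integral {off n..off n + l} f) {-l..0}"
      using has_integral_reflect_real[THEN iffD2, OF fwd] by simp
    then have bwd: "((\<lambda>x. f (off n + l - x)) has_integral integral {off n..off n + l} f) {0..l}"
      using has_integral_affinity[of "\<lambda>x. f (off n - x)" "integral {off n..off n + l} f" "-l" 0 1 "-l"]
      by (simp add: algebra_simps)
    have "integral {0..l} (\<lambda>x. f (pos n x)) = integral {off n..off n + l} f"
      using fwd bwd by (cases "bs n") (auto simp: pos_def l_def[symmetric] intro: integral_unique)
    moreover have "integral {0..off n} f + integral {off n..off n + l} f = integral {0..off n + l} f"
      using r l by (intro Henstock_Kurzweil_Integration.integral_combine integrable_continuous_real continuous_on_subset[OF f]) auto
    ultimately show ?case using Suc l by (simp add: l_def)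
  qed
  then show ?thesis by (simp add: Lt_def)
qed

section \<open>The glued function, its mass and its energy\<close>

definition scale :: "real \<Rightarrow> real \<Rightarrow> real \<Rightarrow> real" where
  "scale h a b = (theta h a + theta h b) / Lt"

definition zpar :: "real \<Rightarrow> real \<Rightarrow> real \<Rightarrow> real \<times> real \<times> real" where
  "zpar h a b = (scale h a b, a, b)"

text \<open>The Kirchhoff conditions at the two ends of the path, divided by \<open>k\<close>.\<close>

definition match1 :: "real \<Rightarrow> real \<Rightarrow> real \<Rightarrow> real" where
  "match1 h a b = sig h a + (\<Sum>g\<in>Hout (vs 0). oder (zpar h a b) g)"

definition match2 :: "real \<Rightarrow> real \<Rightarrow> real \<Rightarrow> real" where
  "match2 h a b = sig h b + (\<Sum>g\<in>Hout (vs m). oder (zpar h a b) g)"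

text \<open>The rescaling from \<open>v\<close> to \<open>u\<close> contributes the square of
  \<open>k powr (2 / (p - 2))\<close>; the inner part also receives \<open>1 / k\<close> from the
  change of variable.\<close>

definition total_mass :: "real \<Rightarrow> real \<Rightarrow> real \<Rightarrow> real" where
  "total_mass h a b = scale h a b powr (4 / (p - 2)) *
     ((halfmass h a + halfmass h b) / scale h a b + omass (- P) (zpar h a b))"

context
  fixes h a b :: real
  assumes h: "sol_height p \<le> h" "h \<le> Hh" and a: "0 < a" "a < h" and b: "0 < b" "b < h"
    and zZ: "zpar h a b \<in> Zs"
begin

abbreviation "z \<equiv> zpar h a b"

definition "kk = scale h a b"
definition "s1 = theta h a"

lemma z_simps: "fst z = kk" "fst (snd z) = a" "snd (snd z) = b"
  by (simp_all add: zpar_def kk_def)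

lemma kk_pos: "kk > 0" using ZsD(2)[OF zZ] by (simp add: z_simps)

lemma kk_Lt: "kk * Lt = theta h a + theta h b" using Lt_pos by (simp add: kk_def scale_def)

lemma th_pos: "0 < theta h a" "0 < theta h b"
  using theta_props(1)[OF h a] theta_props(1)[OF h b] .

text \<open>The maximum sits at \<open>x = s1 / kk\<close>; since
  \<open>kk * Lt = theta h a + theta h b\<close>, the end values are \<open>a\<close> and
  \<open>b\<close>.\<close>

definition "V x = ps h \<bar>kk * x - s1\<bar>"
definition "V' x = kk * (sgn (kk * x - s1) * ys h \<bar>kk * x - s1\<bar>)"

lemma arg_range:
  assumes "x \<in> {0..Lt}"
  shows "\<bar>kk * x - s1\<bar> \<le> max (theta h a) (theta h b)"
proof -
  have "0 \<le> kk * x" "kk * x \<le> kk * Lt" using assms kk_pos by auto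
  then show ?thesis using kk_Lt by (auto simp: s1_def abs_if)
qed

lemma good_max: "good h (max (theta h a) (theta h b))"
  using theta_props(3)[OF h a] theta_props(3)[OF h b] by (simp add: max_def)

lemma V_range: "x \<in> {0..Lt} \<Longrightarrow> 0 < V x" "x \<in> {0..Lt} \<Longrightarrow> V x \<le> Hh"
proof -
  assume "x \<in> {0..Lt}"
  then have g: "good h \<bar>kk * x - s1\<bar>" using good_mono[OF good_max arg_range] by blast
  show "0 < V x" using g by (auto simp: V_def good_def)
  show "V x \<le> Hh" using ps_le_h[OF h g] h by (simp add: V_def)
qed

lemma V_derivs:
  assumes x: "x \<in> {0..Lt}"
  shows "(V has_real_derivative V' x) (at x)"
    and "(V' has_real_derivative kk\<^sup>2 * (V x - V x powr (p - 1))) (at x)"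
proof -
  have lin: "((\<lambda>x. kk * x - s1) has_real_derivative kk) (at x)" by (auto intro!: derivative_eq_intros)
  have "((\<lambda>t. ps h \<bar>t\<bar>) has_real_derivative sgn (kk * x - s1) * ys h \<bar>kk * x - s1\<bar>) (at (kk * x - s1))"
    by (rule even_extension_deriv[OF ps_deriv ys0])
  from DERIV_chain2[OF this lin] show "(V has_real_derivative V' x) (at x)"
    unfolding V_def[abs_def] V'_def by (simp add: mult.commute)
  have "((\<lambda>t. sgn t * ys h \<bar>t\<bar>) has_real_derivative (V x - V x powr (p - 1))) (at (kk * x - s1))"
    using ys_deriv'[of "\<bar>kk * x - s1\<bar>" h] V_range[OF x]
    by (intro odd_extension_deriv ys0) (simp add: V_def)
  from DERIV_cmult[OF DERIV_chain2[OF this lin], of kk]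
  show "(V' has_real_derivative kk\<^sup>2 * (V x - V x powr (p - 1))) (at x)"
    unfolding V'_def[abs_def] by (simp add: power2_eq_square mult_ac)
qed

lemma V_cont: "continuous_on {0..Lt} V" "continuous_on {0..Lt} V'"
  by (rule DERIV_continuous_on[OF has_field_derivative_at_within[OF V_derivs(1)]], assumption)
    (rule DERIV_continuous_on[OF has_field_derivative_at_within[OF V_derivs(2)]], assumption)

lemma V_ends: "V 0 = a" "V Lt = b" "V' 0 = kk * sig h a" "V' Lt = - kk * sig h b"
  using theta_props(2)[OF h a] theta_props(2)[OF h b] ys_theta[OF h a] ys_theta[OF h b] th_pos kk_Lt
  by (auto simp: V_def V'_def s1_def)

lemma inner_integrals:
  "integral {0..Lt} (\<lambda>x. (V x)\<^sup>2) = (halfmass h a + halfmass h b) / kk"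
  "integral {0..Lt} (\<lambda>x. V x powr p) = (halfpow h a + halfpow h b) / kk"
  "integral {0..Lt} (\<lambda>x. (V' x)\<^sup>2) = kk * (halfkin h a + halfkin h b)"
proof -
  have L: "(theta h a + theta h b) / kk = Lt" using kk_Lt kk_pos by (simp add: field_simps)
  note aff = integral_abs_affine[of s1 "theta h b" _ kk, unfolded s1_def L, folded s1_def, OF _ _ _ kk_pos]
  have "continuous_on {0..max s1 (theta h b)} (\<lambda>s. (ps h s)\<^sup>2)" "continuous_on {0..max s1 (theta h b)} (\<lambda>s. (ys h s)\<^sup>2)"
    by (intro continuous_intros ps_cont'; simp)+
  moreover have "continuous_on {0..max s1 (theta h b)} (\<lambda>s. ps h s powr p)"
    using ps_powr_cont[OF good_max] by (simp add: s1_def)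
  moreover have "0 \<le> s1" "0 \<le> theta h b" using th_pos by (auto simp: s1_def)
  ultimately have i: "((\<lambda>x. (ps h \<bar>kk * x - s1\<bar>)\<^sup>2) has_integral (halfmass h a + halfmass h b) / kk) {0..Lt}"
    "((\<lambda>x. ps h \<bar>kk * x - s1\<bar> powr p) has_integral (halfpow h a + halfpow h b) / kk) {0..Lt}"
    "((\<lambda>x. (ys h \<bar>kk * x - s1\<bar>)\<^sup>2) has_integral (halfkin h a + halfkin h b) / kk) {0..Lt}"
    using aff[of "\<lambda>s. (ps h s)\<^sup>2"] aff[of "\<lambda>s. ps h s powr p"] aff[of "\<lambda>s. (ys h s)\<^sup>2"]
    by (auto simp: halfmass_def halfpow_def halfkin_def s1_def)
  show "integral {0..Lt} (\<lambda>x. (V x)\<^sup>2) = (halfmass h a + halfmass h b) / kk"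
    "integral {0..Lt} (\<lambda>x. V x powr p) = (halfpow h a + halfpow h b) / kk"
    using integral_unique[OF i(1)] integral_unique[OF i(2)] by (simp_all add: V_def)
  have sq: "(V' x)\<^sup>2 = kk\<^sup>2 * (ys h \<bar>kk * x - s1\<bar>)\<^sup>2" for x
    by (cases "kk * x - s1 = 0") (auto simp: V'_def power_mult_distrib ys0 sgn_if)
  have "integral {0..Lt} (\<lambda>x. (V' x)\<^sup>2) = kk\<^sup>2 * ((halfkin h a + halfkin h b) / kk)"
    unfolding sq by (intro integral_unique has_integral_mult_right i(3))
  then show "integral {0..Lt} (\<lambda>x. (V' x)\<^sup>2) = kk * (halfkin h a + halfkin h b)"
    using kk_pos by (simp add: power2_eq_square)
qed

definition "idx e = inv_into {..<m} es e"

lemma idx: "i < m \<Longrightarrow> idx (es i) = i" using es_inj by (simp add: idx_def)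

definition "v e x = (if e \<in> P then V (pos (idx e) x) else ul z e x)"
definition "v' e x = (if e \<in> P then (if bs (idx e) then - V' (pos (idx e) x) else V' (pos (idx e) x)) else ul' z e x)"

lemma PE: assumes "e \<in> P" obtains i where "i < m" "e = es i" "idx e = i"
  using assms idx by (auto simp: P_def)

lemma v_pos: "x \<in> {0..len e} \<Longrightarrow> 0 < v e x"
  by (cases "e \<in> P") (auto simp: v_def ul_pos[OF zZ] elim!: PE intro!: V_range(1) pos_range)

lemma v_derivs:
  assumes x: "x \<in> {0..len e}"
  shows "(v e has_real_derivative v' e x) (at x within {0..len e})"
    and "(v' e has_real_derivative kk\<^sup>2 * (v e x - v e x powr (p - 1))) (at x within {0..len e})"
proof -
  show "(v e has_real_derivative v' e x) (at x within {0..len e})"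
  proof (cases "e \<in> P")
    case True
    then obtain i where i: "i < m" "e = es i" "idx e = i" by (rule PE)
    have lin: "(pos i has_real_derivative (if bs i then -1 else 1)) (at x within {0..len e})"
      unfolding pos_def[abs_def] by (auto intro!: derivative_eq_intros)
    have "pos i x \<in> {0..Lt}" using pos_range x i by simp
    from DERIV_chain2[OF V_derivs(1)[OF this] lin] show ?thesis
      using True i unfolding v_def[abs_def] v'_def by (auto split: if_splits)
  next
    case False
    then show ?thesis using ul_derivs(1)[OF zZ x] by (simp add: v_def[abs_def] v'_def)
  qed
  show "(v' e has_real_derivative kk\<^sup>2 * (v e x - v e x powr (p - 1))) (at x within {0..len e})"
  proof (cases "e \<in> P")
    case True
    then obtain i where i: "i < m" "e = es i" "idx e = i" by (rule PE)
    have lin: "(pos i has_real_derivative (if bs i then -1 else 1)) (at x within {0..len e})"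
      unfolding pos_def[abs_def] by (auto intro!: derivative_eq_intros)
    have "pos i x \<in> {0..Lt}" using pos_range x i by simp
    note d = DERIV_chain2[OF V_derivs(2)[OF this] lin]
    show ?thesis
    proof (cases "bs i")
      case True
      with DERIV_minus[OF d] \<open>e \<in> P\<close> i show ?thesis unfolding v_def v'_def[abs_def] by simp
    next
      case False
      with d \<open>e \<in> P\<close> i show ?thesis unfolding v_def v'_def[abs_def] by simp
    qed
  next
    case False
    then show ?thesis using ul_derivs(2)[OF zZ x] by (simp add: v_def v'_def[abs_def] z_simps)
  qed
qed

lemma v_cont: "continuous_on {0..len e} (v e)" "continuous_on {0..len e} (v' e)"
  by (rule DERIV_continuous_on[OF v_derivs(1)], assumption) (rule DERIV_continuous_on[OF v_derivs(2)], assumption)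

definition "phi y = (if y \<in> Vx then V (off (inv_into {0..m} vs y)) else Yl z y)"

lemma phi_vs: "i \<le> m \<Longrightarrow> phi (vs i) = V (off i)"
  using vs_inj by (simp add: phi_def)

text \<open>An edge off the path can meet it only at the two end vertices, where the prescribed
  outer data are the end values \<open>a\<close> and \<open>b\<close> of the bump.\<close>

lemma Yl_phi:
  assumes g: "g \<in> H y" "fst g \<notin> P"
  shows "Yl z y = phi y"
proof (cases "y \<in> Vx")
  case True
  then obtain i where i: "i \<le> m" "y = vs i" by auto
  have "\<not> (0 < i \<and> i < m)"
  proof
    assume ii: "0 < i \<and> i < m"
    then have "g = (es i, bs i) \<or> g = (es (i - 1), \<not> bs (i - 1))" using H_interior(1)[of i] g(1) i(2) by blast
    then have "fst g \<in> P" using ii by (auto simp: P_def)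
    with g show False by simp
  qed
  then consider "i = 0" | "i = m" using i by linarith
  then show ?thesis
  proof cases
    case 1
    then have "Yl z y = a" using Yl_X[OF zZ, of y] True i vs_eq[of 0 m] m_pos by (simp add: data_def z_simps)
    then show ?thesis using 1 i phi_vs[of 0] by (simp add: off_0 V_ends)
  next
    case 2
    then have "Yl z y = b" using Yl_X[OF zZ, of y] True i by (simp add: data_def z_simps)
    then show ?thesis using 2 i phi_vs[of m] by (simp add: Lt_def[symmetric] V_ends)
  qed
qed (simp add: phi_def)

lemma v_vertex: "v e 0 = phi (src e)" "v e (len e) = phi (tgt e)"
proof -
  have "v e 0 = phi (src e) \<and> v e (len e) = phi (tgt e)"
  proof (cases "e \<in> P")
    case True
    then obtain i where i: "i < m" "e = es i" "idx e = i" by (rule PE)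
    then show ?thesis using True path_ends[OF i(1)] phi_vs[of i] phi_vs[of "Suc i"]
      by (cases "bs i") (auto simp: v_def pos_def off_Suc)
  next
    case False
    then show ?thesis using Yl_phi[OF H_src] Yl_phi[OF H_tgt] by (simp add: v_def ul_ends[OF zZ])
  qed
  then show "v e 0 = phi (src e)" "v e (len e) = phi (tgt e)" by auto
qed

text \<open>Outgoing derivative of the glued function along a half-edge.\<close>

definition "gd g = (if snd g then - v' (fst g) (len (fst g)) else v' (fst g) 0)"

lemma gd_out: "fst g \<notin> P \<Longrightarrow> gd g = kk * oder z g"
  using ul'_oder[OF zZ, of "fst g"] by (cases g; cases "snd g") (auto simp: gd_def v'_def z_simps)

lemma gd_path: "i < m \<Longrightarrow> gd (es i, bs i) = V' (off i)" "i < m \<Longrightarrow> gd (es i, \<not> bs i) = - V' (off (Suc i))"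
  by (cases "bs i"; auto simp: gd_def v'_def P_def idx pos_def off_Suc)+

text \<open>Off the path the condition belongs to the outer solution. At interior path vertices the
  two terms are \<open>V'\<close> at the same point with opposite signs. At the two ends it is
  \<open>match1\<close> and \<open>match2\<close>.\<close>

lemma sum_gd:
  assumes m1: "match1 h a b = 0" and m2: "match2 h a b = 0"
  shows "(\<Sum>g\<in>H y. gd g) = 0"
proof (cases "y \<in> Vx")
  case False
  then have "(\<Sum>g\<in>H y. gd g) = (\<Sum>g\<in>H y. kk * oder z g)"
    using H_off_path by (intro sum.cong refl gd_out) auto
  then show ?thesis using kirchhoff_outer[OF zZ False] by (simp add: sum_distrib_left[symmetric])
next
  case True
  then obtain i where i: "i \<le> m" "y = vs i" by auto
  have fo: "finite (Hout y)" for y using finH[of y] by (simp add: Hout_def)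
  have so: "(\<Sum>g\<in>Hout y. gd g) = kk * (\<Sum>g\<in>Hout y. oder z g)" for y
    unfolding sum_distrib_left by (rule sum.cong[OF refl]) (simp add: Hout_def gd_out)
  consider "i = 0" | "i = m" | "0 < i" "i < m" using i by linarith
  then show ?thesis
  proof cases
    case 1
    have "(\<Sum>g\<in>H y. gd g) = V' 0 + kk * (\<Sum>g\<in>Hout (vs 0). oder z g)"
      using 1 i Hout_first fo gd_path(1)[OF m_pos] by (simp add: so off_0)
    also have "\<dots> = kk * match1 h a b" by (simp add: V_ends match1_def distrib_left)
    finally show ?thesis using m1 by simp
  next
    case 2
    have "(\<Sum>g\<in>H y. gd g) = - V' Lt + kk * (\<Sum>g\<in>Hout (vs m). oder z g)"
      using 2 i Hout_last fo gd_path(2)[of "m - 1"] m_pos by (simp add: so Lt_def)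
    also have "\<dots> = kk * match2 h a b" by (simp add: V_ends match2_def distrib_left)
    finally show ?thesis using m2 by simp
  next
    case 3
    then show ?thesis
      using H_interior[OF 3] gd_path(1)[of i] gd_path(2)[of "i - 1"] i by simp
  qed
qed

lemma summable_split:
  fixes f :: "'e \<Rightarrow> real"
  assumes "f summable_on - P"
  shows "f summable_on UNIV" "infsum f UNIV = (\<Sum>i<m. f (es i)) + infsum f (- P)"
proof -
  have fin: "finite P" by (simp add: P_def)
  show s: "f summable_on UNIV"
    using summable_on_Un_disjoint[OF summable_on_finite[OF fin] assms] by simp
  have "infsum f UNIV = infsum f P + infsum f (- P)"
    using infsum_Un_disjoint[OF summable_on_finite[OF fin] assms] by simp
  also have "infsum f P = (\<Sum>i<m. f (es i))"
    using fin es_inj by (simp add: P_def sum.reindex)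
  finally show "infsum f UNIV = (\<Sum>i<m. f (es i)) + infsum f (- P)" .
qed

lemma integral_path_edge:
  assumes "i < m"
  shows "integral {0..len (es i)} (\<lambda>x. (v (es i) x)\<^sup>2) = integral {0..len (es i)} (\<lambda>x. (V (pos i x))\<^sup>2)"
    "integral {0..len (es i)} (\<lambda>x. v (es i) x powr p) = integral {0..len (es i)} (\<lambda>x. V (pos i x) powr p)"
    "integral {0..len (es i)} (\<lambda>x. (v' (es i) x)\<^sup>2) = integral {0..len (es i)} (\<lambda>x. (V' (pos i x))\<^sup>2)"
  using assms idx by (auto simp: v_def v'_def P_def intro!: integral_cong)

lemma v_mass:
  shows "(\<lambda>e. integral {0..len e} (\<lambda>x. (v e x)\<^sup>2)) summable_on UNIV"
    "(\<Sum>\<^sub>\<infinity>e. integral {0..len e} (\<lambda>x. (v e x)\<^sup>2)) = (halfmass h a + halfmass h b) / kk + omass (- P) z"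
proof -
  have s: "(\<lambda>e. integral {0..len e} (\<lambda>x. (v e x)\<^sup>2)) summable_on - P"
    by (rule summable_on_cong[THEN iffD1, OF _ mass_summable[OF zZ]]) (simp add: v_def)
  show "(\<lambda>e. integral {0..len e} (\<lambda>x. (v e x)\<^sup>2)) summable_on UNIV" by (rule summable_split(1)[OF s])
  have "infsum (\<lambda>e. integral {0..len e} (\<lambda>x. (v e x)\<^sup>2)) (- P) = omass (- P) z"
    unfolding omass_def by (rule infsum_cong) (simp add: v_def)
  moreover have "(\<Sum>i<m. integral {0..len (es i)} (\<lambda>x. (v (es i) x)\<^sup>2)) = integral {0..Lt} (\<lambda>x. (V x)\<^sup>2)"
    using sum_path_integral[of "\<lambda>x. (V x)\<^sup>2"] V_cont by (simp add: integral_path_edge continuous_intros)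
  ultimately show "(\<Sum>\<^sub>\<infinity>e. integral {0..len e} (\<lambda>x. (v e x)\<^sup>2)) = (halfmass h a + halfmass h b) / kk + omass (- P) z"
    using summable_split(2)[OF s] inner_integrals(1) by simp
qed

lemma v_kin:
  shows "(\<lambda>e. integral {0..len e} (\<lambda>x. (v' e x)\<^sup>2)) summable_on UNIV"
    "(\<Sum>\<^sub>\<infinity>e. integral {0..len e} (\<lambda>x. (v' e x)\<^sup>2)) \<ge> kk * (halfkin h a + halfkin h b)"
proof -
  obtain C where C: "C \<ge> 0" "\<And>e x. x \<in> {0..len e} \<Longrightarrow> \<bar>ul' z e x\<bar> \<le> C * W e"
    using ul'_bound[OF zZ] by blast
  have i: "(\<lambda>x. (v' e x)\<^sup>2) integrable_on {0..len e}" for e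
    by (intro integrable_continuous_real continuous_intros v_cont)
  have nn: "0 \<le> integral {0..len e} (\<lambda>x. (v' e x)\<^sup>2)" for e
    by (rule Henstock_Kurzweil_Integration.integral_nonneg[OF i]) simp
  have "integral {0..len e} (\<lambda>x. (v' e x)\<^sup>2) \<le> Lm * C\<^sup>2 * (W e)\<^sup>2" if "e \<in> - P" for e
  proof -
    have "integral {0..len e} (\<lambda>x. (v' e x)\<^sup>2) \<le> integral {0..len e} (\<lambda>x. (C * W e)\<^sup>2)"
      using order_trans[OF C(2) abs_ge_self] that
      by (intro integral_le i) (auto simp: v'_def abs_le_square_iff[symmetric])
    also have "\<dots> = len e * (C * W e)\<^sup>2" using len_pos[of e] by simp
    also have "\<dots> \<le> Lm * (C * W e)\<^sup>2" using Lm[of e] by (intro mult_right_mono) auto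
    finally show ?thesis by (simp add: power_mult_distrib mult.assoc)
  qed
  then have s: "(\<lambda>e. integral {0..len e} (\<lambda>x. (v' e x)\<^sup>2)) summable_on - P"
    using nn by (intro summable_on_comparison_test[OF W2_summable[of "Lm * C\<^sup>2" "- P"]]) auto
  show "(\<lambda>e. integral {0..len e} (\<lambda>x. (v' e x)\<^sup>2)) summable_on UNIV" by (rule summable_split(1)[OF s])
  have "(\<Sum>i<m. integral {0..len (es i)} (\<lambda>x. (v' (es i) x)\<^sup>2)) = integral {0..Lt} (\<lambda>x. (V' x)\<^sup>2)"
    using sum_path_integral[of "\<lambda>x. (V' x)\<^sup>2"] V_cont by (simp add: integral_path_edge continuous_intros)
  moreover have "0 \<le> infsum (\<lambda>e. integral {0..len e} (\<lambda>x. (v' e x)\<^sup>2)) (- P)"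
    using nn by (intro infsum_nonneg) auto
  ultimately show "(\<Sum>\<^sub>\<infinity>e. integral {0..len e} (\<lambda>x. (v' e x)\<^sup>2)) \<ge> kk * (halfkin h a + halfkin h b)"
    using summable_split(2)[OF s] inner_integrals(3) by simp
qed

text \<open>Off the path \<open>u powr (p - 1) <= eps * u\<close>, so the outer power integral is
  controlled by the outer mass.\<close>

lemma v_pow:
  "(\<Sum>\<^sub>\<infinity>e. integral {0..len e} (\<lambda>x. v e x powr p)) \<le> (halfpow h a + halfpow h b) / kk + omass (- P) z"
proof -
  have i: "(\<lambda>x. v e x powr p) integrable_on {0..len e}" for e
    using v_pos by (intro integrable_continuous_real continuous_on_powr v_cont continuous_on_const) fastforce
  have nn: "0 \<le> integral {0..len e} (\<lambda>x. v e x powr p)" for e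
    by (rule Henstock_Kurzweil_Integration.integral_nonneg[OF i]) simp
  have le: "integral {0..len e} (\<lambda>x. v e x powr p) \<le> integral {0..len e} (\<lambda>x. (ul z e x)\<^sup>2)" if "e \<in> - P" for e
  proof (rule integral_le[OF i])
    show "(\<lambda>x. (ul z e x)\<^sup>2) integrable_on {0..len e}"
      by (intro integrable_continuous_real continuous_intros ul_cont zZ)
    fix x assume x: "x \<in> {0..len e}"
    have pos: "0 < ul z e x" by (rule ul_pos[OF zZ x])
    have "ul z e x * pw (ul z e) x \<le> ul z e x * (eps * ul z e x)"
      using pw_bound(2)[OF zZ adm_lim[OF zZ] x] pos by (intro mult_left_mono) auto
    also have "\<dots> \<le> (ul z e x)\<^sup>2"
      using eps pos mult_right_mono[of eps 1 "ul z e x * ul z e x"] by (simp add: power2_eq_square mult_ac)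
    also have "ul z e x * pw (ul z e) x = v e x powr p"
      using pos that powr_add[of "ul z e x" 1 "p - 1"] by (simp add: pw_def v_def)
    finally show "v e x powr p \<le> (ul z e x)\<^sup>2" .
  qed
  have s: "(\<lambda>e. integral {0..len e} (\<lambda>x. v e x powr p)) summable_on - P"
    using nn le by (intro summable_on_comparison_test[OF mass_summable[OF zZ, of "- P"]]) auto
  have "(\<Sum>i<m. integral {0..len (es i)} (\<lambda>x. v (es i) x powr p)) = integral {0..Lt} (\<lambda>x. V x powr p)"
    using sum_path_integral[of "\<lambda>x. V x powr p"] V_cont(1) V_range(1)
    by (simp add: integral_path_edge continuous_on_powr less_imp_neq[symmetric])
  moreover have "infsum (\<lambda>e. integral {0..len e} (\<lambda>x. v e x powr p)) (- P) \<le> omass (- P) z"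
    unfolding omass_def using le by (intro infsum_mono s mass_summable zZ)
  ultimately show ?thesis using summable_split(2)[OF s] inner_integrals(2) by simp
qed

lemma solution:
  assumes m1: "match1 h a b = 0" and m2: "match2 h a b = 0"
    and en: "(a * sig h a + b * sig h b) / 4 + scale h a b / p * omass (- P) z
             < (p - 6) / (4 * p) * (halfpow h a + halfpow h b)"
  shows "\<exists>u u' u'' lam. NLS_Kirchhoff_solution src tgt len p lam u u' u'' \<and>
           graph_mass len u = total_mass h a b \<and> graph_energy len p u u' > 0 \<and> lam > 0"
proof -
  \<comment> \<open>Chosen so that \<open>c powr (p - 2) = kk^2\<close>, which removes the scale
    from the equation.\<close>
  define c where "c = kk powr (2 / (p - 2))"
  have c: "c > 0" using kk_pos by (simp add: c_def)
  have cp: "c powr (p - 2) = kk\<^sup>2" 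
  proof -
    have "p - 2 \<noteq> 0" using p6 by simp
    then have "2 / (p - 2) * (p - 2) = 2" by (rule nonzero_eq_divide_eq[THEN iffD1]) (rule refl)
    then show ?thesis using kk_pos unfolding c_def powr_powr by (simp add: powr_numeral)
  qed
  have cp1: "c powr (p - 1) = kk\<^sup>2 * c" using c cp powr_add[of c "p - 2" 1] by simp
  have cpp: "c powr p = kk\<^sup>2 * c\<^sup>2" using c cp powr_add[of c "p - 2" 2] by (simp add: powr_numeral)
  have c2: "c\<^sup>2 = kk powr (4 / (p - 2))"
    using kk_pos by (simp add: c_def power2_eq_square powr_add[symmetric])
  define u where "u e x = c * v e x" for e x
  define u' where "u' e x = c * v' e x" for e x
  define u'' where "u'' e x = c * (kk\<^sup>2 * (v e x - v e x powr (p - 1)))" for e x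
  have sol: "NLS_Kirchhoff_solution src tgt len p (kk\<^sup>2) u u' u''"
    unfolding NLS_Kirchhoff_solution_def
  proof (intro conjI allI ballI)
    fix e x assume x: "x \<in> {0..len e}"
    show "(u e has_real_derivative u' e x) (at x within {0..len e})"
      unfolding u_def[abs_def] u'_def by (intro DERIV_cmult v_derivs x)
    show "0 < u e x" using v_pos[OF x] c by (simp add: u_def)
  next
    fix e x assume x: "x \<in> {0<..<len e}"
    then have x': "x \<in> {0..len e}" by simp
    have "(u' e has_real_derivative u'' e x) (at x within {0..len e})"
      unfolding u'_def[abs_def] u''_def by (intro DERIV_cmult v_derivs x')
    then show "(u' e has_real_derivative u'' e x) (at x)"
      using at_within_Icc_at[of 0 x "len e"] x by simp
    have "u e x powr (p - 1) = kk\<^sup>2 * c * v e x powr (p - 1)"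
      using c v_pos[OF x'] by (simp add: u_def powr_mult cp1)
    then show "u'' e x + u e x powr (p - 1) = kk\<^sup>2 * u e x"
      by (simp add: u''_def u_def algebra_simps)
  next
    show "\<exists>\<phi>. \<forall>e. u e 0 = \<phi> (src e) \<and> u e (len e) = \<phi> (tgt e)"
      by (intro exI[of _ "\<lambda>w. c * phi w"]) (simp add: u_def v_vertex)
  next
    have "integral {0..len e} (\<lambda>x. (u' e x)\<^sup>2 + (u e x)\<^sup>2) =
        c\<^sup>2 * (integral {0..len e} (\<lambda>x. (v' e x)\<^sup>2) + integral {0..len e} (\<lambda>x. (v e x)\<^sup>2))" for e
    proof -
      have "integral {0..len e} (\<lambda>x. (u' e x)\<^sup>2 + (u e x)\<^sup>2) = integral {0..len e} (\<lambda>x. c\<^sup>2 * ((v' e x)\<^sup>2 + (v e x)\<^sup>2))"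
        by (simp add: u_def u'_def power_mult_distrib distrib_left)
      also have "\<dots> = c\<^sup>2 * integral {0..len e} (\<lambda>x. (v' e x)\<^sup>2 + (v e x)\<^sup>2)" by simp
      also have "integral {0..len e} (\<lambda>x. (v' e x)\<^sup>2 + (v e x)\<^sup>2) =
          integral {0..len e} (\<lambda>x. (v' e x)\<^sup>2) + integral {0..len e} (\<lambda>x. (v e x)\<^sup>2)"
        by (intro integral_add integrable_continuous_real continuous_intros v_cont)
      finally show ?thesis .
    qed
    then show "(\<lambda>e. integral {0..len e} (\<lambda>x. (u' e x)\<^sup>2 + (u e x)\<^sup>2)) summable_on UNIV"
      using summable_on_cmult_right[OF summable_on_add[OF v_kin(1) v_mass(1)], of "c\<^sup>2"] by simp
  next
    fix y
    have fin: "finite {e. src e = y}" "finite {e. tgt e = y}"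
      by (rule finite_subset[OF _ finite_imageI[OF finH[of y], of fst]], auto intro: rev_image_eqI[OF H_src] rev_image_eqI[OF H_tgt])+
    have eq: "H y = (\<lambda>e. (e, False)) ` {e. src e = y} \<union> (\<lambda>e. (e, True)) ` {e. tgt e = y}"
      by (auto simp: halfedges_def image_iff split: if_splits)
    have "(\<Sum>g\<in>H y. gd g) = (\<Sum>e\<in>{e. src e = y}. v' e 0) + (\<Sum>e\<in>{e. tgt e = y}. - v' e (len e))"
      unfolding eq using fin
      by (subst sum.union_disjoint) (auto simp: sum.reindex inj_on_def gd_def)
    then have "(\<Sum>e\<in>{e. src e = y}. v' e 0) + (\<Sum>e\<in>{e. tgt e = y}. - v' e (len e)) = 0"
      using sum_gd[OF m1 m2, of y] by simp
    then have "c * ((\<Sum>e\<in>{e. src e = y}. v' e 0) + (\<Sum>e\<in>{e. tgt e = y}. - v' e (len e))) = 0" by simp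
    then show "(\<Sum>e\<in>{e. src e = y}. u' e 0) + (\<Sum>e\<in>{e. tgt e = y}. - u' e (len e)) = 0"
      by (simp add: u'_def distrib_left sum_distrib_left)
  qed
  have mass: "graph_mass len u = total_mass h a b"
  proof -
    have "graph_mass len u = (\<Sum>\<^sub>\<infinity>e. c\<^sup>2 * integral {0..len e} (\<lambda>x. (v e x)\<^sup>2))"
      by (simp add: graph_mass_def u_def power_mult_distrib)
    also have "\<dots> = c\<^sup>2 * (\<Sum>\<^sub>\<infinity>e. integral {0..len e} (\<lambda>x. (v e x)\<^sup>2))"
      using v_mass(1) by (intro infsum_cmult_right)
    finally show ?thesis using v_mass(2) by (simp add: total_mass_def c2 kk_def)
  qed
  have energy: "graph_energy len p u u' > 0"
  proof -
    define K where "K = (\<Sum>\<^sub>\<infinity>e. integral {0..len e} (\<lambda>x. (v' e x)\<^sup>2))"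
    define Q where "Q = (\<Sum>\<^sub>\<infinity>e. integral {0..len e} (\<lambda>x. v e x powr p))"
    have "(\<Sum>\<^sub>\<infinity>e. integral {0..len e} (\<lambda>x. (u' e x)\<^sup>2)) = (\<Sum>\<^sub>\<infinity>e. c\<^sup>2 * integral {0..len e} (\<lambda>x. (v' e x)\<^sup>2))"
      by (simp add: u'_def power_mult_distrib)
    also have "\<dots> = c\<^sup>2 * K" using v_kin(1) unfolding K_def by (intro infsum_cmult_right)
    finally have 1: "(\<Sum>\<^sub>\<infinity>e. integral {0..len e} (\<lambda>x. (u' e x)\<^sup>2)) = c\<^sup>2 * K" .
    have "(\<Sum>\<^sub>\<infinity>e. integral {0..len e} (\<lambda>x. \<bar>u e x\<bar> powr p)) = (\<Sum>\<^sub>\<infinity>e. (kk\<^sup>2 * c\<^sup>2) * integral {0..len e} (\<lambda>x. v e x powr p))"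
    proof (rule infsum_cong)
      fix e
      have "integral {0..len e} (\<lambda>x. \<bar>u e x\<bar> powr p) = integral {0..len e} (\<lambda>x. (kk\<^sup>2 * c\<^sup>2) * v e x powr p)"
      proof (rule integral_cong)
        fix x assume "x \<in> {0..len e}"
        then have "0 < v e x" by (rule v_pos)
        then show "\<bar>u e x\<bar> powr p = (kk\<^sup>2 * c\<^sup>2) * v e x powr p"
          using c by (simp add: u_def abs_mult powr_mult cpp)
      qed
      then show "integral {0..len e} (\<lambda>x. \<bar>u e x\<bar> powr p) = (kk\<^sup>2 * c\<^sup>2) * integral {0..len e} (\<lambda>x. v e x powr p)" by simp
    qed
    also have "\<dots> = (kk\<^sup>2 * c\<^sup>2) * Q"
      unfolding Q_def using c kk_pos by (intro infsum_cmult_right') 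
    finally have 2: "(\<Sum>\<^sub>\<infinity>e. integral {0..len e} (\<lambda>x. \<bar>u e x\<bar> powr p)) = (kk\<^sup>2 * c\<^sup>2) * Q" .
    have "graph_energy len p u u' = c\<^sup>2 * (K / 2 - kk\<^sup>2 / p * Q)"
      unfolding graph_energy_def 1 2 by (simp add: algebra_simps)
    moreover have "K / 2 - kk\<^sup>2 / p * Q > 0"
    proof -
      have "kk\<^sup>2 / p * Q \<le> kk\<^sup>2 / p * ((halfpow h a + halfpow h b) / kk + omass (- P) z)"
        using v_pow p6 unfolding Q_def by (intro mult_left_mono) auto
      also have "\<dots> = kk * ((halfpow h a + halfpow h b) / p + kk / p * omass (- P) z)"
        using kk_pos p6 by (simp add: power2_eq_square field_simps)
      finally have q: "kk\<^sup>2 / p * Q \<le> kk * ((halfpow h a + halfpow h b) / p + kk / p * omass (- P) z)" .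
      \<comment> \<open>Both sides of the bump contribute by \<open>half_energy\<close>; hypothesis
        \<open>en\<close> says that this gain exceeds the boundary terms and the outer power
        integral. The outer kinetic energy is only bounded below by zero.\<close>
      have "(p - 6) / (4 * p) * halfpow h a - a * sig h a / 4 + ((p - 6) / (4 * p) * halfpow h b - b * sig h b / 4)
          \<le> halfkin h a / 2 - halfpow h a / p + (halfkin h b / 2 - halfpow h b / p)"
        by (intro add_mono half_energy h a b)
      moreover have "(p - 6) / (4 * p) * (halfpow h a + halfpow h b) =
          (p - 6) / (4 * p) * halfpow h a + (p - 6) / (4 * p) * halfpow h b" by (rule distrib_left)
      ultimately have "0 < (halfkin h a + halfkin h b) / 2 - ((halfpow h a + halfpow h b) / p + kk / p * omass (- P) z)"
        using en by (simp add: kk_def add_divide_distrib)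
      then have "0 < kk * ((halfkin h a + halfkin h b) / 2 - ((halfpow h a + halfpow h b) / p + kk / p * omass (- P) z))"
        using kk_pos by (intro mult_pos_pos)
      then have "kk * ((halfpow h a + halfpow h b) / p + kk / p * omass (- P) z) < kk * (halfkin h a + halfkin h b) / 2"
        by (simp add: right_diff_distrib)
      moreover have "kk * (halfkin h a + halfkin h b) / 2 \<le> K / 2" using v_kin(2) by (simp add: K_def)
      ultimately show ?thesis using q by linarith
    qed
    ultimately show ?thesis using c by simp
  qed
  show ?thesis using sol mass energy kk_pos
    by (intro exI[of _ u] exI[of _ u'] exI[of _ u''] exI[of _ "kk\<^sup>2"]) simp
qed

end

end

section \<open>Matching at branching vertices\<close>


text \<open>Brouwer is applied to \<open>x + F x\<close> clamped to the box. At a fixed point a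
  component can be nonzero only on a face across which it points outward, and the sign hypotheses
  exclude that.\<close>

lemma poincare_miranda_3:
  fixes F1 F2 F3 :: "real \<times> real \<times> real \<Rightarrow> real"
  assumes le: "a1 \<le> b1" "a2 \<le> b2" "a3 \<le> b3"
  defines "B \<equiv> {a1..b1} \<times> {a2..b2} \<times> {a3..b3}"
  assumes c: "continuous_on B F1" "continuous_on B F2" "continuous_on B F3"
    and f1: "\<And>y z. (a1, y, z) \<in> B \<Longrightarrow> F1 (a1, y, z) > 0" "\<And>y z. (b1, y, z) \<in> B \<Longrightarrow> F1 (b1, y, z) < 0"
    and f2: "\<And>x z. (x, a2, z) \<in> B \<Longrightarrow> F2 (x, a2, z) > 0" "\<And>x z. (x, b2, z) \<in> B \<Longrightarrow> F2 (x, b2, z) < 0"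
    and f3: "\<And>x y. (x, y, a3) \<in> B \<Longrightarrow> F3 (x, y, a3) > 0" "\<And>x y. (x, y, b3) \<in> B \<Longrightarrow> F3 (x, y, b3) < 0"
  shows "\<exists>x\<in>B. F1 x = 0 \<and> F2 x = 0 \<and> F3 x = 0"
proof -
  define cl where "cl a b x = max a (min b x)" for a b x :: real
  define g where "g x = (cl a1 b1 (fst x + F1 x), cl a2 b2 (fst (snd x) + F2 x), cl a3 b3 (snd (snd x) + F3 x))" for x
  have "compact B" "convex B" "B \<noteq> {}"
    using le by (auto simp: B_def intro!: compact_Times convex_Times)
  moreover have "continuous_on B g"
    unfolding g_def cl_def by (intro continuous_intros c)
  moreover have "g \<in> B \<rightarrow> B" using le by (auto simp: g_def cl_def B_def)
  ultimately obtain x where x: "x \<in> B" "g x = x" using brouwer by blast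
  obtain u v w where uvw: "x = (u, v, w)" by (cases x)
  have "cl a1 b1 (u + F1 x) = u" "cl a2 b2 (v + F2 x) = v" "cl a3 b3 (w + F3 x) = w"
    using x(2) by (auto simp: g_def uvw)
  moreover have "u = a1 \<Longrightarrow> F1 x > 0" "u = b1 \<Longrightarrow> F1 x < 0" "v = a2 \<Longrightarrow> F2 x > 0" "v = b2 \<Longrightarrow> F2 x < 0"
    "w = a3 \<Longrightarrow> F3 x > 0" "w = b3 \<Longrightarrow> F3 x < 0"
    using f1 f2 f3 x(1) by (auto simp: uvw)
  moreover have "F = 0" if "cl a b (u + F) = u" "u = a \<Longrightarrow> F > 0" "u = b \<Longrightarrow> F < 0" "a \<le> b" for a b u F :: real
    using that by (cases "u + F \<le> b"; cases "a \<le> u + F") (auto simp: cl_def)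
  ultimately have "F1 x = 0" "F2 x = 0" "F3 x = 0" using le by blast+
  with x show ?thesis by blast
qed

section \<open>Bounds for scale, energy and mass with small cut-offs\<close>

context bump
begin

abbreviation "hs \<equiv> sol_height p"

text \<open>The slope that the energy assigns to the value zero; it vanishes at the homoclinic
  height and measures the distance from it.\<close>

definition "amp h = sqrt (2 * lev p h)"

lemma amp_pos: "hs < h \<Longrightarrow> 0 < amp h"
  and amp_mono: "hs \<le> h \<Longrightarrow> h \<le> h' \<Longrightarrow> amp h \<le> amp h'" and amp_hs: "amp hs = 0"
proof -
  show "hs < h \<Longrightarrow> 0 < amp h"
    using lev_strict_mono[OF p2, of hs h] lev_sol_height[OF p2] sol_height_gt_1[OF p2] by (simp add: amp_def)
  show "hs \<le> h \<Longrightarrow> h \<le> h' \<Longrightarrow> amp h \<le> amp h'"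
    using lev_strict_mono[OF p2, of h h'] sol_height_gt_1[OF p2] by (cases "h = h'") (auto simp: amp_def)
  show "amp hs = 0" using lev_sol_height[OF p2] by (simp add: amp_def)
qed

lemma amp_continuous: "continuous_on {hs..} amp"
proof -
  have "continuous_on {hs..} (lev p)"
    by (rule continuous_on_subset[OF lev_continuous_on[OF p2]]) (use sol_height_gt_1[OF p2] in auto)
  then show ?thesis unfolding amp_def[abs_def] by (intro continuous_intros)
qed

lemma amp_small:
  assumes "r > 0" "hs < hm"
  shows "\<exists>h. hs < h \<and> h < hm \<and> amp h \<le> r"
proof -
  obtain d where d: "d > 0" "\<And>h. h \<ge> hs \<Longrightarrow> \<bar>h - hs\<bar> < d \<Longrightarrow> \<bar>amp h - amp hs\<bar> < r"
    using amp_continuous assms(1) unfolding continuous_on_iff dist_real_def by (metis atLeast_iff order_refl)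
  obtain e where e: "0 < e" "e < hm - hs" "e < d"
    using d(1) assms(2) dense[of 0 "min d (hm - hs)"] by auto
  define h where "h = hs + e"
  have "hs < h" "h < hm" "\<bar>h - hs\<bar> < d" using e by (auto simp: h_def)
  with d(2)[of h] show ?thesis by (intro exI[of _ h]) (auto simp: amp_hs)
qed

lemma mx_zpar: "mx (zpar h a b) = max a b" by (simp add: mx_def zpar_def)

text \<open>A single parameter \<open>rr\<close> bounds the cut-offs and \<open>amp h\<close>, while
  \<open>al\<close> keeps the cut-offs comparable to \<open>rr\<close>. Two choices are made later:
  \<open>rr = amp h\<close> in the branching case, and \<open>h = hs\<close>, \<open>al = 1\<close>,
  \<open>rr = a = b\<close> on the line.\<close>

definition adms :: "real \<Rightarrow> real \<Rightarrow> real \<Rightarrow> real \<Rightarrow> real \<Rightarrow> bool" where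
  "adms al h rr a b \<longleftrightarrow> hs \<le> h \<and> h \<le> Hh \<and> amp h \<le> rr \<and> 0 < rr \<and>
     al * rr \<le> a \<and> a \<le> rr \<and> al * rr \<le> b \<and> b \<le> rr"

text \<open>The lower bound is \<open>exp (- theta h c) <= c + amp h <= 2 * rr\<close>. For the
  upper one the crude estimate \<open>ln (1 / c) <= 1 / c\<close> is enough, since \<open>k\<close>
  will be multiplied by the outer mass of order \<open>rr^2\<close>.\<close>

lemma scale_bounds:
  assumes al: "0 < al" "al \<le> 1"
  shows "\<exists>C>0. \<forall>h rr a b. adms al h rr a b \<and> rr \<le> 1 \<longrightarrow>
    scale h a b \<ge> - 2 * ln (2 * rr) / Lt \<and> scale h a b * rr \<le> C"
proof -
  obtain t0 t1 where t: "t0 > 0" "\<And>h. hs \<le> h \<Longrightarrow> h \<le> Hh \<Longrightarrow> t0 \<le> theta h 1 \<and> theta h 1 \<le> t1"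
    using theta_one_bounds by blast
  have t1: "t1 > 0" using t(1) t(2)[of hs] H_def by simp
  define C where "C = 2 * (t1 + 2 / al) / Lt"
  have C: "C > 0" using t1 al Lt_pos by (simp add: C_def add_pos_pos)
  have "scale h a b \<ge> - 2 * ln (2 * rr) / Lt \<and> scale h a b * rr \<le> C"
    if A: "adms al h rr a b" and rr: "rr \<le> 1" for h rr a b
  proof -
    have h: "hs \<le> h" "h \<le> Hh" and r0: "rr > 0" using A by (auto simp: adms_def)
    have th: "- ln (2 * rr) \<le> theta h c \<and> theta h c * rr \<le> t1 + 2 / al" if c: "al * rr \<le> c" "c \<le> rr" for c
    proof -
      have c0: "0 < c" using al r0 c by (meson less_le_trans mult_pos_pos)
      have ch: "c < h" using c rr h_gt_1[OF h(1)] by simp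
      have "exp (- theta h c) \<le> 2 * rr"
        using theta_exp_lower[OF h c0 ch] A c by (simp add: adms_def amp_def)
      then have "ln (exp (- theta h c)) \<le> ln (2 * rr)" using r0 by (subst ln_le_cancel_iff) auto
      then have lo: "- ln (2 * rr) \<le> theta h c" by simp
      have "ln (1 / c) \<le> 1 / c" using ln_le_minus_one[of "1 / c"] c0 by simp
      also have "\<dots> \<le> 1 / (al * rr)" using c al r0 c0 by (intro divide_left_mono mult_pos_pos) auto
      finally have "theta h c \<le> t1 + 2 * (1 / (al * rr))"
        using theta_upper[OF h c0] t(2)[OF h] c rr by simp
      then have "theta h c * rr \<le> (t1 + 2 * (1 / (al * rr))) * rr" using r0 by (intro mult_right_mono) auto
      also have "\<dots> = t1 * rr + 2 / al" using r0 al by (simp add: field_simps)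
      also have "\<dots> \<le> t1 + 2 / al" using rr t1 by simp
      finally show ?thesis using lo by simp
    qed
    have tha: "- ln (2 * rr) \<le> theta h a \<and> theta h a * rr \<le> t1 + 2 / al"
      and thb: "- ln (2 * rr) \<le> theta h b \<and> theta h b * rr \<le> t1 + 2 / al"
      using th[of a] th[of b] A by (auto simp: adms_def)
    have "- 2 * ln (2 * rr) / Lt \<le> scale h a b"
      unfolding scale_def using tha thb Lt_pos by (intro divide_right_mono) auto
    moreover have "(theta h a + theta h b) * rr / Lt \<le> C"
      unfolding C_def using tha thb Lt_pos by (intro divide_right_mono) (auto simp: distrib_right)
    ultimately show ?thesis by (simp add: scale_def)
  qed
  with C show ?thesis by blast
qed

lemma small_params:
  assumes al: "0 < al" "al \<le> 1"
  shows "\<exists>r0>0. \<forall>h rr a b. adms al h rr a b \<and> rr \<le> r0 \<longrightarrow>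
    0 < a \<and> a < h \<and> 0 < b \<and> b < h \<and> rr \<le> 1 \<and> zpar h a b \<in> Zs \<and>
    (a * sig h a + b * sig h b) / 4 + scale h a b / p * omass (- P) (zpar h a b)
             < (p - 6) / (4 * p) * (halfpow h a + halfpow h b)"
proof -
  obtain C where C: "C > 0" "\<And>h rr a b. adms al h rr a b \<Longrightarrow> rr \<le> 1 \<Longrightarrow>
    scale h a b \<ge> - 2 * ln (2 * rr) / Lt \<and> scale h a b * rr \<le> C"
    using scale_bounds[OF al] by blast
  obtain t0 t1 where t: "t0 > 0" "\<And>h. hs \<le> h \<Longrightarrow> h \<le> Hh \<Longrightarrow> t0 \<le> theta h 1 \<and> theta h 1 \<le> t1"
    using theta_one_bounds by blast
  define Cm where "Cm = 32 * Lm * real D * real (card Vx)"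
  have "Lm > 0" using order_less_le_trans[OF len_pos Lm] by blast
  then have Cm: "Cm \<ge> 0" by (simp add: Cm_def)
  \<comment> \<open>Lower bound for the right-hand side of the energy condition, as each
    \<open>halfpow\<close> is at least \<open>t0\<close>; the left-hand side will be at most
    \<open>C2 * rr\<close>.\<close>
  define E0 where "E0 = (p - 6) / (4 * p) * (2 * t0)"
  have E0: "E0 > 0" using p6 t by (simp add: E0_def)
  define C2 where "C2 = 1 + C * Cm / p"
  have C2: "C2 \<ge> 1" using C Cm p6 by (simp add: C2_def)
  \<comment> \<open>\<open>m0\<close> and the exponential put the parameters into \<open>Zs\<close>,
    the latter by making the logarithmic lower bound for the scale exceed \<open>K0\<close>; the
    last term gives the energy condition.\<close>
  define r0 where "r0 = min (min 1 m0) (min (exp (- K0 * Lt / 2) / 2) (E0 / (2 * C2)))"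
  have r0: "r0 > 0" using m0 E0 C2 by (simp add: r0_def)
  have "0 < a \<and> a < h \<and> 0 < b \<and> b < h \<and> rr \<le> 1 \<and> zpar h a b \<in> Zs \<and>
    (a * sig h a + b * sig h b) / 4 + scale h a b / p * omass (- P) (zpar h a b)
             < (p - 6) / (4 * p) * (halfpow h a + halfpow h b)"
    if A: "adms al h rr a b" and rr: "rr \<le> r0" for h rr a b
  proof -
    have h: "hs \<le> h" "h \<le> Hh" and rp: "rr > 0" using A by (auto simp: adms_def)
    have r1: "rr \<le> 1" "rr \<le> m0" "rr \<le> exp (- K0 * Lt / 2) / 2" "rr \<le> E0 / (2 * C2)" using rr by (auto simp: r0_def)
    have ab: "0 < a" "0 < b" "a \<le> rr" "b \<le> rr"
      using A al rp by (auto simp: adms_def intro: less_le_trans[OF mult_pos_pos])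
    have abh: "a < h" "b < h" using ab r1 h_gt_1[OF h(1)] by auto
    have "ln (2 * rr) \<le> ln (exp (- K0 * Lt / 2))" using rp r1(3) by (subst ln_le_cancel_iff) auto
    then have "K0 * Lt \<le> - 2 * ln (2 * rr)" by simp
    then have "K0 \<le> - 2 * ln (2 * rr) / Lt" by (rule pos_le_divide_eq[OF Lt_pos, THEN iffD2])
    then have k: "K0 \<le> scale h a b" using C(2)[OF A r1(1)] by linarith
    have zZ: "zpar h a b \<in> Zs" using k ab r1 by (simp add: zpar_def Zs_def)
    have s: "c * sig h c \<le> 2 * (rr * rr)" if "0 < c" "c \<le> rr" for c
    proof -
      have "sig h c \<le> 2 * rr" using sig_le[OF h(1), of c] A that by (simp add: adms_def amp_def)
      then have "c * sig h c \<le> c * (2 * rr)" using that by (intro mult_left_mono) auto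
      also have "\<dots> \<le> rr * (2 * rr)" using that by (intro mult_right_mono) auto
      finally show ?thesis by simp
    qed
    have "omass (- P) (zpar h a b) \<le> Cm * (max a b)\<^sup>2"
      using omass_bounds(2)[OF zZ] by (simp add: mx_zpar Cm_def)
    also have "\<dots> \<le> Cm * rr\<^sup>2" using ab Cm by (intro mult_left_mono power_mono) auto
    finally have om: "omass (- P) (zpar h a b) \<le> Cm * rr\<^sup>2" .
    have "scale h a b / p * omass (- P) (zpar h a b) \<le> scale h a b / p * (Cm * rr\<^sup>2)"
      using om k K0 p6 by (intro mult_left_mono) auto
    also have "\<dots> = (scale h a b * rr) * (Cm * rr / p)" by (simp add: power2_eq_square)
    also have "\<dots> \<le> C * (Cm * rr / p)"
      using C(2)[OF A r1(1)] Cm rp p6 by (intro mult_right_mono) auto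
    finally have e1: "scale h a b / p * omass (- P) (zpar h a b) \<le> C * Cm / p * rr" by simp
    have "rr * rr \<le> rr * 1" using r1 rp by (intro mult_left_mono) auto
    with s[OF ab(1,3)] s[OF ab(2,4)] have e2: "(a * sig h a + b * sig h b) / 4 \<le> rr" by simp
    have "(a * sig h a + b * sig h b) / 4 + scale h a b / p * omass (- P) (zpar h a b) \<le> rr + C * Cm / p * rr"
      using e1 e2 by (rule add_mono[rotated])
    also have "\<dots> = C2 * rr" by (simp add: C2_def distrib_right)
    also have "\<dots> \<le> C2 * (E0 / (2 * C2))" using r1 C2 by (intro mult_left_mono) auto
    also have "\<dots> < E0" using C2 E0 by simp
    also have "\<dots> \<le> (p - 6) / (4 * p) * (halfpow h a + halfpow h b)"
      unfolding E0_def using halfmass_bounds(3)[OF h ab(1)] halfmass_bounds(3)[OF h ab(2)] t(2)[OF h] ab r1 p6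
      by (intro mult_left_mono) auto
    finally show ?thesis using ab abh r1 zZ by simp
  qed
  with r0 show ?thesis by blast
qed

text \<open>With \<open>q = 4 / (p - 2)\<close>, which is below 1 because \<open>p > 6\<close>, the
  inner part is at most \<open>k powr (q - 1) * N\<close> with \<open>k\<close> large, and the outer
  part at most \<open>(k * rr) * (Cm * rr) <= C * Cm * rr\<close>.\<close>

lemma mass_small:
  assumes al: "0 < al" "al \<le> 1" and mu: "mu > 0"
  shows "\<exists>r1>0. \<forall>h rr a b. adms al h rr a b \<and> rr \<le> r1 \<longrightarrow> total_mass h a b < mu"
proof -
  obtain C where C: "C > 0" "\<And>h rr a b. adms al h rr a b \<Longrightarrow> rr \<le> 1 \<Longrightarrow>
    scale h a b \<ge> - 2 * ln (2 * rr) / Lt \<and> scale h a b * rr \<le> C"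
    using scale_bounds[OF al] by blast
  obtain r0 where r0: "r0 > 0" "\<And>h rr a b. adms al h rr a b \<Longrightarrow> rr \<le> r0 \<Longrightarrow>
    0 < a \<and> a < h \<and> 0 < b \<and> b < h \<and> rr \<le> 1 \<and> zpar h a b \<in> Zs"
    using small_params[OF al] by blast
  obtain t0 t1 where t: "t0 > 0" "\<And>h. hs \<le> h \<Longrightarrow> h \<le> Hh \<Longrightarrow> t0 \<le> theta h 1 \<and> theta h 1 \<le> t1"
    using theta_one_bounds by blast
  define q where "q = 4 / (p - 2)"
  have q: "0 < q" "q < 1" using p6 by (auto simp: q_def field_simps)
  define Cm where "Cm = 32 * Lm * real D * real (card Vx)"
  have "Lm > 0" using order_less_le_trans[OF len_pos Lm] by blast
  then have Cm: "Cm \<ge> 0" by (simp add: Cm_def)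
  define N where "N = 2 * (Hh\<^sup>2 * t1 + 1)"
  have t1: "t1 > 0" using t(1) t(2)[of hs] H_def by simp
  have N: "N > 0" using t1 by (auto simp: N_def intro!: add_nonneg_pos)
  have "((\<lambda>x. x powr (q - 1)) \<longlongrightarrow> 0) at_top" using q by (intro tendsto_neg_powr filterlim_ident) auto
  then have "\<forall>\<^sub>F x in at_top. x powr (q - 1) < mu / (2 * N)"
    using mu N by (intro order_tendstoD(2)) auto
  then obtain M0 where M0: "\<And>x. x \<ge> M0 \<Longrightarrow> x powr (q - 1) < mu / (2 * N)"
    by (auto simp: eventually_at_top_linorder)
  define M where "M = max 1 M0"
  define r1 where "r1 = min r0 (min (exp (- M * Lt / 2) / 2) (mu / (2 * (C * Cm + 1))))"
  have half: "x * (mu / (2 * x)) = mu / 2" if "x > 0" for x :: real using that by simp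
  have CC: "C * Cm + 1 > 0" using C Cm by (simp add: add_nonneg_pos)
  have r1: "r1 > 0" using r0 mu CC by (simp add: r1_def)
  have "total_mass h a b < mu" if A: "adms al h rr a b" and rr: "rr \<le> r1" for h rr a b
  proof -
    have rr': "rr \<le> r0" "rr \<le> exp (- M * Lt / 2) / 2" "rr \<le> mu / (2 * (C * Cm + 1))" using rr by (auto simp: r1_def)
    note P = r0(2)[OF A rr'(1)]
    have h: "hs \<le> h" "h \<le> Hh" and rp: "rr > 0" and ab: "a \<le> rr" "b \<le> rr" using A by (auto simp: adms_def)
    define k where "k = scale h a b"
    have "ln (2 * rr) \<le> ln (exp (- M * Lt / 2))" using rp rr'(2) by (subst ln_le_cancel_iff) auto
    then have "M * Lt \<le> - 2 * ln (2 * rr)" by simp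
    then have "M \<le> - 2 * ln (2 * rr) / Lt" by (rule pos_le_divide_eq[OF Lt_pos, THEN iffD2])
    then have kM: "M \<le> k" and kC: "k * rr \<le> C" using C(2)[OF A] P by (auto simp: k_def)
    then have k1: "1 \<le> k" and kM0: "M0 \<le> k" by (auto simp: M_def)
    have hm: "halfmass h a + halfmass h b \<le> N"
      using halfmass_bounds(2)[OF h, of a] halfmass_bounds(2)[OF h, of b] P ab t(2)[OF h]
        mult_left_mono[of "theta h 1" t1 "Hh\<^sup>2"] by (simp add: N_def)
    have "omass (- P) (zpar h a b) \<le> Cm * (max a b)\<^sup>2"
      using omass_bounds(2)[of "zpar h a b"] P by (simp add: mx_zpar Cm_def)
    also have "\<dots> \<le> Cm * rr\<^sup>2" using ab P Cm by (intro mult_left_mono power_mono) auto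
    finally have om: "omass (- P) (zpar h a b) \<le> Cm * rr\<^sup>2" .
    have kq: "k powr q \<le> k" using k1 q powr_mono[of q 1 k] by simp
    have "total_mass h a b = k powr q * ((halfmass h a + halfmass h b) / k) + k powr q * omass (- P) (zpar h a b)"
      by (simp add: total_mass_def k_def q_def distrib_left)
    also have "\<dots> \<le> k powr q * (N / k) + k * (Cm * rr\<^sup>2)"
      using hm om kq k1 omass_bounds(1)[of "zpar h a b"] P
      by (intro add_mono mult_left_mono mult_mono divide_right_mono) auto
    also have "k powr q * (N / k) = k powr (q - 1) * N" using k1 by (simp add: powr_diff)
    also have "\<dots> < mu / (2 * N) * N" using M0[OF kM0] N by (intro mult_strict_right_mono)
    also have "\<dots> = mu / 2" using N by simp
    also have "k * (Cm * rr\<^sup>2) = (k * rr) * (Cm * rr)" by (simp add: power2_eq_square)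
    also have "\<dots> \<le> C * (Cm * rr)" using kC Cm rp by (intro mult_right_mono) auto
    also have "\<dots> \<le> (C * Cm + 1) * rr" using rp by (simp add: distrib_right)
    also have "\<dots> \<le> (C * Cm + 1) * (mu / (2 * (C * Cm + 1)))" using rr'(3) CC by (intro mult_left_mono) auto
    also have "\<dots> = mu / 2" by (rule half[OF CC])
    finally show ?thesis by simp
  qed
  with r1 show ?thesis by blast
qed

definition Adom :: "(real \<times> real \<times> real) set" where
  "Adom = {(h, a, b). hs \<le> h \<and> h \<le> Hh \<and> 0 < a \<and> a < h \<and> 0 < b \<and> b < h \<and> zpar h a b \<in> Zs}"

lemma
  shows total_mass_continuous: "continuous_on Adom (\<lambda>(h, a, b). total_mass h a b)"
    and match1_continuous: "continuous_on Adom (\<lambda>(h, a, b). match1 h a b)"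
    and match2_continuous: "continuous_on Adom (\<lambda>(h, a, b). match2 h a b)"
proof -
  have th: "continuous_on Adom (\<lambda>y. theta (fst y) (fst (snd y)))" "continuous_on Adom (\<lambda>y. theta (fst y) (snd (snd y)))"
    by (rule continuous_on_compose2[OF theta_continuous, where f="\<lambda>y. (fst y, fst (snd y))", simplified]
         continuous_on_compose2[OF theta_continuous, where f="\<lambda>y. (fst y, snd (snd y))", simplified];
        auto simp: Adom_def intro!: continuous_intros)+
  have hm: "continuous_on Adom (\<lambda>y. halfmass (fst y) (fst (snd y)))" "continuous_on Adom (\<lambda>y. halfmass (fst y) (snd (snd y)))"
    by (rule continuous_on_compose2[OF halfmass_continuous, where f="\<lambda>y. (fst y, fst (snd y))", simplified]
         continuous_on_compose2[OF halfmass_continuous, where f="\<lambda>y. (fst y, snd (snd y))", simplified];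
        auto simp: Adom_def intro!: continuous_intros)+
  have sc: "continuous_on Adom (\<lambda>y. scale (fst y) (fst (snd y)) (snd (snd y)))"
    unfolding scale_def using Lt_pos by (intro continuous_intros th) auto
  have zc: "continuous_on Adom (\<lambda>y. zpar (fst y) (fst (snd y)) (snd (snd y)))"
    unfolding zpar_def by (intro continuous_intros sc)
  have zZ: "(\<lambda>y. zpar (fst y) (fst (snd y)) (snd (snd y))) ` Adom \<subseteq> Zs" by (auto simp: Adom_def)
  have scp: "scale (fst y) (fst (snd y)) (snd (snd y)) > 0" if "y \<in> Adom" for y
    using zZ ZsD(2)[of "zpar (fst y) (fst (snd y)) (snd (snd y))"] that by (auto simp: zpar_def)
  have om: "continuous_on Adom (\<lambda>y. omass (- P) (zpar (fst y) (fst (snd y)) (snd (snd y))))"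
    by (rule continuous_on_compose2[OF omass_continuous zc zZ])
  have od: "continuous_on Adom (\<lambda>y. oder (zpar (fst y) (fst (snd y)) (snd (snd y))) g)" for g
    by (rule continuous_on_compose2[OF oder_continuous zc zZ])
  have sg: "continuous_on Adom (\<lambda>y. sig (fst y) (fst (snd y)))" "continuous_on Adom (\<lambda>y. sig (fst y) (snd (snd y)))"
    unfolding sig_def using sol_height_gt_1[OF p2]
    by (auto intro!: continuous_intros continuous_on_compose2[OF lev_continuous_on[OF p2]] simp: Adom_def)
  show "continuous_on Adom (\<lambda>(h, a, b). total_mass h a b)"
    unfolding total_mass_def case_prod_unfold using scp less_imp_neq[OF scp, symmetric]
    by (intro continuous_intros sc hm om) auto
  show "continuous_on Adom (\<lambda>(h, a, b). match1 h a b)"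
    unfolding match1_def case_prod_unfold by (intro continuous_intros sg od)
  show "continuous_on Adom (\<lambda>(h, a, b). match2 h a b)"
    unfolding match2_def case_prod_unfold by (intro continuous_intros sg od)
qed

lemma total_mass_pos: 
  assumes "(h, a, b) \<in> Adom" "a \<le> 1" "b \<le> 1"
  shows "0 < total_mass h a b"
proof -
  have h: "hs \<le> h" "h \<le> Hh" and z: "zpar h a b \<in> Zs" and ab: "0 < a" "0 < b" using assms(1) by (auto simp: Adom_def)
  have k: "scale h a b > 0" using ZsD(2)[OF z] by (simp add: zpar_def)
  have "0 < theta h 1" using theta_props(1)[OF h, of 1] h_gt_1[OF h(1)] by simp
  then have "0 < halfmass h a + halfmass h b"
    using halfmass_bounds(1)[OF h ab(1) assms(2)] halfmass_bounds(1)[OF h ab(2) assms(3)] by simp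
  then have "0 < (halfmass h a + halfmass h b) / scale h a b" using k by (rule divide_pos_pos)
  then show ?thesis unfolding total_mass_def using k omass_bounds(1)[OF z, of "- P"]
    by (intro mult_pos_pos add_pos_nonneg) auto
qed

lemma D_pos: "D \<ge> 1"
  using neH finH cardH by (metis One_nat_def Suc_leI card_gt_0_iff order_trans)

text \<open>With \<open>n \<ge> 2\<close> outer half-edges the sum is about \<open>- n * c\<close>, whereas
\<open>sig h c\<close> is about \<open>sqrt (c\<^sup>2 + (amp h)\<^sup>2)\<close>.\<close>

lemma match_signs:
  assumes H': "H' \<subseteq> H x" "2 \<le> card H'" and x: "x \<in> Vx" and zz: "zz \<in> Zs" and dz: "data zz x = c"
    and h: "hs < h" "h \<le> Hh" and mz: "mx zz \<le> amp h" and amp1: "amp h \<le> 1"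
  shows "c = amp h \<Longrightarrow> sig h c + (\<Sum>g\<in>H'. oder zz g) < 0"
    and "c = 1 / (4 * real D) * amp h \<Longrightarrow> sig h c + (\<Sum>g\<in>H'. oder zz g) > 0"
proof -
  have r: "amp h > 0" by (rule amp_pos[OF h(1)])
  have card: "card H' \<le> D" using card_mono[OF finH H'(1)] cardH[of x] by simp
  have lev: "2 * lev p h = (amp h)\<^sup>2" using lev_nonneg[OF p2, of h] h by (simp add: amp_def)
  {
    assume c: "c = amp h"
    \<comment> \<open>Here \<open>sig\<close> is at most \<open>sqrt 2 * amp h\<close>, below
      \<open>3/2 * amp h\<close>, while at least two half-edges contribute at most
      \<open>- 9/10 * amp h\<close> each.\<close>
    have "sig h c \<le> sqrt (2 * (amp h)\<^sup>2)"
      unfolding sig_def using lev lev_upper[OF p2, of c] c by (intro real_sqrt_le_mono) simp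
    also have "\<dots> = sqrt 2 * amp h" using r by (simp add: real_sqrt_mult)
    also have "\<dots> < 3/2 * amp h" using r by (intro mult_strict_right_mono real_less_lsqrt) (auto simp: power2_eq_square)
    finally have s: "sig h c < 3/2 * amp h" .
    have "(\<Sum>g\<in>H'. oder zz g) \<le> (\<Sum>g\<in>H'. - (9/10) * amp h)"
    proof (rule sum_mono)
      fix g assume "g \<in> H'"
      then have "oder zz g \<le> - c + 9 * eps * mx zz" using oder_bounds(2)[OF zz _ x, of g] H' dz by auto
      also have "9 * eps * mx zz \<le> 1/10 * amp h"
        using eps mz ZsD(5)[OF zz] by (intro mult_mono) auto
      finally show "oder zz g \<le> - (9/10) * amp h" using c by simp
    qed
    also have "\<dots> = - (real (card H') * (9/10 * amp h))" by simp
    also have "\<dots> \<le> - (2 * (9/10 * amp h))" using H'(2) r by simp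
    finally show "sig h c + (\<Sum>g\<in>H'. oder zz g) < 0" using s r by simp
  next
    assume c: "c = 1 / (4 * real D) * amp h"
    have D: "real D \<ge> 1" using D_pos by simp
    have "1 / (4 * real D) * amp h \<le> 1 * amp h" using D r by (intro mult_right_mono) auto
    then have c0: "0 < c" "c \<le> 1" using c r D amp1 by auto
    have "c < hs" using c0 sol_height_gt_1[OF p2] by simp
    then have "amp h \<le> sig h c"
      unfolding amp_def sig_def using lev_neg[OF p2 c0(1)] by (intro real_sqrt_le_mono) simp
    \<comment> \<open>At most \<open>D\<close> half-edges take away at most \<open>2 * c\<close>
      each, in total half of \<open>amp h\<close>.\<close>
    moreover have "(\<Sum>g\<in>H'. oder zz g) \<ge> (\<Sum>g\<in>H'. - c * 2)"
    proof (rule sum_mono)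
      fix g assume "g \<in> H'"
      then have "- c * (1 + eps) \<le> oder zz g" using oder_bounds(1)[OF zz _ x, of g] H' dz by auto
      moreover have "c * (1 + eps) \<le> c * 2" using c0 eps by (intro mult_left_mono) auto
      ultimately show "- c * 2 \<le> oder zz g" by simp
    qed
    moreover have "(\<Sum>g\<in>H'. - c * 2) = - (real (card H') * (c * 2))" by simp
    moreover have "real (card H') * (c * 2) \<le> real D * (c * 2)" using card c0 by (intro mult_right_mono) auto
    moreover have "real D * (c * 2) = amp h / 2" using c D by (simp add: field_simps)
    ultimately show "sig h c + (\<Sum>g\<in>H'. oder zz g) > 0" using r by linarith
  }
qed

text \<open>The cut-offs are written as \<open>x * amp h\<close> and \<open>y * amp h\<close>, so
  that the box in \<open>(h, x, y)\<close> has fixed faces although the cut-offs shrink with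
  \<open>h\<close>. The face \<open>h = h0\<close> is chosen first and fixes the mass threshold; the
  face \<open>h = h1\<close> depends on the prescribed mass.\<close>

lemma branching_case:
  assumes deg: "2 \<le> card (Hout (vs 0))" "2 \<le> card (Hout (vs m))"
  shows "\<exists>\<mu>0>0. \<forall>\<mu>. 0 < \<mu> \<and> \<mu> \<le> \<mu>0 \<longrightarrow>
           (\<exists>u u' u'' lam. NLS_Kirchhoff_solution src tgt len p lam u u' u''
                          \<and> graph_mass len u = \<mu> \<and> graph_energy len p u u' > 0 \<and> lam > 0)"
proof -
  define al where "al = 1 / (4 * real D)"
  have al: "0 < al" "al \<le> 1" using D_pos by (auto simp: al_def field_simps)
  obtain r0 where r0: "r0 > 0" "\<And>h rr a b. adms al h rr a b \<Longrightarrow> rr \<le> r0 \<Longrightarrow>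
    0 < a \<and> a < h \<and> 0 < b \<and> b < h \<and> rr \<le> 1 \<and> zpar h a b \<in> Zs \<and>
    (a * sig h a + b * sig h b) / 4 + scale h a b / p * omass (- P) (zpar h a b)
             < (p - 6) / (4 * p) * (halfpow h a + halfpow h b)"
    using small_params[OF al] by blast
  obtain h0 where h0: "hs < h0" "h0 < Hh" "amp h0 \<le> r0" using amp_small[OF r0(1), of Hh] H_def by auto
  define ff where "ff y = (fst y, fst (snd y) * amp (fst y), snd (snd y) * amp (fst y))" for y :: "real \<times> real \<times> real"
  have adm: "adms al h (amp h) (x * amp h) (y * amp h)" "amp h \<le> r0" "0 < amp h"
    if "hs < h" "h \<le> h0" "al \<le> x" "x \<le> 1" "al \<le> y" "y \<le> 1" for h x y
    using that h0 amp_pos[OF that(1)] amp_mono[of h h0]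
    by (auto simp: adms_def mult_left_le_one_le intro!: mult_right_mono)
  have ffA: "ff y \<in> Adom" if "y \<in> {h1..h0} \<times> {al..1} \<times> {al..1}" "hs < h1" for y h1
    using that r0(2)[OF adm(1,2)[of "fst y" "fst (snd y)" "snd (snd y)"]] h0
    by (auto simp: ff_def Adom_def)
  have ffc: "continuous_on ({h1..h0} \<times> {al..1} \<times> {al..1}) ff" if "hs < h1" for h1
  proof -
    have "continuous_on ({h1..h0} \<times> {al..1} \<times> {al..1}) (\<lambda>y. amp (fst y))"
      by (rule continuous_on_compose2[OF amp_continuous]) (use that in \<open>auto intro!: continuous_intros\<close>)
    then show ?thesis unfolding ff_def[abs_def] by (intro continuous_intros)
  qed
  define TM where "TM y = (case ff y of (h, a, b) \<Rightarrow> total_mass h a b)" for y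
  define M1 where "M1 y = (case ff y of (h, a, b) \<Rightarrow> match1 h a b)" for y
  define M2 where "M2 y = (case ff y of (h, a, b) \<Rightarrow> match2 h a b)" for y
  have cont: "continuous_on ({h1..h0} \<times> {al..1} \<times> {al..1}) TM" "continuous_on ({h1..h0} \<times> {al..1} \<times> {al..1}) M1"
    "continuous_on ({h1..h0} \<times> {al..1} \<times> {al..1}) M2" if "hs < h1" for h1
    unfolding TM_def M1_def M2_def using ffA[OF _ that]
    by (intro continuous_on_compose2[OF total_mass_continuous ffc[OF that]]
        continuous_on_compose2[OF match1_continuous ffc[OF that]]
        continuous_on_compose2[OF match2_continuous ffc[OF that]]; blast)+
  have B0: "compact ({h0..h0} \<times> {al..1} \<times> {al..1})" "{h0..h0} \<times> {al..1} \<times> {al..1} \<noteq> {}"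
    using al by (auto intro!: compact_Times)
  obtain y0 where y0: "y0 \<in> {h0..h0} \<times> {al..1} \<times> {al..1}"
      "\<And>y. y \<in> {h0..h0} \<times> {al..1} \<times> {al..1} \<Longrightarrow> TM y0 \<le> TM y"
    using continuous_attains_inf[OF B0 cont(1)[OF h0(1)]] by blast
  have "0 < TM y0"
  proof -
    obtain x y where xy: "y0 = (h0, x, y)" "al \<le> x" "x \<le> 1" "al \<le> y" "y \<le> 1" using y0(1) by (cases y0) auto
    have "amp h0 \<le> 1" "x * amp h0 \<le> amp h0" "y * amp h0 \<le> amp h0"
      using r0(2)[OF adm(1,2)[OF h0(1) order_refl xy(2-5)]] adm(1)[OF h0(1) order_refl xy(2-5)]
      by (auto simp: adms_def)
    then show ?thesis using ffA[OF y0(1) h0(1)] total_mass_pos by (auto simp: TM_def ff_def xy)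
  qed
  \<comment> \<open>Half of the minimal mass on the face \<open>h = h0\<close>, because the mass
    inequality on that face has to be strict.\<close>
  define \<mu>0 where "\<mu>0 = TM y0 / 2"
  have \<mu>0: "0 < \<mu>0" "\<mu>0 < TM y0" using \<open>0 < TM y0\<close> by (auto simp: \<mu>0_def)
  show ?thesis
  proof (intro exI[of _ \<mu>0] conjI \<mu>0 allI impI)
    fix \<mu> assume \<mu>: "0 < \<mu> \<and> \<mu> \<le> \<mu>0"
    obtain r1 where r1: "r1 > 0" "\<And>h rr a b. adms al h rr a b \<Longrightarrow> rr \<le> r1 \<Longrightarrow> total_mass h a b < \<mu>"
      using mass_small[OF al, of \<mu>] \<mu> by blast
    obtain h1 where h1: "hs < h1" "h1 < h0" "amp h1 \<le> r1" using amp_small[OF r1(1) h0(1)] by blast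
    define B where "B = {h1..h0} \<times> {al..1} \<times> {al..1}"
    have inB: "hs < h \<and> h \<le> h0 \<and> al \<le> x \<and> x \<le> 1 \<and> al \<le> y \<and> y \<le> 1" if "(h, x, y) \<in> B" for h x y
      using that h1 by (auto simp: B_def)
    have good: "adms al h (amp h) (x * amp h) (y * amp h)" "amp h \<le> 1" "zpar h (x * amp h) (y * amp h) \<in> Zs"
       "mx (zpar h (x * amp h) (y * amp h)) \<le> amp h" if "(h, x, y) \<in> B" for h x y
      using adm[of h x y] r0(2)[of h "amp h" "x * amp h" "y * amp h"] inB[OF that]
      by (auto simp: mx_zpar adms_def)
    have d0: "data (zpar h a b) (vs 0) = a" "data (zpar h a b) (vs m) = b" for h a b
      using vs_eq[of 0 m] m_pos by (auto simp: data_def zpar_def)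
    have H0: "Hout x \<subseteq> H x" for x by (auto simp: Hout_def)
    have "\<exists>y\<in>B. \<mu> - TM y = 0 \<and> M1 y = 0 \<and> M2 y = 0"
      unfolding B_def
    proof (rule poincare_miranda_3; (fold B_def)?)
      show "h1 \<le> h0" "al \<le> 1" "al \<le> 1" using h1 al by auto
      show "continuous_on B (\<lambda>y. \<mu> - TM y)" "continuous_on B M1" "continuous_on B M2"
        unfolding B_def using cont[OF h1(1)] by (auto intro!: continuous_intros)
      show "0 < \<mu> - TM (h1, x, y)" if "(h1, x, y) \<in> B" for x y
        using r1(2)[OF good(1)[OF that] h1(3)] by (simp add: TM_def ff_def)
      show "\<mu> - TM (h0, x, y) < 0" if "(h0, x, y) \<in> B" for x y
        using y0(2)[of "(h0, x, y)"] inB[OF that] \<mu> \<mu>0 by simp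
      show "0 < M1 (h, al, y)" if "(h, al, y) \<in> B" for h y
        using match_signs(2)[OF H0 deg(1) _ good(3)[OF that] d0(1) _ _ good(4)[OF that] good(2)[OF that]] inB[OF that] h0
        by (simp add: M1_def ff_def match1_def al_def)
      show "M1 (h, 1, y) < 0" if "(h, 1, y) \<in> B" for h y
        using match_signs(1)[OF H0 deg(1) _ good(3)[OF that] d0(1) _ _ good(4)[OF that] good(2)[OF that]] inB[OF that] h0
        by (simp add: M1_def ff_def match1_def)
      show "0 < M2 (h, x, al)" if "(h, x, al) \<in> B" for h x
        using match_signs(2)[OF H0 deg(2) _ good(3)[OF that] d0(2) _ _ good(4)[OF that] good(2)[OF that]] inB[OF that] h0
        by (simp add: M2_def ff_def match2_def al_def)
      show "M2 (h, x, 1) < 0" if "(h, x, 1) \<in> B" for h x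
        using match_signs(1)[OF H0 deg(2) _ good(3)[OF that] d0(2) _ _ good(4)[OF that] good(2)[OF that]] inB[OF that] h0
        by (simp add: M2_def ff_def match2_def)
    qed
    then obtain h x y where B: "(h, x, y) \<in> B" "TM (h, x, y) = \<mu>" "M1 (h, x, y) = 0" "M2 (h, x, y) = 0"
      by auto
    have i: "hs < h" "h \<le> h0" "al \<le> x" "x \<le> 1" "al \<le> y" "y \<le> 1" using inB[OF B(1)] by auto
    note R = r0(2)[OF adm(1,2)[OF i]]
    show "\<exists>u u' u'' lam. NLS_Kirchhoff_solution src tgt len p lam u u' u''
                          \<and> graph_mass len u = \<mu> \<and> graph_energy len p u u' > 0 \<and> lam > 0"
      using solution[of h "x * amp h" "y * amp h"] R B(2-4) i h0 by (simp add: TM_def M1_def M2_def ff_def)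
  qed
qed

end

section \<open>The line\<close>


context outer
begin

text \<open>Twice the conserved energy, with the derivative divided by \<open>k\<close> to remove
  the scale. Being constant along the edge, it can be read off at either end.\<close>

definition edge_energy :: "real \<times> real \<times> real \<Rightarrow> 'e \<Rightarrow> real" where
  "edge_energy zz e = (ul' zz e 0 / fst zz)\<^sup>2 + 2 * lev p (ul zz e 0)"

lemma edge_energy_const:
  assumes z: "zz \<in> Zs" and x: "x \<in> {0..len e}"
  shows "(ul' zz e x / fst zz)\<^sup>2 + 2 * lev p (ul zz e x) = edge_energy zz e"
proof -
  define f where "f x = (ul' zz e x / fst zz)\<^sup>2 + 2 * lev p (ul zz e x)" for x
  have k: "fst zz > 0" by (rule ZsD(2)[OF z])
  have "\<exists>c. \<forall>x\<in>{0..len e}. f x = c"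
  proof (rule has_field_derivative_zero_constant)
    fix y assume y: "y \<in> {0..len e}"
    have pos: "0 < ul zz e y" by (rule ul_pos[OF z y])
    have d1: "(ul zz e has_real_derivative ul' zz e y) (at y within {0..len e})" by (rule ul_derivs(1)[OF z y])
    have d2: "((\<lambda>x. ul' zz e x / fst zz) has_real_derivative (fst zz)\<^sup>2 * (ul zz e y - ul zz e y powr (p - 1)) / fst zz) (at y within {0..len e})"
      by (intro DERIV_cdivide ul_derivs(2)[OF z y])
    have d3: "((\<lambda>x. lev p (ul zz e x)) has_real_derivative (ul zz e y powr (p - 1) - ul zz e y) * ul' zz e y) (at y within {0..len e})"
      by (rule DERIV_chain2[OF lev_has_derivative d1]) (use pos p6 in auto)
    show "(f has_real_derivative 0) (at y within {0..len e})"
      unfolding f_def[abs_def]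
      by (rule DERIV_cong[OF DERIV_add[OF DERIV_power[OF d2, where n=2] DERIV_cmult[OF d3, of 2]]])
        (use k in \<open>simp add: field_simps power2_eq_square\<close>)
  qed simp
  then have "f x = f 0" using x len_pos[of e] by (metis atLeastAtMost_iff order_refl less_imp_le)
  then show ?thesis by (simp add: f_def edge_energy_def)
qed

lemma edge_energy_vertex:
  assumes z: "zz \<in> Zs" and h: "g \<in> H y"
  shows "edge_energy zz (fst g) = (oder zz g)\<^sup>2 + 2 * lev p (Yl zz y)"
proof -
  have k: "fst zz > 0" by (rule ZsD(2)[OF z])
  have l: "0 \<le> len (fst g)" using len_pos[of "fst g"] by simp
  show ?thesis
  proof (cases "snd g")
    case True
    then have y: "tgt (fst g) = y" and g: "(fst g, True) = g" using h by (auto simp: halfedges_def prod_eq_iff)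
    have "ul' zz (fst g) (len (fst g)) / fst zz = - oder zz g"
      using ul'_oder(2)[OF z, of "fst g"] k g by (simp add: field_simps)
    then show ?thesis using edge_energy_const[OF z, of "len (fst g)" "fst g"] l ul_ends(2)[OF z, of "fst g"] y by simp
  next
    case False
    then have y: "src (fst g) = y" and g: "(fst g, False) = g" using h by (auto simp: halfedges_def prod_eq_iff)
    have "ul' zz (fst g) 0 / fst zz = oder zz g"
      using ul'_oder(1)[OF z, of "fst g"] k g by (simp add: field_simps)
    then show ?thesis using ul_ends(1)[OF z, of "fst g"] y by (simp add: edge_energy_def)
  qed
qed

lemma finite_large_W:
  assumes "d > 0"
  shows "finite {e. d \<le> W e}"
proof (rule ccontr)
  assume inf: "infinite {e. d \<le> W e}"
  define B where "B = 4 * real D * real (card X)"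
  obtain n :: nat where n: "real n * d > B" using reals_Archimedean3[OF assms] by blast
  obtain F where F: "F \<subseteq> {e. d \<le> W e}" "finite F" "card F = n"
    using infinite_arbitrarily_large[OF inf] by blast
  have "real n * d = (\<Sum>e\<in>F. d)" using F by simp
  also have "\<dots> \<le> sum W F" using F by (intro sum_mono) auto
  also have "\<dots> \<le> B" unfolding B_def by (rule sum_W_le[OF F(2)])
  finally show False using n by simp
qed

text \<open>The energy is bounded by a multiple of the edge weight and the weights have bounded
  finite sums; so a nonzero value is taken on finitely many edges only.\<close>

lemma finite_edge_energy:
  assumes z: "zz \<in> Zs" and q: "c \<noteq> 0"
  shows "finite {e. edge_energy zz e = c}"
proof -
  obtain C where C: "C \<ge> 0" "\<And>e x. x \<in> {0..len e} \<Longrightarrow> \<bar>ul' zz e x\<bar> \<le> C * W e"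
    using ul'_bound[OF z] by blast
  note zz = ZsD[OF z]
  define K where "K = 2 * (C / fst zz)\<^sup>2 + 8 * (mx zz)\<^sup>2 + 1"
  have K: "K > 0" by (simp add: K_def add_nonneg_pos)
  have "\<bar>edge_energy zz e\<bar> \<le> K * W e" for e
  proof -
    have x: "0 \<in> {0..len e}" using len_pos[of e] by simp
    have u: "0 < ul zz e 0" "ul zz e 0 \<le> 2 * mx zz * W e" using ul_pos[OF z x] ul_bounds(2)[OF z x] by auto
    have "\<bar>ul' zz e 0 / fst zz\<bar> \<le> C * W e / fst zz"
      using C(2)[OF x] zz(2) by (simp add: abs_divide divide_right_mono)
    then have "(ul' zz e 0 / fst zz)\<^sup>2 \<le> (C * W e / fst zz)\<^sup>2"
      by (metis abs_ge_zero power2_abs power_mono)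
    also have "\<dots> = (C / fst zz)\<^sup>2 * (W e)\<^sup>2" by (simp add: power_mult_distrib power_divide)
    also have "\<dots> \<le> (C / fst zz)\<^sup>2 * (2 * W e)" by (intro mult_left_mono W_sq) simp
    finally have 1: "(ul' zz e 0 / fst zz)\<^sup>2 \<le> 2 * (C / fst zz)\<^sup>2 * W e" by simp
    have u2: "(ul zz e 0)\<^sup>2 \<le> (2 * mx zz * W e)\<^sup>2" using u by (intro power_mono) auto
    also have "\<dots> = 4 * (mx zz)\<^sup>2 * (W e)\<^sup>2" by (simp add: power_mult_distrib)
    also have "\<dots> \<le> 4 * (mx zz)\<^sup>2 * (2 * W e)" by (intro mult_left_mono W_sq) simp
    finally have 2: "(ul zz e 0)\<^sup>2 \<le> 8 * (mx zz)\<^sup>2 * W e" by simp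
    have "lev p (ul zz e 0) \<le> 0"
    proof -
      have "ul zz e 0 * pw (ul zz e) 0 \<le> ul zz e 0 * (eps * ul zz e 0)"
        using pw_bound(2)[OF z adm_lim[OF z] x] u by (intro mult_left_mono) auto
      also have "ul zz e 0 * pw (ul zz e) 0 = ul zz e 0 powr p"
        using u powr_add[of "ul zz e 0" 1 "p - 1"] by (simp add: pw_def)
      also have "ul zz e 0 * (eps * ul zz e 0) \<le> (ul zz e 0)\<^sup>2"
        using eps u mult_right_mono[of eps 1 "ul zz e 0 * ul zz e 0"] by (simp add: power2_eq_square mult_ac)
      finally have "ul zz e 0 powr p / p \<le> (ul zz e 0)\<^sup>2 / 2"
        using p6 by (intro frac_le) auto
      then show ?thesis by (simp add: lev_def)
    qed
    moreover have "- 2 * lev p (ul zz e 0) \<le> (ul zz e 0)\<^sup>2" using p6 by (intro lev_upper) simp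
    ultimately have 3: "\<bar>2 * lev p (ul zz e 0)\<bar> \<le> 8 * (mx zz)\<^sup>2 * W e" using 2 by linarith
    have "\<bar>edge_energy zz e\<bar> \<le> (ul' zz e 0 / fst zz)\<^sup>2 + \<bar>2 * lev p (ul zz e 0)\<bar>"
      unfolding edge_energy_def by (rule order_trans[OF abs_triangle_ineq]) simp
    also have "\<dots> \<le> (2 * (C / fst zz)\<^sup>2 + 8 * (mx zz)\<^sup>2) * W e" using add_mono[OF 1 3] by (simp only: distrib_right)
    also have "\<dots> \<le> K * W e" using W_pos[of e] by (intro mult_right_mono) (auto simp: K_def)
    finally show ?thesis .
  qed
  then have "{e. edge_energy zz e = c} \<subseteq> {e. \<bar>c\<bar> / K \<le> W e}" using K by (auto simp: pos_divide_le_eq mult.commute)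
  moreover have "finite {e. \<bar>c\<bar> / K \<le> W e}" using K q by (intro finite_large_W) simp
  ultimately show ?thesis by (rule finite_subset)
qed

end

context bump
begin

text \<open>If all degrees are two, the outer solution is a half-soliton on either side: its energy is
constant along the two components of the complement of the path and vanishes at infinity.
A parity count of half-edges shows that these components are infinite.\<close>

lemma edge_energy_outer:
  assumes deg: "\<And>y. card (H y) = 2" and inf: "infinite (UNIV :: 'e set)" and zz: "zz \<in> Zs"
    and g: "g \<in> Hout x" and x: "x = vs 0 \<or> x = vs m"
  shows "edge_energy zz (fst g) = 0"
proof (rule ccontr)
  assume q: "edge_energy zz (fst g) \<noteq> 0"
  \<comment> \<open>Off-path edges sharing the nonzero energy of the given one; a finite set, since
    the energy tends to zero at infinity.\<close>
  define S where "S = {e. edge_energy zz e = edge_energy zz (fst g)} - P"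
  have finS: "finite S" unfolding S_def using finite_edge_energy[OF zz q] by simp
  have gS: "fst g \<in> S" "g \<in> H x" using g by (auto simp: S_def Hout_def)
  have fP: "finite P" by (simp add: P_def)
  \<comment> \<open>At a vertex of degree two the Kirchhoff condition makes the two outgoing
    derivatives opposite, so both half-edges carry the same energy.\<close>
  have pair: "fst h' \<in> S" if y: "y \<notin> Vx" and h: "h \<in> H y" "h' \<in> H y" and hS: "fst h \<in> S" for y h h'
  proof (cases "h = h'")
    case False
    have "H y = {h, h'}"
      using h False deg[of y] finH[of y] card_subset_eq[of "H y" "{h, h'}"] by simp
    then have "oder zz h + oder zz h' = 0" using kirchhoff_outer[OF zz y] False by simp
    then have "(oder zz h)\<^sup>2 = (oder zz h')\<^sup>2" by (simp add: add_eq_0_iff)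
    then have "edge_energy zz (fst h') = edge_energy zz (fst h)"
      using edge_energy_vertex[OF zz h(1)] edge_energy_vertex[OF zz h(2)] by simp
    then show ?thesis using hS H_off_path[OF y h(2)] by (simp add: S_def)
  qed (use hS in simp)
  \<comment> \<open>All half-edges of \<open>S\<close>, two per edge, hence an even number. Counted
    by vertices, only the two ends of the path can contribute an odd amount.\<close>
  define A where "A = S \<times> (UNIV :: bool set)"
  have finA: "finite A" using finS by (simp add: A_def)
  have evenA: "even (card A)" by (simp add: A_def card_cartesian_product)
  define t where "t y = card (A \<inter> H y)" for y
  have tout: "A \<inter> H y = {h \<in> Hout y. fst h \<in> S}" for y by (auto simp: A_def Hout_def S_def)
  have cardHout: "card (Hout (vs 0)) = 1" "card (Hout (vs m)) = 1"
    using deg[of "vs 0"] deg[of "vs m"] Hout_first Hout_last finH[of "vs 0"] finH[of "vs m"]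
    by (auto simp: card_insert_if)
  have t_le: "t y \<le> 1" if "y = vs 0 \<or> y = vs m" for y
  proof -
    have "t y \<le> card (Hout y)" unfolding t_def tout using finH[of y] by (intro card_mono) (auto simp: Hout_def)
    then show ?thesis using that cardHout by auto
  qed
  have even_t: "even (t y)" if y: "y \<noteq> vs 0" "y \<noteq> vs m" for y
  proof (cases "y \<in> Vx")
    case True
    then obtain i where "i \<le> m" "y = vs i" by auto
    then have i: "0 < i" "i < m" "y = vs i" using y by (cases i; auto simp: le_less)+
    have "Hout y = {}" using H_interior(1)[OF i(1,2)] i by (auto simp: Hout_def P_def)
    then show ?thesis by (simp add: t_def tout)
  next
    case False
    show ?thesis
    proof (cases "A \<inter> H y = {}")
      case False
      then obtain h where h: "h \<in> H y" "fst h \<in> S" by (auto simp: A_def)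
      have "fst h' \<in> S" if "h' \<in> H y" for h' by (rule pair[OF \<open>y \<notin> Vx\<close> h(1) that h(2)])
      then have "H y \<subseteq> A" by (auto simp: A_def mem_Times_iff)
      then have "A \<inter> H y = H y" by blast
      then show ?thesis by (simp add: t_def deg)
    qed (simp add: t_def)
  qed
  define bb where "bb h = (if snd h then tgt (fst h) else src (fst h))" for h :: "'e \<times> bool"
  define VS where "VS = insert (vs 0) (insert (vs m) (bb ` A))"
  have finVS: "finite VS" using finA by (simp add: VS_def)
  have bbH: "h \<in> H y \<longleftrightarrow> bb h = y" for h y by (auto simp: halfedges_def bb_def)
  have "card A = (\<Sum>y\<in>VS. card {h \<in> A. bb h = y})"
    using sum.group[OF finA finVS, of bb "\<lambda>_. 1::nat"] by (simp add: VS_def image_subset_iff)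
  also have "\<dots> = (\<Sum>y\<in>VS. t y)"
    by (rule sum.cong[OF refl]) (auto simp: t_def bbH intro: arg_cong[where f=card])
  also have "\<dots> = t (vs 0) + (t (vs m) + (\<Sum>y\<in>VS - {vs 0, vs m}. t y))"
  proof -
    have ne: "vs 0 \<noteq> vs m" using vs_eq[of 0 m] m_pos by simp
    have "(\<Sum>y\<in>VS. t y) = t (vs 0) + (\<Sum>y\<in>VS - {vs 0}. t y)"
      using finVS by (intro sum.remove) (auto simp: VS_def)
    also have "(\<Sum>y\<in>VS - {vs 0}. t y) = t (vs m) + (\<Sum>y\<in>VS - {vs 0} - {vs m}. t y)"
      using finVS ne by (intro sum.remove) (auto simp: VS_def)
    also have "VS - {vs 0} - {vs m} = VS - {vs 0, vs m}" by auto
    finally show ?thesis .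
  qed
  finally have "even (t (vs 0) + (t (vs m) + (\<Sum>y\<in>VS - {vs 0, vs m}. t y)))" using evenA by simp
  moreover have "even (\<Sum>y\<in>VS - {vs 0, vs m}. t y)" by (intro dvd_sum even_t) auto
  ultimately have par: "even (t (vs 0) + t (vs m))" by simp
  have "t x \<noteq> 0"
  proof -
    have "g \<in> A \<inter> H x" using gS by (simp add: A_def mem_Times_iff)
    then show ?thesis unfolding t_def using finA by (metis card_eq_0_iff empty_iff finite_Int)
  qed
  \<comment> \<open>The end at \<open>x\<close> contributes exactly one half-edge, so by parity the
    other end does as well.\<close>
  then have t1: "t (vs 0) = 1" "t (vs m) = 1"
    using par x t_le[of "vs 0"] t_le[of "vs m"] by (auto simp: le_Suc_eq)
  have sub: "fst h \<in> S" if y: "y = vs 0 \<or> y = vs m" and h: "h \<in> Hout y" for y h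
  proof -
    have "card {h \<in> Hout y. fst h \<in> S} = card (Hout y)"
      using t1 cardHout y unfolding t_def tout by auto
    moreover have "finite (Hout y)" using finH[of y] by (simp add: Hout_def)
    ultimately have "{h \<in> Hout y. fst h \<in> S} = Hout y" by (intro card_subset_eq) auto
    then show ?thesis using h by blast
  qed
  \<comment> \<open>With the outer half-edges of both ends in \<open>S\<close>, no edge leads out of
    \<open>S\<close> and \<open>P\<close> together; by connectedness they would exhaust the infinite
    edge set.\<close>
  have closed: "fst h' \<in> S \<union> P" if h: "h \<in> H y" "h' \<in> H y" and hS: "fst h \<in> S \<union> P" for y h h'
  proof (cases "y \<in> Vx")
    case False
    then show ?thesis using pair[OF False h] H_off_path[OF False h(1)] hS by blast
  next
    case True
    then obtain i where i: "i \<le> m" "y = vs i" by auto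
    consider "i = 0 \<or> i = m" | "0 < i" "i < m" using i by linarith
    then show ?thesis
    proof cases
      case 1
      then show ?thesis using sub[of y h'] h(2) i by (cases "fst h' \<in> P") (auto simp: Hout_def)
    next
      case 2
      then show ?thesis using H_interior(1)[OF 2] h(2) i by (auto simp: P_def)
    qed
  qed
  have all: "\<forall>h\<in>H y. fst h \<in> S \<union> P" for y
    using conn[of x y]
  proof (induction rule: rtrancl_induct)
    case base
    then show ?case using closed[OF gS(2)] gS(1) by blast
  next
    case (step y y')
    then obtain h where h: "h \<in> H y" "far h = y'" by (auto simp: adj_far)
    have "(fst h, \<not> snd h) \<in> H y'" using far_H(1)[OF h(1)] h(2) by simp
    moreover have "fst h \<in> S \<union> P" using step.IH h by blast
    ultimately show ?case using closed by fastforce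
  qed
  have "UNIV \<subseteq> S \<union> P" using all H_src by fastforce
  then show False using inf finS fP finite_subset by blast
qed

text \<open>At \<open>h = hs\<close> the slope of the orbit and the outer derivative have the same
  square \<open>- 2 * lev p r\<close>, the latter because the outer edge energy is zero;
  \<open>oder_bounds\<close> settles the sign. So matching holds for every small \<open>r\<close>,
  and \<open>r\<close> is left to adjust the mass.\<close>

lemma line_case:
  assumes deg: "\<And>y. card (H y) = 2" and inf: "infinite (UNIV :: 'e set)"
  shows "\<exists>\<mu>0>0. \<forall>\<mu>. 0 < \<mu> \<and> \<mu> \<le> \<mu>0 \<longrightarrow>
           (\<exists>u u' u'' lam. NLS_Kirchhoff_solution src tgt len p lam u u' u''
                          \<and> graph_mass len u = \<mu> \<and> graph_energy len p u u' > 0 \<and> lam > 0)"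
proof -
  have hsH: "hs \<le> hs" "hs \<le> Hh" using H_def by auto
  obtain r0 where r0: "r0 > 0" "\<And>h rr a b. adms 1 h rr a b \<Longrightarrow> rr \<le> r0 \<Longrightarrow>
    0 < a \<and> a < h \<and> 0 < b \<and> b < h \<and> rr \<le> 1 \<and> zpar h a b \<in> Zs \<and>
    (a * sig h a + b * sig h b) / 4 + scale h a b / p * omass (- P) (zpar h a b)
             < (p - 6) / (4 * p) * (halfpow h a + halfpow h b)"
    using small_params[of 1] by (metis order_refl zero_less_one)
  have adm: "adms 1 hs r r r" if "r > 0" for r using that hsH by (simp add: adms_def amp_hs)
  note R = r0(2)[OF adm]
  have cardHout: "card (Hout (vs 0)) = 1" "card (Hout (vs m)) = 1"
    using deg[of "vs 0"] deg[of "vs m"] Hout_first Hout_last finH[of "vs 0"] finH[of "vs m"]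
    by (auto simp: card_insert_if)
  have match: "sig hs r + (\<Sum>g\<in>Hout x. oder (zpar hs r r) g) = 0"
    if r: "0 < r" "r \<le> r0" and x: "x = vs 0 \<or> x = vs m" for r x
  proof -
    have zz: "zpar hs r r \<in> Zs" using R[OF r] by blast
    obtain g where g: "Hout x = {g}" using cardHout x by (auto simp: card_1_singleton_iff)
    have gH: "g \<in> H x" "g \<in> Hout x" using g by (auto simp: Hout_def)
    have xV: "x \<in> Vx" using x by auto
    have d: "data (zpar hs r r) x = r" by (simp add: data_def zpar_def)
    have "(oder (zpar hs r r) g)\<^sup>2 = 2 * (lev p hs - lev p r)"
      using edge_energy_outer[OF deg inf zz gH(2) x] edge_energy_vertex[OF zz gH(1)] Yl_X[OF zz xV] d lev_sol_height[OF p2]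
      by simp
    moreover have "oder (zpar hs r r) g < 0"
    proof -
      have "9 * eps * r \<le> 9/100 * r" using eps r by (intro mult_right_mono) auto
      moreover have "oder (zpar hs r r) g \<le> - r + 9 * eps * r"
        using oder_bounds(2)[OF zz gH(1) xV] d by (simp add: mx_zpar)
      ultimately show ?thesis using r by linarith
    qed
    ultimately have "sig hs r = - oder (zpar hs r r) g" unfolding sig_def by (metis abs_of_neg real_sqrt_abs)
    then show ?thesis using g by simp
  qed
  have A: "(hs, r, r) \<in> Adom" if "0 < r" "r \<le> r0" for r
    using R[OF that] hsH by (auto simp: Adom_def)
  define f where "f r = total_mass hs r r" for r
  have cont: "continuous_on {r1..r0} f" if "r1 > 0" for r1
    unfolding f_def
    by (rule continuous_on_compose2[OF total_mass_continuous, where f="\<lambda>r. (hs, r, r)", simplified])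
      (use A that in \<open>auto intro!: continuous_intros\<close>)
  have f0: "0 < f r0"
    unfolding f_def using A[OF r0(1)] R[OF r0(1) order_refl] by (intro total_mass_pos) auto
  show ?thesis
  proof (intro exI[of _ "f r0"] conjI f0 allI impI)
    fix \<mu> assume \<mu>: "0 < \<mu> \<and> \<mu> \<le> f r0"
    obtain r1 where r1: "r1 > 0" "\<And>h rr a b. adms 1 h rr a b \<Longrightarrow> rr \<le> r1 \<Longrightarrow> total_mass h a b < \<mu>"
      using mass_small[of 1 \<mu>] \<mu> by (metis order_refl zero_less_one)
    define r2 where "r2 = min r1 r0"
    have r2: "0 < r2" "r2 \<le> r1" "r2 \<le> r0" using r1 r0 by (auto simp: r2_def)
    have "f r2 < \<mu>" unfolding f_def by (rule r1(2)[OF adm[OF r2(1)] r2(2)])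
    then obtain r where r: "r2 \<le> r" "r \<le> r0" "f r = \<mu>"
      using IVT'[of f r2 \<mu> r0] \<mu> r2 cont[OF r2(1)] by auto
    have rp: "0 < r" using r r2 by simp
    show "\<exists>u u' u'' lam. NLS_Kirchhoff_solution src tgt len p lam u u' u''
                          \<and> graph_mass len u = \<mu> \<and> graph_energy len p u u' > 0 \<and> lam > 0"
      using solution[OF hsH, of r r] R[OF rp r(2)] match[OF rp r(2)] r(3)
      by (simp add: match1_def match2_def f_def)
  qed
qed

end

section \<open>Periodic graphs\<close>


context metric_graph
begin

definition is_path :: "(nat \<Rightarrow> 'v) \<Rightarrow> nat \<Rightarrow> (nat \<Rightarrow> 'e) \<Rightarrow> (nat \<Rightarrow> bool) \<Rightarrow> bool" where
  "is_path vs m es bs \<longleftrightarrow> 0 < m \<and> inj_on vs {0..m} \<and>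
     (\<forall>i<m. (es i, bs i) \<in> H (vs i) \<and> far (es i, bs i) = vs (Suc i))"

text \<open>A shortest walk among all pairs of distinct points of \<open>T\<close>: a repeated
  vertex could be cut out, and an interior point in \<open>T\<close> would give a shorter walk
  between distinct points.\<close>

lemma shortest_path:
  assumes xy: "x \<in> T" "y \<in> T" "x \<noteq> y"
  shows "\<exists>vs m es bs. is_path vs m es bs \<and> vs 0 \<in> T \<and> vs m \<in> T \<and> (\<forall>i. 0 < i \<and> i < m \<longrightarrow> vs i \<notin> T)"
proof -
  let ?R = "graph_adj src tgt"
  define Q where "Q n \<longleftrightarrow> (\<exists>x\<in>T. \<exists>y\<in>T. x \<noteq> y \<and> (x, y) \<in> ?R ^^ n)" for n
  have "\<exists>n. Q n" using conn[of x y] xy by (auto simp: Q_def rtrancl_power)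
  define m where "m = (LEAST n. Q n)"
  have Qm: "Q m" unfolding m_def using \<open>\<exists>n. Q n\<close> by (rule LeastI_ex)
  have least: "\<not> Q n" if "n < m" for n using that unfolding m_def by (rule not_less_Least)
  obtain vs where vs: "vs 0 \<in> T" "vs m \<in> T" "vs 0 \<noteq> vs m" "\<And>i. i < m \<Longrightarrow> (vs i, vs (Suc i)) \<in> ?R"
    using Qm unfolding Q_def relpow_fun_conv by blast
  have m: "0 < m" using vs(3) by (cases m) auto
  have sub: "(vs i, vs j) \<in> ?R ^^ (j - i)" if "i \<le> j" "j \<le> m" for i j
    unfolding relpow_fun_conv using that vs(4) by (intro exI[of _ "\<lambda>k. vs (i + k)"]) auto
  have neq: "vs i \<noteq> vs j" if ij: "i < j" "j \<le> m" for i j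
  proof
    assume eq: "vs i = vs j"
    have "(vs 0, vs i) \<in> ?R ^^ i" "(vs i, vs m) \<in> ?R ^^ (m - j)"
      using sub[of 0 i] sub[of j m] ij eq by auto
    then have "(vs 0, vs m) \<in> ?R ^^ (i + (m - j))" by (auto simp: relpow_add)
    then have "Q (i + (m - j))" using vs by (auto simp: Q_def)
    moreover have "i + (m - j) < m" using ij by simp
    ultimately show False using least by blast
  qed
  have inj: "inj_on vs {0..m}"
    unfolding inj_on_def using neq by (metis atLeastAtMost_iff linorder_neqE_nat)
  have int: "vs i \<notin> T" if i: "0 < i" "i < m" for i
  proof
    assume "vs i \<in> T"
    then have "Q i" using sub[of 0 i] i vs(1) neq[of 0 i] by (auto simp: Q_def)
    then show False using least i by blast
  qed
  have "\<forall>i. \<exists>h. i < m \<longrightarrow> h \<in> H (vs i) \<and> far h = vs (Suc i)" using vs(4) unfolding adj_far by blast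
  then obtain hh where hh: "\<And>i. i < m \<Longrightarrow> hh i \<in> H (vs i) \<and> far (hh i) = vs (Suc i)" by metis
  have "is_path vs m (\<lambda>i. fst (hh i)) (\<lambda>i. snd (hh i))"
    using m inj hh by (simp add: is_path_def)
  with vs int show ?thesis by blast
qed

text \<open>The two path half-edges at \<open>vs i\<close> differ because their far ends do, and the
  degree leaves no room for a third one.\<close>

lemma path_interior_degree_2:
  assumes p: "is_path vs m es bs" and i: "0 < i" "i < m" and card: "card (H (vs i)) \<le> 2"
  shows "H (vs i) = {(es i, bs i), (es (i - 1), \<not> bs (i - 1))}"
proof -
  have 1: "(es i, bs i) \<in> H (vs i)" "far (es i, bs i) = vs (Suc i)" using p i by (auto simp: is_path_def)
  have "(es (i - 1), bs (i - 1)) \<in> H (vs (i - 1)) \<and> far (es (i - 1), bs (i - 1)) = vs (Suc (i - 1))"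
    using p i by (simp add: is_path_def)
  then have 2: "(es (i - 1), \<not> bs (i - 1)) \<in> H (vs i)" "far (es (i - 1), \<not> bs (i - 1)) = vs (i - 1)"
    using far_H[of "(es (i - 1), bs (i - 1))" "vs (i - 1)"] i by auto
  have "vs (Suc i) \<noteq> vs (i - 1)"
  proof
    assume "vs (Suc i) = vs (i - 1)"
    moreover have "inj_on vs {0..m}" using p by (simp add: is_path_def)
    ultimately have "Suc i = i - 1" using i by (auto dest: inj_onD)
    then show False by simp
  qed
  then have ne: "(es i, bs i) \<noteq> (es (i - 1), \<not> bs (i - 1))" using 1(2) 2(2) by metis
  have "{(es i, bs i), (es (i - 1), \<not> bs (i - 1))} = H (vs i)"
    using 1(1) 2(1) ne card by (intro card_seteq finH) auto
  then show ?thesis ..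
qed

lemma ex_bump:
  assumes p: "is_path vs m es bs" and int: "\<And>i. 0 < i \<Longrightarrow> i < m \<Longrightarrow> card (H (vs i)) \<le> 2"
  shows "\<exists>K0 m0 Hh L ps ys. bump src tgt len p e0 Lm D vs m K0 m0 Hh L ps ys es bs"
proof -
  have eps: "outer_eps D > 0" by (simp add: outer_eps_def)
  \<comment> \<open>Both smallness conditions hold with equality: \<open>sinh (K0 * e0)\<close> is
    \<open>1 / outer_eps D\<close>, and the Lipschitz bound at \<open>4 * m0\<close> is
    \<open>outer_eps D\<close>.\<close>
  define K0 where "K0 = arsinh (1 / outer_eps D) / e0"
  define m0 where "m0 = (outer_eps D / (p - 1)) powr (1 / (p - 2)) / 4"
  have K0: "K0 > 0" "1 / sinh (K0 * e0) \<le> outer_eps D" using e0(1) eps by (simp_all add: K0_def)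
  have "p - 2 \<noteq> 0" using p6 by simp
  then have "(4 * m0) powr (p - 2) = outer_eps D / (p - 1)"
    using eps p6 by (simp add: m0_def powr_powr)
  then have m0: "m0 > 0" "(p - 1) * (4 * m0) powr (p - 2) \<le> outer_eps D" using eps p6 by (simp_all add: m0_def)
  obtain L ps ys where "profile p (sol_height p + 1) L ps ys" using profile_exists[OF p6] by blast
  then interpret profile p "sol_height p + 1" L ps ys .
  have "bump src tgt len p e0 Lm D vs m K0 m0 (sol_height p + 1) L ps ys es bs"
  proof unfold_locales
    show "finite (vs ` {0..m})" "vs ` {0..m} \<noteq> {}" by auto
    show "0 < m" "inj_on vs {0..m}" "\<And>i. i < m \<Longrightarrow> (es i, bs i) \<in> H (vs i)" "\<And>i. i < m \<Longrightarrow> far (es i, bs i) = vs (Suc i)"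
      using p by (auto simp: is_path_def)
    show "H (vs i) \<subseteq> {(es i, bs i), (es (i - 1), \<not> bs (i - 1))}" if "0 < i" "i < m" for i
      using path_interior_degree_2[OF p that int[OF that]] by simp
  qed (use K0 m0 in auto)
  then show ?thesis by blast
qed

text \<open>A path between two leaves whose interior vertices have degree two has no exit, so by
  connectedness it is the whole graph, which then has finitely many edges.\<close>

lemma no_leaves_on_line:
  assumes le2: "\<And>y. card (H y) \<le> 2" and inf: "infinite (UNIV :: 'e set)"
    and leaves: "card (H x) = 1" "card (H y) = 1" "x \<noteq> y"
  shows False
proof -
  obtain vs m es bs where p: "is_path vs m es bs" and T: "card (H (vs 0)) = 1" "card (H (vs m)) = 1"
    using shortest_path[of x "{y. card (H y) = 1}" y] leaves by auto
  have m: "0 < m" using p by (simp add: is_path_def)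
  have pe: "i < m \<Longrightarrow> (es i, bs i) \<in> H (vs i)" "i < m \<Longrightarrow> far (es i, bs i) = vs (Suc i)" for i
    using p by (auto simp: is_path_def)
  have bk: "(es (i - 1), \<not> bs (i - 1)) \<in> H (vs i)" "far (es (i - 1), \<not> bs (i - 1)) = vs (i - 1)" if "0 < i" "i \<le> m" for i
    using far_H[OF pe(1)[of "i - 1"]] pe(2)[of "i - 1"] that by auto
  have closed: "far h \<in> vs ` {0..m}" if i: "i \<le> m" and h: "h \<in> H (vs i)" for i h
  proof -
    consider "i = 0" | "i = m" | "0 < i" "i < m" using i by linarith
    then show ?thesis
    proof cases
      case 1
      then have "h = (es 0, bs 0)" using T(1) h pe(1)[OF m] by (auto simp: card_1_singleton_iff)
      then show ?thesis using pe(2)[OF m] m by auto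
    next
      case 2
      then have "h = (es (m - 1), \<not> bs (m - 1))" using T(2) h bk(1)[OF m order_refl] by (auto simp: card_1_singleton_iff)
      then show ?thesis using bk(2)[OF m order_refl] by auto
    next
      case 3
      have "h = (es i, bs i) \<or> h = (es (i - 1), \<not> bs (i - 1))"
        using path_interior_degree_2[OF p 3 le2] h by blast
      then have "far h = vs (Suc i) \<or> far h = vs (i - 1)" using pe(2)[OF 3(2)] bk(2)[OF 3(1) i] by blast
      then show ?thesis using 3 by (auto intro!: imageI)
    qed
  qed
  have "y \<in> vs ` {0..m}" for y
    using conn[of "vs 0" y]
  proof (induction rule: rtrancl_induct)
    case (step y z)
    then show ?case using closed by (auto simp: adj_far)
  qed simp
  then have V: "src e \<in> vs ` {0..m}" for e by blast
  have "UNIV \<subseteq> (\<Union>y\<in>vs ` {0..m}. fst ` H y)"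
  proof
    fix e :: 'e
    have "e \<in> fst ` H (src e)" by (rule rev_image_eqI[OF H_src]) simp
    then show "e \<in> (\<Union>y\<in>vs ` {0..m}. fst ` H y)" using V by blast
  qed
  moreover have "finite (\<Union>y\<in>vs ` {0..m}. fst ` H y)" using finH by auto
  ultimately show False using inf finite_subset by blast
qed

end

section \<open>The group action and the conclusion\<close>

lemma Zd_periodic_actionD:
  assumes act: "Zd_periodic_action src tgt len d sv se rv"
  shows "sv (\<lambda>_. 0) = id" "se (\<lambda>_. 0) = id"
    and "\<And>g h. g \<in> Zd d \<Longrightarrow> h \<in> Zd d \<Longrightarrow> sv (\<lambda>i. g i + h i) = sv g \<circ> sv h"
    and "\<And>g h. g \<in> Zd d \<Longrightarrow> h \<in> Zd d \<Longrightarrow> se (\<lambda>i. g i + h i) = se g \<circ> se h"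
    and "\<And>g e. g \<in> Zd d \<Longrightarrow>
      if rv g e then src (se g e) = sv g (tgt e) \<and> tgt (se g e) = sv g (src e)
      else src (se g e) = sv g (src e) \<and> tgt (se g e) = sv g (tgt e)"
    and "\<And>g v. g \<in> Zd d \<Longrightarrow> g \<noteq> (\<lambda>_. 0) \<Longrightarrow> sv g v \<noteq> v"
    and "\<exists>FV FE. finite FV \<and> finite FE \<and>
        (\<forall>v. \<exists>g\<in>Zd d. \<exists>w\<in>FV. v = sv g w) \<and> (\<forall>e. \<exists>g\<in>Zd d. \<exists>f\<in>FE. e = se g f)"
proof -
  note c = act[unfolded Zd_periodic_action_def]
  note c2 = conjunct2[OF conjunct2[OF conjunct2[OF c]]]
  show "sv (\<lambda>_. 0) = id" "se (\<lambda>_. 0) = id" by (rule conjunct1[OF c], rule conjunct1[OF conjunct2[OF c]])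
  fix g h assume g: "g \<in> Zd d" "h \<in> Zd d"
  note gh = conjunct1[OF c2, rule_format, OF g]
  show "sv (\<lambda>i. g i + h i) = sv g \<circ> sv h" by (rule conjunct1[OF gh])
  show "se (\<lambda>i. g i + h i) = se g \<circ> se h" by (rule conjunct1[OF conjunct2[OF gh]])
next
  note c = conjunct2[OF conjunct2[OF conjunct2[OF conjunct2[OF act[unfolded Zd_periodic_action_def]]]]]
  show "if rv g e then src (se g e) = sv g (tgt e) \<and> tgt (se g e) = sv g (src e)
      else src (se g e) = sv g (src e) \<and> tgt (se g e) = sv g (tgt e)" if "g \<in> Zd d" for g e
    using conjunct1[OF c] that by metis
  show "sv g v \<noteq> v" if "g \<in> Zd d" "g \<noteq> (\<lambda>_. 0)" for g v
    using conjunct1[OF conjunct2[OF c]] that by metis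
  show "\<exists>FV FE. finite FV \<and> finite FE \<and>
        (\<forall>v. \<exists>g\<in>Zd d. \<exists>w\<in>FV. v = sv g w) \<and> (\<forall>e. \<exists>g\<in>Zd d. \<exists>f\<in>FE. e = se g f)"
    by (rule conjunct2[OF conjunct2[OF c]])
qed

text \<open>The isometry maps half-edges injectively to half-edges, exchanging the two ends when it
  reverses the edge; the inverse group element gives the opposite inequality.\<close>

lemma Zd_action_degree:
  fixes src tgt :: "'e \<Rightarrow> 'v"
  assumes act: "Zd_periodic_action src tgt len d sv se rv" and fin: "\<And>v. finite (halfedges src tgt v)"
    and g: "g \<in> Zd d"
  shows "card (halfedges src tgt (sv g v)) = card (halfedges src tgt v)"
proof -
  have le: "card (halfedges src tgt v) \<le> card (halfedges src tgt (sv g v))" if g: "g \<in> Zd d" for g v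
  proof (rule card_inj_on_le[OF _ _ fin])
    have g': "(\<lambda>i. - g i) \<in> Zd d" using g by (simp add: Zd_def)
    have "se (\<lambda>i. - g i + g i) = se (\<lambda>i. - g i) \<circ> se g"
      by (rule Zd_periodic_actionD(4)[OF act g' g])
    with Zd_periodic_actionD(2)[OF act] have "se (\<lambda>i. - g i) (se g e) = e" for e by (simp add: fun_eq_iff)
    then have inj: "se g e = se g e' \<Longrightarrow> e = e'" for e e' by metis
    show "inj_on (\<lambda>h. (se g (fst h), snd h \<noteq> rv g (fst h))) (halfedges src tgt v)"
      by (rule inj_onI) (auto simp: prod_eq_iff dest!: inj)
    show "(\<lambda>h. (se g (fst h), snd h \<noteq> rv g (fst h))) ` halfedges src tgt v \<subseteq> halfedges src tgt (sv g v)"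
      using Zd_periodic_actionD(5)[OF act g] by (force simp: halfedges_def split: if_splits)
  qed
  have g': "(\<lambda>i. - g i) \<in> Zd d" using g by (simp add: Zd_def)
  have "sv (\<lambda>i. - g i + g i) = sv (\<lambda>i. - g i) \<circ> sv g"
    by (rule Zd_periodic_actionD(3)[OF act g' g])
  with Zd_periodic_actionD(1)[OF act] have "sv (\<lambda>i. - g i) (sv g v) = v" by (simp add: fun_eq_iff)
  with le[OF g, of v] le[OF g', of "sv g v"] show ?thesis by simp
qed

theorem theorem1p2:
  fixes src tgt :: "'e \<Rightarrow> 'v" and len :: "'e \<Rightarrow> real" and p :: real
  assumes "in_class_G src tgt len"
    and "periodic_graph src tgt len"
    and "p > 6"
  shows "\<exists>\<mu>0>0. \<forall>\<mu>. 0 < \<mu> \<and> \<mu> \<le> \<mu>0 \<longrightarrow>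
           (\<exists>u u' u'' lam. NLS_Kirchhoff_solution src tgt len p lam u u' u''
                          \<and> graph_mass len u = \<mu>
                          \<and> graph_energy len p u u' > 0
                          \<and> lam > 0)"
proof -
  obtain e0 where e0: "e0 > 0" "\<And>e. e0 \<le> len e" using assms(1) by (auto simp: in_class_G_def)
  have conn: "(v, w) \<in> (graph_adj src tgt)\<^sup>*" for v w
    using assms(1) by (auto simp: in_class_G_def graph_connected_def)
  have finH: "finite (halfedges src tgt v)" for v
  proof (rule finite_subset)
    show "halfedges src tgt v \<subseteq> {e. src e = v \<or> tgt e = v} \<times> UNIV" by (auto simp: halfedges_def split: if_splits)
    show "finite ({e. src e = v \<or> tgt e = v} \<times> (UNIV :: bool set))" using assms(1) by (auto simp: in_class_G_def)
  qed
  have inf: "infinite (UNIV :: 'e set)" using assms(2) by (auto simp: periodic_graph_def)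
  obtain Lm where Lm: "\<And>e. len e \<le> Lm" using assms(2) by (auto simp: periodic_graph_def)
  obtain d sv se rv where act: "Zd_periodic_action src tgt len d sv se rv"
    using assms(2) by (auto simp: periodic_graph_def)
  obtain FV FE where F: "finite FV" "finite FE" "\<And>v. \<exists>g\<in>Zd d. \<exists>w\<in>FV. v = sv g w" "\<And>e. \<exists>g\<in>Zd d. \<exists>f\<in>FE. e = se g f"
    using Zd_periodic_actionD(7)[OF act] by blast
  note deg_inv = Zd_action_degree[OF act finH]
  \<comment> \<open>Degrees are constant on orbits and there are finitely many orbits, so the
    maximum over representatives bounds all degrees.\<close>
  define D where "D = Max ((\<lambda>v. card (halfedges src tgt v)) ` FV)"
  have cardH: "card (halfedges src tgt v) \<le> D" for v
  proof -
    obtain g w where "g \<in> Zd d" "w \<in> FV" "v = sv g w" using F(3) by blast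
    then show ?thesis using deg_inv F(1) by (auto simp: D_def)
  qed
  \<comment> \<open>Some translation is nontrivial, since otherwise all edges would lie in the
    finite set \<open>FE\<close>.\<close>
  obtain g where g: "g \<in> Zd d" "g \<noteq> (\<lambda>_. 0)"
  proof -
    have "\<exists>g\<in>Zd d. g \<noteq> (\<lambda>_. 0)"
    proof (rule ccontr)
      assume "\<not> ?thesis"
      then have "e \<in> FE" for e using F(4)[of e] Zd_periodic_actionD(2)[OF act] by auto
      then have "UNIV \<subseteq> FE" by blast
      then show False using inf F(2) finite_subset by blast
    qed
    then show ?thesis using that by blast
  qed
  have moved: "sv g v \<noteq> v" for v by (rule Zd_periodic_actionD(6)[OF act g])
  have neH: "halfedges src tgt v \<noteq> {}" for v
  proof -
    have "(v, sv g v) \<in> (graph_adj src tgt)\<^sup>*" by (rule conn)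
    then obtain w where "(v, w) \<in> graph_adj src tgt" using moved[of v] by (metis converse_rtranclE)
    then obtain e where "src e = v \<or> tgt e = v" by (auto simp: graph_adj_def)
    then have "(e, False) \<in> halfedges src tgt v \<or> (e, True) \<in> halfedges src tgt v" by (auto simp: halfedges_def)
    then show ?thesis by blast
  qed
  interpret metric_graph src tgt len p e0 Lm D
    using e0 Lm finH cardH neH conn assms(3) by unfold_locales auto
  consider (branch) v where "3 \<le> card (H v)" | (line) "\<And>v. card (H v) \<le> 2"
  proof (cases "\<exists>v. 3 \<le> card (H v)")
    case False
    have "card (H v) \<le> 2" for v
    proof -
      have "\<not> 3 \<le> card (H v)" using False by blast
      then show ?thesis by linarith
    qed
    then show ?thesis using that by blast
  qed (use that in blast)
  then show ?thesis
  proof cases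
    case branch
    \<comment> \<open>The translate of a branching vertex is a second one, distinct by freeness; a
      shortest path between branching vertices has interior degrees at most two.\<close>
    then have "sv g v \<in> {v. 3 \<le> card (H v)}" "v \<in> {v. 3 \<le> card (H v)}" using deg_inv[OF g(1), of v] by auto
    from shortest_path[OF this moved] obtain vs m es bs where p: "is_path vs m es bs"
      and T: "3 \<le> card (H (vs 0))" "3 \<le> card (H (vs m))" and int: "\<And>i. 0 < i \<Longrightarrow> i < m \<Longrightarrow> \<not> 3 \<le> card (H (vs i))"
      by blast
    have "card (H (vs i)) \<le> 2" if "0 < i" "i < m" for i using int[OF that] by linarith
    from ex_bump[OF p this]
    obtain K0 m0 Hh L ps ys where "bump src tgt len p e0 Lm D vs m K0 m0 Hh L ps ys es bs" by blast
    then interpret b: bump src tgt len p e0 Lm D vs m K0 m0 Hh L ps ys es bs .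
    have "2 \<le> card (b.Hout (vs 0))" "2 \<le> card (b.Hout (vs m))"
      using T b.Hout_first b.Hout_last finH[of "vs 0"] finH[of "vs m"] by (auto simp: card_insert_if)
    then show ?thesis by (rule b.branching_case)
  next
    case line
    \<comment> \<open>A leaf would come with its translate, a second leaf.\<close>
    have deg2: "card (H v) = 2" for v
    proof (rule ccontr)
      assume "card (H v) \<noteq> 2"
      moreover have "card (H v) \<noteq> 0" using neH finH by (simp add: card_eq_0_iff)
      ultimately have "card (H v) = 1" using line[of v] by linarith
      then show False using no_leaves_on_line[OF line inf, of "sv g v" v] deg_inv[OF g(1), of v] moved[of v] by simp
    qed
    obtain vs m es bs where p: "is_path vs m es bs"
      using shortest_path[of "sv g v" UNIV v for v] moved by blast
    obtain K0 m0 Hh L ps ys where "bump src tgt len p e0 Lm D vs m K0 m0 Hh L ps ys es bs"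
      using ex_bump[OF p line] by blast
    then interpret b: bump src tgt len p e0 Lm D vs m K0 m0 Hh L ps ys es bs .
    show ?thesis by (rule b.line_case[OF deg2 inf])
  qed
qed

end
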